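(* Let $(p_j)_{j\in\mathbb{Z}}$ be real numbers with $0<p_j\le 1/2$ for all $j\in\mathbb{Z}$ and $\min_{j\in\mathbb{Z}}p_j<1/2$. Suppose that there are constants $\gamma_1,\gamma_2$ with $1\le\gamma_2<\gamma_1<\infty$ and $\tau$ with $1/2<\tau\le 1$ such that, as $n\to\infty$, $$n^{-1}\sum_{j=1}^n p_j^{-1}=2\gamma_1+o(n^{-\tau}),\qquad n^{-1}\sum_{j=1}^n p_{-j}^{-1}=2\gamma_2+o(n^{-\tau}).$$ Then, on an appropriate probability space, for the anisotropic random walk $\{\mathbf{C}(N)=(C_1(N),C_2(N));\ N=0,1,2,\ldots\}$ on $\mathbb{Z}^2$ with parameters $(p_j)_{j\in\mathbb{Z}}$ started at $(0,0)$, one can construct two independent standard Wiener processes $\{W_1(t);\ t\ge 0\}$ and $\{W_2(t);\ t\ge 0\}$ such that, for any $\varepsilon>0$, as $N\to\infty$, $$\left|C_1(N)-W_1\left(N-A_2^{-1}(N)\right)\right|+\left|C_2(N)-W_2\left(A_2^{-1}(N)\right)\right|=O\left(N^{5/8-\tau/4+\varepsilon}\right)\quad\text{almost surely},$$ where $$A_2(t)=\gamma_1\int_0^t I(W_2(s)\ge 0)\,ds+\gamma_2\int_0^t I(W_2(s)<0)\,ds,\qquad t\ge 0,$$ and $A_2^{-1}(\cdot)$ is the inverse of $A_2(\cdot)$.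
   Context: The anisotropic random walk on $\mathbb{Z}^2$ with parameters $(p_j)_{j\in\mathbb{Z}}$ is the Markov chain $\{\mathbf{C}(N)=(C_1(N),C_2(N));\ N=0,1,2,\ldots\}$ with values in $\mathbb{Z}^2$, $\mathbf{C}(0)=(0,0)$, and transition probabilities, for $(k,j)\in\mathbb{Z}^2$ and $N=0,1,2,\ldots$, $$\mathbf{P}(\mathbf{C}(N+1)=(k+1,j)\mid\mathbf{C}(N)=(k,j))=\mathbf{P}(\mathbf{C}(N+1)=(k-1,j)\mid\mathbf{C}(N)=(k,j))=\tfrac12-p_j,$$ $$\mathbf{P}(\mathbf{C}(N+1)=(k,j+1)\mid\mathbf{C}(N)=(k,j))=\mathbf{P}(\mathbf{C}(N+1)=(k,j-1)\mid\mathbf{C}(N)=(k,j))=p_j.$$ "On an appropriate probability space one can construct" means that there exist a probability space and, on it, a process with the law of $\{\mathbf{C}(N)\}$ together with two independent standard Wiener processes (standard Brownian motions started at $0$) $W_1,W_2$ such that the stated almost sure relation holds. The $O(\cdot)$ constant may be random and may depend on $\varepsilon$. $I(\cdot)$ denotes the indicator function. *)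

theory Defs
  imports "HOL-Probability.Probability" "HOL-Library.Landau_Symbols"
begin

definition step_prob :: "(int \<Rightarrow> real) \<Rightarrow> int \<times> int \<Rightarrow> int \<times> int \<Rightarrow> real" where
  "step_prob p x y = (case x of (k, j) \<Rightarrow>
     if y = (k + 1, j) \<or> y = (k - 1, j) then 1 / 2 - p j
     else if y = (k, j + 1) \<or> y = (k, j - 1) then p j
     else 0)"

text \<open>Conditioning is on the whole history (this is the Markov property together with the
  transition probabilities) and is required only for histories of positive probability.\<close>

definition anisotropic_walk ::
    "'a measure \<Rightarrow> (int \<Rightarrow> real) \<Rightarrow> (nat \<Rightarrow> 'a \<Rightarrow> int \<times> int) \<Rightarrow> bool" where
  "anisotropic_walk M p C \<longleftrightarrow>
     prob_space M \<and>
     (\<forall>N. C N \<in> measurable M (count_space UNIV)) \<and>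
     (\<forall>\<omega>\<in>space M. C 0 \<omega> = (0, 0)) \<and>
     (\<forall>N x y. \<P>(\<omega> in M. \<forall>i\<le>N. C i \<omega> = x i) > 0 \<longrightarrow>
        \<P>(\<omega> in M. C (Suc N) \<omega> = y \<bar> \<forall>i\<le>N. C i \<omega> = x i) = step_prob p (x N) y)"

text \<open>Processes in continuous time are families indexed by \<^typ>\<open>real\<close>; only the
  indices \<open>t \<ge> 0\<close> matter.\<close>

definition wiener_process :: "'a measure \<Rightarrow> (real \<Rightarrow> 'a \<Rightarrow> real) \<Rightarrow> bool" where
  "wiener_process M W \<longleftrightarrow>
     prob_space M \<and>
     (\<forall>t\<ge>0. W t \<in> borel_measurable M) \<and>
     (AE \<omega> in M. W 0 \<omega> = 0) \<and>
     (AE \<omega> in M. continuous_on {0..} (\<lambda>t. W t \<omega>)) \<and>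
     (\<forall>s t. 0 \<le> s \<and> s < t \<longrightarrow>
        distributed M lborel (\<lambda>\<omega>. W t \<omega> - W s \<omega>) (normal_density 0 (sqrt (t - s)))) \<and>
     (\<forall>(n::nat) t. 0 \<le> t 0 \<and> (\<forall>i<n. t i < t (Suc i)) \<longrightarrow>
        prob_space.indep_vars M (\<lambda>_. borel) (\<lambda>i \<omega>. W (t (Suc i)) \<omega> - W (t i) \<omega>) {..<n})"

text \<open>Independence of whole processes: the paths, as random elements of the product
  space over \<open>{0..}\<close>, are independent.\<close>

definition independent_processes ::
    "'a measure \<Rightarrow> (real \<Rightarrow> 'a \<Rightarrow> real) \<Rightarrow> (real \<Rightarrow> 'a \<Rightarrow> real) \<Rightarrow> bool" where
  "independent_processes M X Y \<longleftrightarrow>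
     prob_space.indep_var M
       (PiM {0..} (\<lambda>_. borel)) (\<lambda>\<omega>. \<lambda>t\<in>{0..}. X t \<omega>)
       (PiM {0..} (\<lambda>_. borel)) (\<lambda>\<omega>. \<lambda>t\<in>{0..}. Y t \<omega>)"

definition A2 :: "real \<Rightarrow> real \<Rightarrow> (real \<Rightarrow> real) \<Rightarrow> real \<Rightarrow> real" where
  "A2 \<gamma>\<^sub>1 \<gamma>\<^sub>2 w t =
     \<gamma>\<^sub>1 * (LBINT s:{0..t}. indicator {0..} (w s)) + \<gamma>\<^sub>2 * (LBINT s:{0..t}. indicator {..<0} (w s))"

definition A2_inv :: "real \<Rightarrow> real \<Rightarrow> (real \<Rightarrow> real) \<Rightarrow> real \<Rightarrow> real" where
  "A2_inv \<gamma>\<^sub>1 \<gamma>\<^sub>2 w = inv_into {0..} (A2 \<gamma>\<^sub>1 \<gamma>\<^sub>2 w)"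

text \<open>HOL cannot quantify existentially over types, so ``there is a probability space''
  needs a fixed type of sample points. Real sequences carry every Borel probability on a
  Polish space up to isomorphism, hence all countable families of random variables and all
  continuous processes.\<close>

type_synonym sample_point = "nat \<Rightarrow> real"

end

theory Submission
  imports Defs "HOL-Real_Asymp.Real_Asymp"
begin

text \<open>
  The Wiener processes are obtained by Knight's construction: a simple random walk is refined, at
  half the spatial scale and a quarter of the time scale, by inserting independent excursions
  between its steps. The refined steps are again fair coins, and the refined walk at time \<open>2 n\<close> is
  twice the coarse walk at a binomial time, so the rescaled walks converge almost surely and stay
  within \<open>t powr (1/4 + \<delta>)\<close> of the original walk at time \<open>t\<close>.

  The anisotropic walk runs two independent simple random walks with a random clock: the number
  \<open>V\<close> of vertical steps among the first \<open>N\<close>. Up to martingale errors controlled by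
  Azuma's inequality, \<open>N\<close> is the sum of \<open>1 / (2 * p j)\<close> over the rows \<open>j\<close> of the
  vertical steps. Solving the discrete Poisson equation replaces \<open>1 / (2 * p j)\<close> by \<open>\<gamma>\<^sub>1\<close> or \<open>\<gamma>\<^sub>2\<close>
  according to the sign of \<open>j\<close>, and the resulting sum differs from \<open>A2 V\<close> only by visits of the walk
  near \<open>0\<close>. Hence \<open>A2 V - N\<close> is at most \<open>N powr (5/4 - \<tau>/2)\<close> up to an arbitrarily small power, and so
  is the error of \<open>V\<close> because \<open>A2\<close> expands distances; the Wiener paths turn this time
  error into its square root.
\<close>

section \<open>Azuma--Hoeffding inequality on sequence spaces\<close>

text \<open>The exponent comes from three time errors, up to small powers. Waiting times are bounded
  only through differences of their centred partial sums, hence by N^(1-\<tau>); the compensated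
  clock, a martingale with such jumps, errs by N^(3/2-\<tau>). The boundary term of the Poisson
  equation has order x^(2-\<tau>) at distance x, which is N^(1-\<tau>/2) for x = N^(1/2). The Wiener
  path is only within N^(1/4) of the walk, so its sign is unreliable during the roughly N^(3/4)
  visits to that strip.

  In Knight's construction the walk comes first and the Wiener process is a function of it and of
  further coins. Two separate coin arrays therefore give independent Wiener processes, whatever
  clock later interleaves the two walks; the clock has its own source, uniform variables.

  Chance enters the estimates only through Borel-Cantelli, with polynomially many events at stage n,
  each of probability at most 2 exp(-n^(2\<delta>)/2). After that they hold path by path, at the
  price of factors n^\<delta>.\<close>

lemma Azuma_mgf:
  fixes D :: "nat \<Rightarrow> (nat \<Rightarrow> 'b) \<Rightarrow> real" and \<nu> :: "'b measure" and l :: real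
  assumes \<nu>: "prob_space \<nu>"
    and meas: "\<And>i. D i \<in> borel_measurable (PiM UNIV (\<lambda>_. \<nu>))"
    and adapted: "\<And>i \<omega> \<omega>'. (\<And>j. j \<le> i \<Longrightarrow> \<omega> j = \<omega>' j) \<Longrightarrow> D i \<omega> = D i \<omega>'"
    and mean: "\<And>i \<omega>. \<omega> \<in> space (PiM UNIV (\<lambda>_. \<nu>)) \<Longrightarrow> (\<integral>y. D i (\<omega> (i := y)) \<partial>\<nu>) = 0"
    and bound: "\<And>i \<omega>. \<bar>D i \<omega>\<bar> \<le> c i"
    and l: "0 < l"
  shows "(\<integral>\<^sup>+\<omega>. exp (l * (\<Sum>i<n. D i \<omega>)) \<partial>PiM UNIV (\<lambda>_. \<nu>)) \<le> exp (l\<^sup>2 * (\<Sum>i<n. (c i)\<^sup>2) / 2)"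
  using meas adapted mean bound
\<comment> \<open>The induction removes the first coordinate, not the last: once it is fixed to
  \<open>s\<close>, the shifted process \<open>D (Suc i) (case_nat s \<omega>)\<close> satisfies the
  same hypotheses on the same infinite product, and the bound obtained for it does not depend on
  \<open>s\<close>.\<close>
proof (induction n arbitrary: D c)
  case 0
  interpret prob_space "PiM UNIV (\<lambda>_::nat. \<nu>)" using \<nu> by (intro prob_space_PiM) auto
  show ?case by (simp add: emeasure_space_1)
next
  case (Suc n)
  let ?S = "PiM (UNIV::nat set) (\<lambda>_. \<nu>)"
  interpret N: prob_space \<nu> by (rule \<nu>)
  interpret product_prob_space "\<lambda>_. \<nu>" "UNIV :: nat set" by unfold_locales
  interpret sequence_space \<nu> by unfold_locales
  note [measurable] = Suc.prems(1)
  obtain \<omega>0 where \<omega>0: "\<omega>0 \<in> space ?S"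
    using P.not_empty by blast
  \<comment> \<open>\<open>D 0\<close> sees the first coordinate alone, so the tail may be frozen at
    \<open>\<omega>0\<close> and this factor leaves the inner integral.\<close>
  have D0: "D 0 (case_nat s \<omega>) = D 0 (case_nat s \<omega>0)" for s \<omega>
    by (rule Suc.prems(2)) auto
  have cn: "case_nat s \<omega> \<in> space ?S" if "s \<in> space \<nu>" "\<omega> \<in> space ?S" for s \<omega>
    using that by (auto simp: space_PiM PiE_iff split: nat.splits)
  have mcn[measurable]: "(\<lambda>\<omega>. case_nat s \<omega>) \<in> measurable ?S ?S" if "s \<in> space \<nu>" for s
    using that by measurable
  have mcn2[measurable]: "(\<lambda>s. case_nat s \<omega>0) \<in> measurable \<nu> ?S"
    using \<omega>0 by measurable
  have mp[measurable]: "(\<lambda>(s, \<omega>). case_nat s \<omega>) \<in> measurable (\<nu> \<Otimes>\<^sub>M ?S) ?S" by measurable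
  have IH: "(\<integral>\<^sup>+\<omega>. exp (l * (\<Sum>i<n. D (Suc i) (case_nat s \<omega>))) \<partial>?S)
      \<le> exp (l\<^sup>2 * (\<Sum>i<n. (c (Suc i))\<^sup>2) / 2)" if s: "s \<in> space \<nu>" for s
  proof (rule Suc.IH)
    show "(\<lambda>\<omega>. D (Suc i) (case_nat s \<omega>)) \<in> borel_measurable ?S" for i
      using s by measurable
    show "D (Suc i) (case_nat s \<omega>) = D (Suc i) (case_nat s \<omega>')" if "\<And>j. j \<le> i \<Longrightarrow> \<omega> j = \<omega>' j" for i \<omega> \<omega>'
      using that by (intro Suc.prems(2)) (auto split: nat.splits)
    show "(\<integral>y. D (Suc i) (case_nat s (\<omega> (i := y))) \<partial>\<nu>) = 0" if "\<omega> \<in> space ?S" for i \<omega>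
    proof -
      have "case_nat s (\<omega> (i := y)) = (case_nat s \<omega>)(Suc i := y)" for y
        by (auto split: nat.splits)
      then show ?thesis using Suc.prems(3)[OF cn[OF s that], of "Suc i"] by (simp only:)
    qed
    show "\<bar>D (Suc i) (case_nat s \<omega>)\<bar> \<le> c (Suc i)" for i \<omega> by (rule Suc.prems(4))
  qed
  \<comment> \<open>Hoeffding's lemma on an interval of length \<open>2 * c 0\<close>: its
    denominator 8 becomes the 2 of the conclusion.\<close>
  have H: "(\<integral>\<^sup>+s. exp (l * D 0 (case_nat s \<omega>0)) \<partial>\<nu>) \<le> exp (l\<^sup>2 * (c 0 - - c 0)\<^sup>2 / 8)"
  proof -
    interpret I: interval_bounded_random_variable \<nu> "\<lambda>s. D 0 (case_nat s \<omega>0)" "- c 0" "c 0"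
    proof
      show "(\<lambda>s. D 0 (case_nat s \<omega>0)) \<in> borel_measurable \<nu>" by measurable
      have "D 0 (case_nat s \<omega>0) \<in> {- c 0..c 0}" for s
        using Suc.prems(4)[of 0 "case_nat s \<omega>0"] by auto
      then show "AE x in \<nu>. D 0 (case_nat x \<omega>0) \<in> {- c 0..c 0}" by auto
    qed
    obtain s0 where s0: "s0 \<in> space \<nu>" using N.not_empty by blast
    have "(case_nat s0 \<omega>0)(0 := s) = case_nat s \<omega>0" for s by (auto split: nat.splits)
    then have "N.expectation (\<lambda>s. D 0 (case_nat s \<omega>0)) = 0"
      using Suc.prems(3)[OF cn[OF s0 \<omega>0], of 0] by simp
    from I.Hoeffdings_lemma_nn_integral_0[OF l this] show ?thesis .
  qed
  have "(\<integral>\<^sup>+\<omega>. exp (l * (\<Sum>i<Suc n. D i \<omega>)) \<partial>?S)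
      = (\<integral>\<^sup>+\<omega>. exp (l * (\<Sum>i<Suc n. D i \<omega>)) \<partial>distr (\<nu> \<Otimes>\<^sub>M ?S) ?S (\<lambda>(s, \<omega>). case_nat s \<omega>))"
    by (simp add: PiM_iter)
  also have "\<dots> = (\<integral>\<^sup>+x. exp (l * (\<Sum>i<Suc n. D i ((\<lambda>(s, \<omega>). case_nat s \<omega>) x))) \<partial>(\<nu> \<Otimes>\<^sub>M ?S))"
    by (subst nn_integral_distr) measurable
  also have "\<dots> = (\<integral>\<^sup>+s. \<integral>\<^sup>+\<omega>. exp (l * (\<Sum>i<Suc n. D i (case_nat s \<omega>))) \<partial>?S \<partial>\<nu>)"
    by (subst P.nn_integral_fst[symmetric]) (auto simp del: sum.lessThan_Suc)
  also have "\<dots> = (\<integral>\<^sup>+s. \<integral>\<^sup>+\<omega>. ennreal (exp (l * D 0 (case_nat s \<omega>0))) * exp (l * (\<Sum>i<n. D (Suc i) (case_nat s \<omega>))) \<partial>?S \<partial>\<nu>)"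
  proof (intro nn_integral_cong)
    fix s \<omega>
    show "ennreal (exp (l * (\<Sum>i<Suc n. D i (case_nat s \<omega>)))) =
      ennreal (exp (l * D 0 (case_nat s \<omega>0))) * ennreal (exp (l * (\<Sum>i<n. D (Suc i) (case_nat s \<omega>))))"
      unfolding sum.lessThan_Suc_shift
      using D0[of s \<omega>] by (simp add: ennreal_mult[symmetric] exp_add[symmetric] algebra_simps)
  qed
  also have "\<dots> = (\<integral>\<^sup>+s. ennreal (exp (l * D 0 (case_nat s \<omega>0))) * (\<integral>\<^sup>+\<omega>. exp (l * (\<Sum>i<n. D (Suc i) (case_nat s \<omega>))) \<partial>?S) \<partial>\<nu>)"
    by (intro nn_integral_cong nn_integral_cmult) measurable
  also have "\<dots> \<le> (\<integral>\<^sup>+s. ennreal (exp (l * D 0 (case_nat s \<omega>0))) * exp (l\<^sup>2 * (\<Sum>i<n. (c (Suc i))\<^sup>2) / 2) \<partial>\<nu>)"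
    by (intro nn_integral_mono mult_left_mono IH) auto
  also have "\<dots> = (\<integral>\<^sup>+s. ennreal (exp (l * D 0 (case_nat s \<omega>0))) \<partial>\<nu>) * exp (l\<^sup>2 * (\<Sum>i<n. (c (Suc i))\<^sup>2) / 2)"
    by (intro nn_integral_multc) measurable
  also have "\<dots> \<le> ennreal (exp (l\<^sup>2 * (c 0 - - c 0)\<^sup>2 / 8)) * exp (l\<^sup>2 * (\<Sum>i<n. (c (Suc i))\<^sup>2) / 2)"
    by (intro mult_right_mono H) auto
  also have "\<dots> = exp (l\<^sup>2 * (\<Sum>i<Suc n. (c i)\<^sup>2) / 2)"
    unfolding sum.lessThan_Suc_shift
    by (simp add: ennreal_mult[symmetric] exp_add[symmetric] power2_eq_square algebra_simps add_divide_distrib)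
  finally show ?case .
qed

text \<open>Chernoff's bound: Markov's inequality for the exponential moment, where
  \<open>l = x / sqrt v\<close> minimises \<open>l\<^sup>2 * v / 2 - l * x * sqrt v\<close>. The
  two-sided estimate adds the same bound for \<open>- D\<close>.\<close>

lemma Azuma_tail:
  fixes D :: "nat \<Rightarrow> (nat \<Rightarrow> 'b) \<Rightarrow> real" and \<nu> :: "'b measure" and x v :: real
  assumes \<nu>: "prob_space \<nu>"
    and meas: "\<And>i. D i \<in> borel_measurable (PiM UNIV (\<lambda>_. \<nu>))"
    and adapted: "\<And>i \<omega> \<omega>'. (\<And>j. j \<le> i \<Longrightarrow> \<omega> j = \<omega>' j) \<Longrightarrow> D i \<omega> = D i \<omega>'"
    and mean: "\<And>i \<omega>. \<omega> \<in> space (PiM UNIV (\<lambda>_. \<nu>)) \<Longrightarrow> (\<integral>y. D i (\<omega> (i := y)) \<partial>\<nu>) = 0"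
    and bound: "\<And>i \<omega>. \<bar>D i \<omega>\<bar> \<le> c i"
    and v: "(\<Sum>i<n. (c i)\<^sup>2) \<le> v" "0 < v" and x: "0 < x"
  shows "measure (PiM UNIV (\<lambda>_. \<nu>)) {\<omega> \<in> space (PiM UNIV (\<lambda>_. \<nu>)). x * sqrt v \<le> \<bar>\<Sum>i<n. D i \<omega>\<bar>}
    \<le> 2 * exp (- x\<^sup>2 / 2)"
proof -
  let ?S = "PiM (UNIV::nat set) (\<lambda>_. \<nu>)"
  interpret prob_space ?S using \<nu> by (intro prob_space_PiM) auto
  have one: "emeasure ?S {\<omega> \<in> space ?S. x * sqrt v \<le> (\<Sum>i<n. D' i \<omega>)} \<le> exp (- x\<^sup>2 / 2)"
    if meas: "\<And>i. D' i \<in> borel_measurable ?S"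
    and adapted: "\<And>i \<omega> \<omega>'. (\<And>j. j \<le> i \<Longrightarrow> \<omega> j = \<omega>' j) \<Longrightarrow> D' i \<omega> = D' i \<omega>'"
    and mean: "\<And>i \<omega>. \<omega> \<in> space ?S \<Longrightarrow> (\<integral>y. D' i (\<omega> (i := y)) \<partial>\<nu>) = 0"
    and bound: "\<And>i \<omega>. \<bar>D' i \<omega>\<bar> \<le> c i" for D'
  proof -
    define l where "l = x / sqrt v"
    have l: "0 < l" using v x by (simp add: l_def)
    note [measurable] = meas
    have "emeasure ?S {\<omega> \<in> space ?S. x * sqrt v \<le> (\<Sum>i<n. D' i \<omega>)}
       \<le> emeasure ?S ({\<omega> \<in> space ?S. 1 \<le> ennreal (exp (- x\<^sup>2)) * ennreal (exp (l * (\<Sum>i<n. D' i \<omega>)))} \<inter> space ?S)"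
    proof (intro emeasure_mono subsetI, clarsimp)
      fix \<omega> assume a: "x * sqrt v \<le> (\<Sum>i<n. D' i \<omega>)"
      have "x\<^sup>2 = l * (x * sqrt v)" using v by (simp add: l_def power2_eq_square)
      also have "\<dots> \<le> l * (\<Sum>i<n. D' i \<omega>)" using a l by (intro mult_left_mono) auto
      finally have "0 \<le> - x\<^sup>2 + l * (\<Sum>i<n. D' i \<omega>)" by simp
      then have "1 \<le> exp (- x\<^sup>2 + l * (\<Sum>i<n. D' i \<omega>))" by simp
      then have "1 \<le> exp (- x\<^sup>2) * exp (l * (\<Sum>i<n. D' i \<omega>))" unfolding exp_add .
      then show "1 \<le> ennreal (exp (- x\<^sup>2)) * ennreal (exp (l * (\<Sum>i<n. D' i \<omega>)))"
        by (simp add: ennreal_mult[symmetric])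
    qed measurable
    also have "\<dots> \<le> ennreal (exp (- x\<^sup>2)) * (\<integral>\<^sup>+\<omega>. ennreal (exp (l * (\<Sum>i<n. D' i \<omega>))) * indicator (space ?S) \<omega> \<partial>?S)"
      using nn_integral_Markov_inequality[where M = "?S" and A = "space ?S" and u = "\<lambda>\<omega>. ennreal (exp (l * (\<Sum>i<n. D' i \<omega>)))" and c = "ennreal (exp (- x\<^sup>2))"]
      by (simp add: Collect_conj_eq Int_commute)
    also have "\<dots> = ennreal (exp (- x\<^sup>2)) * (\<integral>\<^sup>+\<omega>. ennreal (exp (l * (\<Sum>i<n. D' i \<omega>))) \<partial>?S)"
      by (intro arg_cong2[where f = "(*)"] nn_integral_cong refl) auto
    also have "\<dots> \<le> ennreal (exp (- x\<^sup>2)) * exp (l\<^sup>2 * (\<Sum>i<n. (c i)\<^sup>2) / 2)"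
      by (intro mult_left_mono Azuma_mgf[OF \<nu> that l]) auto
    also have "\<dots> \<le> exp (- x\<^sup>2) * exp (l\<^sup>2 * v / 2)"
      using v(1) by (auto simp: ennreal_mult[symmetric] intro!: ennreal_leI mult_left_mono divide_right_mono)
    also have "\<dots> = exp (- x\<^sup>2 / 2)"
      using v by (simp add: l_def power_divide exp_add[symmetric])
    finally show ?thesis .
  qed
  note [measurable] = meas
  have "emeasure ?S {\<omega> \<in> space ?S. x * sqrt v \<le> \<bar>\<Sum>i<n. D i \<omega>\<bar>}
    \<le> emeasure ?S ({\<omega> \<in> space ?S. x * sqrt v \<le> (\<Sum>i<n. D i \<omega>)} \<union> {\<omega> \<in> space ?S. x * sqrt v \<le> (\<Sum>i<n. - D i \<omega>)})"
    by (intro emeasure_mono) (auto simp: abs_if sum_negf split: if_splits)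
  also have "\<dots> \<le> emeasure ?S {\<omega> \<in> space ?S. x * sqrt v \<le> (\<Sum>i<n. D i \<omega>)} + emeasure ?S {\<omega> \<in> space ?S. x * sqrt v \<le> (\<Sum>i<n. - D i \<omega>)}"
    by (intro emeasure_subadditive) measurable
  also have "\<dots> \<le> ennreal (exp (- x\<^sup>2 / 2)) + ennreal (exp (- x\<^sup>2 / 2))"
  proof (rule add_mono)
    show "emeasure ?S {\<omega> \<in> space ?S. x * sqrt v \<le> (\<Sum>i<n. D i \<omega>)} \<le> exp (- x\<^sup>2 / 2)"
      by (rule one) (fact meas adapted mean bound)+
    show "emeasure ?S {\<omega> \<in> space ?S. x * sqrt v \<le> (\<Sum>i<n. - D i \<omega>)} \<le> exp (- x\<^sup>2 / 2)"
    proof (rule one)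
      show "- D i \<omega> = - D i \<omega>'" if "\<And>j. j \<le> i \<Longrightarrow> \<omega> j = \<omega>' j" for i \<omega> \<omega>'
        using adapted[of i \<omega> \<omega>'] that by simp
      show "(\<integral>y. - D i (\<omega> (i := y)) \<partial>\<nu>) = 0" if "\<omega> \<in> space ?S" for i \<omega>
        using mean[OF that, of i] by simp
      show "\<bar>- D i \<omega>\<bar> \<le> c i" for i \<omega> using bound[of i \<omega>] by simp
      show "(\<lambda>\<omega>. - D i \<omega>) \<in> borel_measurable ?S" for i by measurable
    qed
  qed
  also have "\<dots> = ennreal (2 * exp (- x\<^sup>2 / 2))" by (simp add: ennreal_plus[symmetric] del: ennreal_plus)
  finally show ?thesis by (simp add: emeasure_eq_measure)
qed

section \<open>Fair coins and the refinement of a simple random walk\<close>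

definition coin :: "bool measure" where
  "coin = measure_pmf (bernoulli_pmf (1/2))"

abbreviation coins :: "('i \<Rightarrow> bool) measure" where
  "coins \<equiv> PiM UNIV (\<lambda>_. coin)"

lemma prob_space_coin: "prob_space coin"
  unfolding coin_def by (rule prob_space_measure_pmf)

lemma sets_coin [simp, measurable_cong]: "sets coin = sets (count_space UNIV)"
  unfolding coin_def by simp

lemma space_coin [simp]: "space coin = UNIV"
  unfolding coin_def by simp

lemma emeasure_coin_single: "emeasure coin {b} = ennreal (1/2)"
  unfolding coin_def by (cases b) (simp_all add: emeasure_pmf_single)

lemma prob_space_coins: "prob_space coins"
  by (intro prob_space_PiM prob_space_coin)

lemma space_coins [simp]: "space coins = UNIV"
  by (simp add: space_PiM)

lemma emb_coins: "prod_emb UNIV (\<lambda>_. coin) J (Pi\<^sub>E J A) = {c. \<forall>i\<in>J. c i \<in> A i}"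
  by (auto simp: prod_emb_def space_PiM PiE_iff)

lemma cylinder_sets:
  assumes "finite J" shows "{c. \<forall>i\<in>J. c i \<in> A i} \<in> sets coins"
  unfolding emb_coins[symmetric] using assms by (intro sets_PiM_I) auto

lemma emeasure_cylinder:
  assumes "finite J"
  shows "emeasure coins {c. \<forall>i\<in>J. c i = \<eta> i} = ennreal ((1/2) ^ card J)"
proof -
  have "{c. \<forall>i\<in>J. c i = \<eta> i} = prod_emb UNIV (\<lambda>_. coin) J (Pi\<^sub>E J (\<lambda>i. {\<eta> i}))"
    by (simp add: emb_coins)
  also have "emeasure coins \<dots> = (\<Prod>i\<in>J. emeasure coin {\<eta> i})"
    by (subst emeasure_PiM_emb) (use assms prob_space_coin in auto)
  also have "\<dots> = ennreal ((1/2) ^ card J)"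
    by (simp only: emeasure_coin_single prod_constant) (subst ennreal_power, auto)
  finally show ?thesis .
qed

text \<open>A cylinder over \<open>J\<close> is a finite disjoint union of point cylinders over any
  larger \<open>J'\<close>, so it is enough to test a cofinal family of coordinate sets. This
  freedom lets \<open>distr_zoom\<close> work with whole refined pairs.\<close>

lemma coins_eqI:
  fixes N :: "('i \<Rightarrow> bool) measure"
  assumes sets: "sets N = sets coins" and fin: "finite_measure N"
    and cyl: "\<And>J::'i set. finite J \<Longrightarrow> \<exists>J'. J \<subseteq> J' \<and> finite J' \<and>
      (\<forall>\<eta>. emeasure N {c. \<forall>i\<in>J'. c i = \<eta> i} = ennreal ((1/2) ^ card J'))"
  shows "N = coins"
proof (rule measure_eqI_PiM_infinite[where I = UNIV and M = "\<lambda>_. coin"])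
  show "sets N = sets coins" by (rule sets)
  show "finite_measure N" by (rule fin)
  fix A :: "'i \<Rightarrow> bool set" and J :: "'i set" assume J: "finite J"
  obtain J' where J': "J \<subseteq> J'" "finite J'"
    "\<And>\<eta>. emeasure N {c. \<forall>i\<in>J'. c i = \<eta> i} = ennreal ((1/2) ^ card J')"
    using cyl[OF J] by blast
  define B where "B = {\<eta> \<in> PiE J' (\<lambda>_. UNIV). \<forall>i\<in>J. \<eta> i \<in> A i}"
  have finB: "finite B"
    unfolding B_def by (rule finite_subset[of _ "PiE J' (\<lambda>_. UNIV)"]) (auto intro!: finite_PiE J')
  have eq: "prod_emb UNIV (\<lambda>_. coin) J (Pi\<^sub>E J A) = (\<Union>\<eta>\<in>B. {c. \<forall>i\<in>J'. c i = \<eta> i})"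
  proof (intro set_eqI iffI)
    fix c assume "c \<in> prod_emb UNIV (\<lambda>_. coin) J (Pi\<^sub>E J A)"
    then have "restrict c J' \<in> B" "c \<in> {c'. \<forall>i\<in>J'. c' i = restrict c J' i}"
      using J' by (auto simp: emb_coins B_def)
    then show "c \<in> (\<Union>\<eta>\<in>B. {c. \<forall>i\<in>J'. c i = \<eta> i})" by blast
  next
    fix c assume "c \<in> (\<Union>\<eta>\<in>B. {c. \<forall>i\<in>J'. c i = \<eta> i})"
    then show "c \<in> prod_emb UNIV (\<lambda>_. coin) J (Pi\<^sub>E J A)"
      using J' by (fastforce simp: emb_coins B_def)
  qed
  have disj: "disjoint_family_on (\<lambda>\<eta>. {c. \<forall>i\<in>J'. c i = \<eta> i}) B"
    unfolding disjoint_family_on_def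
  proof (intro ballI impI equals0I)
    fix \<eta> \<theta> c assume *: "\<eta> \<in> B" "\<theta> \<in> B" "\<eta> \<noteq> \<theta>"
      "c \<in> {c. \<forall>i\<in>J'. c i = \<eta> i} \<inter> {c. \<forall>i\<in>J'. c i = \<theta> i}"
    then have "\<eta> = \<theta>" by (intro PiE_ext[of \<eta> J' "\<lambda>_. UNIV" \<theta>]) (auto simp: B_def)
    with * show False by simp
  qed
  have "emeasure P (prod_emb UNIV (\<lambda>_. coin) J (Pi\<^sub>E J A)) = (\<Sum>\<eta>\<in>B. emeasure P {c. \<forall>i\<in>J'. c i = \<eta> i})"
    if "sets P = sets coins" for P
    unfolding eq
  proof (intro sum_emeasure[symmetric])
    show "(\<lambda>\<eta>. {c. \<forall>i\<in>J'. c i = \<eta> i}) ` B \<subseteq> sets P"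
    proof -
      have "{c. \<forall>i\<in>J'. c i = \<eta> i} \<in> sets coins" for \<eta>
        using cylinder_sets[OF J'(2), of "\<lambda>i. {\<eta> i}"] by simp
      then show ?thesis using that by auto
    qed
  qed (use finB disj in auto)
  from this[OF sets] this[OF refl]
  show "emeasure N (prod_emb UNIV (\<lambda>_. coin) J (Pi\<^sub>E J A)) = emeasure coins (prod_emb UNIV (\<lambda>_. coin) J (Pi\<^sub>E J A))"
    using J'(3) emeasure_cylinder[OF J'(2)] by simp
qed (rule refl)

definition exits :: "(nat \<Rightarrow> bool) \<Rightarrow> nat \<Rightarrow> nat" where
  "exits e n = (\<Sum>i<n. of_bool (e i))"

definition walk :: "(nat \<Rightarrow> bool) \<Rightarrow> nat \<Rightarrow> int" where
  "walk x n = (\<Sum>i<n. if x i then 1 else - 1)"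

text \<open>The refined steps come in pairs. If \<open>e j\<close>, then pair \<open>j\<close> repeats the next unused coarse step;
  otherwise it is an excursion that returns to its starting point, in the direction \<open>d j\<close>.\<close>

definition refine :: "(nat \<Rightarrow> bool) \<Rightarrow> (nat \<Rightarrow> bool) \<Rightarrow> (nat \<Rightarrow> bool) \<Rightarrow> nat \<Rightarrow> bool" where
  "refine x e d i = (let y = (if e (i div 2) then x (exits e (i div 2)) else d (i div 2))
     in if even i then y else y = e (i div 2))"

text \<open>Row 0 holds the steps of the current walk, rows 1 and 2 the randomness of the next refinement,
  and the later rows that of the refinements to follow.\<close>

definition zoom :: "(nat \<times> nat \<Rightarrow> bool) \<Rightarrow> nat \<times> nat \<Rightarrow> bool" where
  "zoom c = (\<lambda>(r, i). if r = 0 then refine (\<lambda>i. c (0, i)) (\<lambda>i. c (1, i)) (\<lambda>i. c (2, i)) i else c (r + 2, i))"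

lemma refine_even [simp]: "refine x e d (2 * n) = (if e n then x (exits e n) else d n)"
  by (simp add: refine_def)

lemma refine_odd [simp]: "refine x e d (Suc (2 * n)) = (if e n then x (exits e n) else \<not> d n)"
  by (simp add: refine_def)

lemma walk_refine: "walk (refine x e d) (2 * n) = 2 * walk x (exits e n)"
proof (induction n)
  case 0 show ?case by (simp add: walk_def exits_def)
next
  case (Suc n)
  have "walk (refine x e d) (2 * Suc n) = walk (refine x e d) (2 * n)
      + (if refine x e d (2 * n) then 1 else - 1) + (if refine x e d (Suc (2 * n)) then 1 else - 1)"
    by (simp add: walk_def)
  moreover have "walk x (exits e (Suc n)) = walk x (exits e n) + (if e n then if x (exits e n) then 1 else - 1 else 0)"
    by (simp add: walk_def exits_def)
  ultimately show ?case using Suc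
    by auto
qed

lemma measurable_exits [measurable]:
  assumes [measurable]: "\<And>i. (\<lambda>c. e c i) \<in> measurable M (count_space UNIV)"
  shows "(\<lambda>c. exits (e c) n) \<in> measurable M (count_space UNIV)"
  unfolding exits_def by measurable

lemma measurable_walk [measurable]:
  assumes [measurable]: "\<And>i. (\<lambda>c. x c i) \<in> measurable M (count_space UNIV)"
  shows "(\<lambda>c. walk (x c) n) \<in> measurable M (count_space UNIV)"
proof (induction n)
  case 0 show ?case by (simp add: walk_def)
next
  case (Suc n)
  have "walk (x c) (Suc n) = (\<lambda>(a, b). a + (if b then 1 else - 1)) (walk (x c) n, x c n)" for c
    by (simp add: walk_def)
  then show ?case
    using Suc by (auto intro!: measurable_compose[OF measurable_Pair, of _ M "count_space UNIV" _ "count_space UNIV"]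
      simp: pair_measure_countable)
qed

lemma measurable_coins_component [measurable]: "(\<lambda>c. c i) \<in> measurable coins (count_space UNIV)"
  using measurable_component_singleton[of i UNIV "\<lambda>_. coin"]
  by (simp cong: measurable_cong_sets)

lemma measurable_coinsI:
  assumes "\<And>i. (\<lambda>x. f x i) \<in> measurable M (count_space UNIV)"
  shows "f \<in> measurable M coins"
  using assms by (intro measurable_PiM_single') (auto cong: measurable_cong_sets)

lemma measurable_refine [measurable]:
  assumes [measurable]: "\<And>i. (\<lambda>c. x c i) \<in> measurable M (count_space UNIV)"
    "\<And>i. (\<lambda>c. e c i) \<in> measurable M (count_space UNIV)"
    "\<And>i. (\<lambda>c. d c i) \<in> measurable M (count_space UNIV)"
  shows "(\<lambda>c. refine (x c) (e c) (d c) i) \<in> measurable M (count_space UNIV)"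
proof -
  have [measurable]: "(\<lambda>c. x c (exits (e c) j)) \<in> measurable M (count_space UNIV)" for j
    by (rule measurable_compose_countable[where g = "\<lambda>c. exits (e c) j"]) measurable
  show ?thesis unfolding refine_def Let_def by measurable
qed

lemma measurable_zoom [measurable]: "zoom \<in> measurable coins coins"
proof (rule measurable_coinsI)
  fix a :: "nat \<times> nat"
  obtain r i where a: "a = (r, i)" by (cases a)
  show "(\<lambda>c. zoom c a) \<in> measurable coins (count_space UNIV)"
    unfolding a zoom_def by (cases "r = 0") simp_all
qed

text \<open>The content of pair \<open>j\<close> is decided by coarse step \<open>exits e j\<close>
  in row 0 or by direction \<open>j\<close> in row 2. The count \<open>exits\<close> increases
  strictly across every consuming pair, so no coarse step serves two pairs.\<close>

lemma inj_exits_pos: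
  "inj_on (\<lambda>j. if e j then (0::nat, exits e j) else (2, j)) {..<n}"
proof -
  have less: "exits e i < exits e j" if "i < j" "e i" for i j
  proof -
    have "exits e i < exits e (Suc i)" using that by (simp add: exits_def)
    also have "\<dots> \<le> exits e j" unfolding exits_def using that by (intro sum_mono2) auto
    finally show ?thesis .
  qed
  show ?thesis
    by (rule inj_onI) (metis less linorder_neqE_nat nat_neq_iff prod.inject zero_neq_numeral)
qed

lemma exits_cong: "(\<And>j. j < i \<Longrightarrow> e j = e' j) \<Longrightarrow> exits e i = exits e' i"
  unfolding exits_def by (intro sum.cong) auto

text \<open>Prescribing the first refined pairs prescribes the first entries of \<open>e\<close> and then, for each pair,
  one more coin; these coins are distinct, so the probability is right.\<close>

theorem distr_zoom: "distr coins coins zoom = coins"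
proof (rule coins_eqI)
  interpret prob_space coins by (rule prob_space_coins)
  show "sets (distr coins coins zoom) = sets coins" by simp
  show "finite_measure (distr coins coins zoom)"
    using prob_space_distr[OF measurable_zoom] by (simp add: prob_space_def)
  fix J :: "(nat \<times> nat) set" assume J: "finite J"
  obtain n where n: "\<And>r i. (r, i) \<in> J \<Longrightarrow> i < 2 * n"
  proof -
    obtain k where "\<forall>i\<in>snd ` J. i \<le> k" using J by (meson finite_imageI finite_nat_set_iff_bounded_le)
    then show ?thesis by (intro that[of "Suc k"]) force
  qed
  define R where "R = {a\<in>J. fst a \<noteq> 0}"
  \<comment> \<open>Row 0 is enlarged to an initial block of whole pairs, because the coarse step
    read by a pair depends on all earlier entries of \<open>e\<close>.\<close>
  define J' where "J' = {0} \<times> {..<2*n} \<union> R"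
  have finJ': "finite J'" using J by (simp add: J'_def R_def)
  have "emeasure (distr coins coins zoom) {c. \<forall>i\<in>J'. c i = \<eta> i} = ennreal ((1/2) ^ card J')" for \<eta>
  proof -
    \<comment> \<open>The two steps of a pair agree exactly when the pair repeats a coarse step, so
      the prescribed values determine \<open>e\<close> on the first \<open>n\<close> pairs.\<close>
    define \<epsilon> where "\<epsilon> j = (\<eta> (0, 2*j) = \<eta> (0, Suc (2*j)))" for j
    \<comment> \<open>\<open>\<phi>\<close> locates the input coin behind each prescribed cell: an
      even cell leads to the content of its pair, an odd one to the entry of \<open>e\<close>.
      \<open>\<zeta>\<close> is the value this coin must show.\<close>
    define \<phi> where "\<phi> = (\<lambda>(r, i). if r = 0 then if even i then (if \<epsilon> (i div 2) then (0::nat, exits \<epsilon> (i div 2)) else (2, i div 2))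
        else (1, i div 2) else (r + 2, i))"
    define \<zeta> where "\<zeta> = (\<lambda>(r::nat, i). if r = 0 \<and> odd i then \<epsilon> (i div 2) else \<eta> (r, i))"
    have inj: "inj_on \<phi> J'"
    proof (rule inj_onI)
      fix a b assume ab: "a \<in> J'" "b \<in> J'" "\<phi> a = \<phi> b"
      obtain r i s j where [simp]: "a = (r, i)" "b = (s, j)" by (cases a, cases b)
      have e: "even i \<Longrightarrow> even j \<Longrightarrow> r = 0 \<Longrightarrow> s = 0 \<Longrightarrow> i div 2 = j div 2"
        using ab inj_onD[OF inj_exits_pos[of \<epsilon> n], of "i div 2" "j div 2"]
        by (auto simp: \<phi>_def J'_def R_def)
      show "a = b"
        using ab(3) e by (auto simp: \<phi>_def split: if_splits elim!: evenE oddE)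
    qed
    have key: "(\<forall>a\<in>J'. zoom c a = \<eta> a) \<longleftrightarrow> (\<forall>a\<in>J'. c (\<phi> a) = \<zeta> a)" for c
    proof -
      have coin_row: "(\<forall>i<2*n. zoom c (0, i) = \<eta> (0, i)) \<longleftrightarrow> (\<forall>i<2*n. c (\<phi> (0, i)) = \<zeta> (0, i))"
      proof -
        let ?e = "\<lambda>i. c (1, i)"
        have pairs: "(\<forall>i<2*n. P i) \<longleftrightarrow> (\<forall>j<n. P (2*j) \<and> P (Suc (2*j)))" for P
        proof (safe)
          fix i assume *: "\<forall>j<n. P (2*j) \<and> P (Suc (2*j))" "i < 2*n"
          show "P i" using *(1)[rule_format, of "i div 2"] *(2) by (cases "even i") (auto elim!: evenE oddE)
        qed auto
        have "(\<forall>i<2*n. zoom c (0, i) = \<eta> (0, i)) \<longleftrightarrow>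
           (\<forall>j<n. ?e j = \<epsilon> j \<and> (if ?e j then c (0, exits ?e j) else c (2, j)) = \<eta> (0, 2*j))"
          unfolding pairs zoom_def split by (intro all_cong) (auto simp: \<epsilon>_def)
        also have "\<dots> \<longleftrightarrow> (\<forall>j<n. ?e j = \<epsilon> j \<and> (if \<epsilon> j then c (0, exits \<epsilon> j) else c (2, j)) = \<eta> (0, 2*j))"
        proof -
          have "exits ?e j = exits \<epsilon> j" if "\<forall>j<n. ?e j = \<epsilon> j" "j < n" for j
            using that by (intro exits_cong) auto
          then show ?thesis by (cases "\<forall>j<n. ?e j = \<epsilon> j") auto
        qed
        also have "\<dots> \<longleftrightarrow> (\<forall>i<2*n. c (\<phi> (0, i)) = \<zeta> (0, i))"
          unfolding pairs by (auto simp: \<phi>_def \<zeta>_def)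
        finally show ?thesis .
      qed
      have rest: "zoom c a = c (\<phi> a)" "\<zeta> a = \<eta> a" if "a \<in> R" for a
        using that by (auto simp: R_def zoom_def \<phi>_def \<zeta>_def split: prod.splits)
      show ?thesis using coin_row rest by (auto simp: J'_def)
    qed
    have "{c. \<forall>a\<in>J'. c a = \<eta> a} \<in> sets coins" using cylinder_sets[OF finJ', of "\<lambda>i. {\<eta> i}"] by simp
    then have "emeasure (distr coins coins zoom) {c. \<forall>i\<in>J'. c i = \<eta> i} = emeasure coins {c. \<forall>a\<in>J'. zoom c a = \<eta> a}"
      by (subst emeasure_distr) (auto intro!: arg_cong2[where f = emeasure])
    also have "{c. \<forall>a\<in>J'. zoom c a = \<eta> a} = {c. \<forall>b\<in>\<phi> ` J'. c b = \<zeta> (inv_into J' \<phi> b)}"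
      using inj by (auto simp: key)
    also have "emeasure coins \<dots> = ennreal ((1/2) ^ card J')"
      using inj finJ' by (subst emeasure_cylinder) (auto simp: card_image)
    finally show ?thesis .
  qed
  moreover have "J \<subseteq> J'" using n by (auto simp: J'_def R_def)
  ultimately show "\<exists>J'. J \<subseteq> J' \<and> finite J' \<and>
      (\<forall>\<eta>. emeasure (distr coins coins zoom) {c. \<forall>i\<in>J'. c i = \<eta> i} = ennreal ((1/2) ^ card J'))"
    using finJ' by blast
qed

section \<open>Invariance under iterated refinement\<close>

lemma measure_preserving_vimage:
  assumes "distr M N \<phi> = N" "\<phi> \<in> measurable M N" "A \<in> sets N"
  shows "measure M {x \<in> space M. \<phi> x \<in> A} = measure N A"
proof -
  have "{x \<in> space M. \<phi> x \<in> A} = \<phi> -` A \<inter> space M" by auto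
  then show ?thesis using measure_distr[OF assms(2,3)] assms(1) by simp
qed

lemma measurable_zoom_pow [measurable]: "zoom ^^ m \<in> measurable coins coins"
  by (induction m) (auto intro: measurable_comp)

lemma distr_zoom_pow: "distr coins coins (zoom ^^ m) = coins"
proof (induction m)
  case 0 show ?case using distr_id2[of coins coins] by (simp add: id_def)
next
  case (Suc m)
  have "distr coins coins (zoom ^^ Suc m) = distr (distr coins coins (zoom ^^ m)) coins zoom"
    by (subst distr_distr) auto
  then show ?case by (simp only: Suc distr_zoom)
qed

definition coin_row :: "nat \<Rightarrow> (nat \<times> nat \<Rightarrow> bool) \<Rightarrow> nat \<Rightarrow> bool" where
  "coin_row r c i = c (r, i)"

lemma measurable_row [measurable]: "coin_row r \<in> measurable coins coins"
  by (rule measurable_coinsI) (simp add: coin_row_def)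

lemma distr_row: "distr coins coins (coin_row r) = coins"
proof -
  have "distr (PiM UNIV (\<lambda>_::nat \<times> nat. coin)) (PiM UNIV (\<lambda>i::nat. coin)) (\<lambda>\<omega>. \<lambda>n\<in>UNIV. \<omega> (r, n)) = PiM UNIV (\<lambda>i::nat. coin)"
    by (rule distr_PiM_reindex) (auto simp: inj_on_def prob_space_coin)
  then show ?thesis by (simp add: coin_row_def[abs_def] restrict_def)
qed

section \<open>Tail bounds for the simple random walk, uniform over refinement levels\<close>

abbreviation coin_sign :: "bool \<Rightarrow> real" where "coin_sign b \<equiv> (if b then 1 else - 1)"

lemma expectation_sign: "(\<integral>y. k * coin_sign y \<partial>coin) = 0"
  unfolding coin_def by (subst integral_bernoulli_pmf) auto

lemma of_int_walk: "real_of_int (walk x n) = (\<Sum>i<n. coin_sign (x i))"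
  by (auto simp: walk_def intro!: sum.cong)

lemma abs_walk_le: "\<bar>walk x n\<bar> \<le> int n"
  by (induction n) (auto simp: walk_def)

lemma walk_cong: "(\<And>j. j < i \<Longrightarrow> e j = e' j) \<Longrightarrow> walk e i = walk e' i"
  unfolding walk_def by (intro sum.cong) auto

lemma walk_exits: "2 * int (exits e n) - int n = walk e n"
  by (induction n) (auto simp: exits_def walk_def)

lemma borel_measurable_walk:
  "(\<lambda>c. (f (walk c n) :: real)) \<in> borel_measurable coins"
  by (rule measurable_compose[OF measurable_walk, of _ _ f]) auto

lemma borel_measurable_of_int_walk [measurable]:
  "(\<lambda>c. real_of_int (walk c n)) \<in> borel_measurable coins"
  by (rule borel_measurable_walk)

text \<open>The summands are martingale differences since \<open>h i\<close> looks only at the walk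
  before coin \<open>i\<close>. A bound on \<open>\<bar>j\<bar> \<le> int n\<close> suffices because
  the walk cannot get further in \<open>n\<close> steps; thus \<open>h\<close> itself may be
  unbounded.\<close>

lemma walk_transform_tail:
  fixes h :: "nat \<Rightarrow> int \<Rightarrow> real"
  assumes H: "\<And>i j. i < n \<Longrightarrow> \<bar>j\<bar> \<le> int n \<Longrightarrow> \<bar>h i j\<bar> \<le> H i"
    and v: "(\<Sum>i<n. (H i)\<^sup>2) \<le> v" and x: "0 < v" "0 < x"
  shows "measure coins {c. x * sqrt v \<le> \<bar>\<Sum>i<n. h i (walk c i) * coin_sign (c i)\<bar>} \<le> 2 * exp (- x\<^sup>2 / 2)"
proof -
  define D where "D i c = (if i < n then h i (walk c i) * coin_sign (c i) else 0)" for i c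
  define c where "c i = (if i < n then H i else 0)" for i
  have "measure coins {\<omega> \<in> space coins. x * sqrt v \<le> \<bar>\<Sum>i<n. D i \<omega>\<bar>} \<le> 2 * exp (- x\<^sup>2 / 2)"
  proof (rule Azuma_tail[OF prob_space_coin, where c = c])
    show "D i \<in> borel_measurable coins" for i
    proof -
      note [measurable] = borel_measurable_walk[of "h i"]
      show ?thesis unfolding D_def by measurable
    qed
    show "D i \<omega> = D i \<omega>'" if "\<And>j. j \<le> i \<Longrightarrow> \<omega> j = \<omega>' j" for i \<omega> \<omega>'
      using that walk_cong[of i \<omega> \<omega>'] by (simp add: D_def)
    show "(\<integral>y. D i (\<omega> (i := y)) \<partial>coin) = 0" for i \<omega>
    proof -
      have "walk (\<omega> (i := y)) i = walk \<omega> i" for y by (rule walk_cong) auto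
      then show ?thesis using expectation_sign[of "h i (walk \<omega> i)"] 
        by (cases "i < n") (simp_all only: D_def if_True if_False integral_zero fun_upd_same)
    qed
    show "\<bar>D i \<omega>\<bar> \<le> c i" for i \<omega>
      using H[of i "walk \<omega> i"] abs_walk_le[of \<omega> i] by (auto simp: D_def c_def abs_mult)
  qed (use v x in \<open>auto simp: c_def\<close>)
  then show ?thesis by (simp add: D_def)
qed

text \<open>The increment is the transform by the deterministic weight
  \<open>of_bool (b \<le> i)\<close>, whose squares sum to \<open>a - b\<close>.\<close>

lemma walk_increment_tail:
  assumes "b < a" "0 < x"
  shows "measure coins {c. x * sqrt (real a - real b) \<le> \<bar>real_of_int (walk c a) - real_of_int (walk c b)\<bar>}
    \<le> 2 * exp (- x\<^sup>2 / 2)"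
proof -
  have eq: "real_of_int (walk c a) - real_of_int (walk c b) = (\<Sum>i<a. of_bool (b \<le> i) * coin_sign (c i))" for c
  proof -
    have "(\<Sum>i<a. coin_sign (c i)) = (\<Sum>i<b. coin_sign (c i)) + (\<Sum>i=b..<a. coin_sign (c i))"
      using sum.atLeastLessThan_concat[of 0 b a "\<lambda>i. coin_sign (c i)"] assms
      by (simp only: atLeast0LessThan less_imp_le)
    moreover have "(\<Sum>i<a. of_bool (b \<le> i) * coin_sign (c i)) = (\<Sum>i=b..<a. coin_sign (c i))"
      by (rule sum.mono_neutral_cong_right) auto
    ultimately show ?thesis by (simp add: of_int_walk)
  qed
  have "(\<Sum>i<a. (of_bool (b \<le> i))\<^sup>2) = (\<Sum>i=b..<a. 1::real)"
    by (rule sum.mono_neutral_cong_right) auto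
  then show ?thesis
    unfolding eq using assms
    by (intro walk_transform_tail[where H = "\<lambda>i. of_bool (b \<le> i)" and h = "\<lambda>i _. of_bool (b \<le> i)"]) auto
qed

text \<open>The stretched exponential beats every polynomial, so a union bound over
  \<open>I n\<close> stays summable and one almost sure event serves all its indices at once. Hence
  the thresholds \<open>n powr \<delta>\<close> in the estimates below.\<close>

lemma Borel_Cantelli_polynomially_many:
  fixes E :: "nat \<Rightarrow> 'i \<Rightarrow> 'a set"
  assumes "prob_space M" and "0 < \<delta>"
    and fin: "\<And>n. finite (I n)" "\<And>n. card (I n) \<le> K * (n + 1) ^ k"
    and E: "\<And>n i. i \<in> I n \<Longrightarrow> E n i \<in> sets M"
    and P: "\<And>n i. 1 \<le> n \<Longrightarrow> i \<in> I n \<Longrightarrow> measure M (E n i) \<le> 2 * exp (- (real n powr \<delta>)\<^sup>2 / 2)"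
  shows "AE \<omega> in M. \<forall>\<^sub>F n in sequentially. \<forall>i\<in>I n. \<omega> \<notin> E n i"
proof -
  interpret prob_space M by fact
  have sets: "(\<Union>i\<in>I n. E n i) \<in> sets M" for n using fin E by auto
    have "(\<lambda>n. real (2 * K) * (real (n + 1) ^ k * exp (- (real n powr \<delta>)\<^sup>2 / 2))) \<in> O(\<lambda>n. 1 / real n ^ 2)"
      using \<open>0 < \<delta>\<close> by real_asymp
    then obtain C where C: "\<forall>\<^sub>F n in sequentially. norm (real (2 * K) * (real (n + 1) ^ k * exp (- (real n powr \<delta>)\<^sup>2 / 2))) \<le> C * norm (1 / real n ^ 2)"
      by (elim landau_o.bigE)
  have "summable (\<lambda>n. measure M (\<Union>i\<in>I n. E n i))"
  proof (rule summable_comparison_test_ev)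
    show "\<forall>\<^sub>F n in sequentially. norm (measure M (\<Union>i\<in>I n. E n i)) \<le> C * (1 / real n ^ 2)"
      using C eventually_ge_at_top[of 1]
    proof eventually_elim
      case (elim n)
      have "measure M (\<Union>i\<in>I n. E n i) \<le> (\<Sum>i\<in>I n. measure M (E n i))"
        using fin E by (intro measure_UNION_le) auto
      also have "\<dots> \<le> real (card (I n)) * (2 * exp (- (real n powr \<delta>)\<^sup>2 / 2))"
        using P elim by (intro sum_bounded_above) auto
      also have "\<dots> \<le> real (K * (n + 1) ^ k) * (2 * exp (- (real n powr \<delta>)\<^sup>2 / 2))"
        using fin(2)[of n] by (intro mult_right_mono) (auto simp del: of_nat_mult of_nat_power)
      finally show ?case using elim by (simp add: mult_ac)
    qed
    show "summable (\<lambda>n. C * (1 / real n ^ 2))"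
      by (intro summable_mult) (use inverse_power_summable[of 2, where 'a = real] in \<open>simp add: field_simps\<close>)
  qed
  then have "AE \<omega> in M. \<forall>\<^sub>F n in sequentially. \<omega> \<in> space M - (\<Union>i\<in>I n. E n i)"
    by (intro borel_cantelli_AE1) (auto simp: sets emeasure_eq_measure)
  then show ?thesis by eventually_elim (auto elim: eventually_mono)
qed

text \<open>The property of a sample from which convergence, continuity and closeness to the walk
  all follow deterministically. Row 0 is the walk at level \<open>m\<close>; row 1, the coins that
  choose between step and excursion, is read as a walk too, which controls the fluctuation of
  \<open>exits\<close>.\<close>

definition tame :: "real \<Rightarrow> nat \<Rightarrow> (nat \<times> nat \<Rightarrow> bool) \<Rightarrow> bool" where
  "tame \<delta> n\<^sub>0 c \<longleftrightarrow> (\<forall>n\<ge>n\<^sub>0. \<forall>m\<le>n. \<forall>r\<le>1. \<forall>a\<le>n. \<forall>b\<le>a.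
     \<bar>real_of_int (walk (coin_row r ((zoom ^^ m) c)) a) - real_of_int (walk (coin_row r ((zoom ^^ m) c)) b)\<bar>
       \<le> real n powr \<delta> * sqrt (real a - real b))"

text \<open>Zooming and selecting a row preserve the fair-coin law, so each event has the
  probability bounded in \<open>walk_increment_tail\<close>, and there are at most
  \<open>2 * (n + 1) ^ 3\<close> of them.\<close>

lemma AE_tame:
  assumes "0 < \<delta>"
  shows "AE c in coins. \<exists>n\<^sub>0. tame \<delta> n\<^sub>0 c"
proof -
  define I :: "nat \<Rightarrow> (nat \<times> nat \<times> nat \<times> nat) set" where
    "I n = {..n} \<times> {..1} \<times> {..n} \<times> {..n}" for n
  define E where "E n = (\<lambda>(m, r, a, b). if b < a then
      {c \<in> space coins. (coin_row r \<circ> (zoom ^^ m)) c \<in> {x. real n powr \<delta> * sqrt (real a - real b) < \<bar>real_of_int (walk x a) - real_of_int (walk x b)\<bar>}}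
      else {})" for n :: nat
  have mp: "distr coins coins (coin_row r \<circ> (zoom ^^ m)) = coins" for r m
  proof -
    have "distr coins coins (coin_row r \<circ> (zoom ^^ m)) = distr (distr coins coins (zoom ^^ m)) coins (coin_row r)"
      by (subst distr_distr) auto
    then show ?thesis by (simp only: distr_zoom_pow distr_row)
  qed
  have S[measurable]: "{x. real n powr \<delta> * sqrt (real a - real b) < \<bar>real_of_int (walk x a) - real_of_int (walk x b)\<bar>} \<in> sets coins" for n a b
  proof -
    have "{x\<in>space coins. real n powr \<delta> * sqrt (real a - real b) < \<bar>real_of_int (walk x a) - real_of_int (walk x b)\<bar>} \<in> sets coins"
      by measurable
    then show ?thesis by simp
  qed
  have S'[measurable]: "{x. real n powr \<delta> * sqrt (real a - real b) \<le> \<bar>real_of_int (walk x a) - real_of_int (walk x b)\<bar>} \<in> sets coins" for n a b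
  proof -
    have "{x\<in>space coins. real n powr \<delta> * sqrt (real a - real b) \<le> \<bar>real_of_int (walk x a) - real_of_int (walk x b)\<bar>} \<in> sets coins"
      by measurable
    then show ?thesis by simp
  qed
  have rz: "(coin_row r \<circ> (zoom ^^ m)) \<in> measurable coins coins" for r m
    by (rule measurable_comp[OF measurable_zoom_pow measurable_row])
  have "AE c in coins. \<forall>\<^sub>F n in sequentially. \<forall>i\<in>I n. c \<notin> E n i"
  proof (rule Borel_Cantelli_polynomially_many[OF prob_space_coins assms, where K = 2 and k = 3])
    show "finite (I n)" "card (I n) \<le> 2 * (n + 1) ^ 3" for n
      by (auto simp: I_def card_cartesian_product power3_eq_cube algebra_simps)
    show "E n i \<in> sets coins" if "i \<in> I n" for n i
      unfolding E_def using measurable_sets[OF rz S]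
      by (auto simp: vimage_def split: prod.splits)
    show "measure coins (E n i) \<le> 2 * exp (- (real n powr \<delta>)\<^sup>2 / 2)" if "1 \<le> n" "i \<in> I n" for n i
    proof -
      obtain m r a b where i: "i = (m, r, a, b)" by (cases i)
      show ?thesis
      proof (cases "b < a")
        case True
        interpret prob_space coins by (rule prob_space_coins)
        have "measure coins (E n i) = measure coins {x. real n powr \<delta> * sqrt (real a - real b) < \<bar>real_of_int (walk x a) - real_of_int (walk x b)\<bar>}"
          unfolding E_def i using True measure_preserving_vimage[OF mp rz S] by simp
        also have "\<dots> \<le> measure coins {x. real n powr \<delta> * sqrt (real a - real b) \<le> \<bar>real_of_int (walk x a) - real_of_int (walk x b)\<bar>}"
          using prob_space_coins S' by (intro finite_measure.finite_measure_mono) (auto simp: prob_space_def)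
        also have "\<dots> \<le> 2 * exp (- (real n powr \<delta>)\<^sup>2 / 2)"
          using True that by (intro walk_increment_tail) auto
        finally show ?thesis .
      qed (simp add: E_def i)
    qed
  qed
  then show ?thesis
  proof eventually_elim
    case (elim c)
    then obtain n\<^sub>0 where n0: "\<And>n i. n\<^sub>0 \<le> n \<Longrightarrow> i \<in> I n \<Longrightarrow> c \<notin> E n i"
      by (auto simp: eventually_sequentially)
    have "tame \<delta> n\<^sub>0 c"
      unfolding tame_def
    proof (intro allI impI)
      fix n m r a b :: nat assume *: "n\<^sub>0 \<le> n" "m \<le> n" "r \<le> 1" "a \<le> n" "b \<le> a"
      show "\<bar>real_of_int (walk (coin_row r ((zoom ^^ m) c)) a) - real_of_int (walk (coin_row r ((zoom ^^ m) c)) b)\<bar>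
       \<le> real n powr \<delta> * sqrt (real a - real b)"
        using n0[OF *(1), of "(m, r, a, b)"] * by (cases "b < a") (auto simp: E_def I_def not_less)
    qed
    then show ?case ..
  qed
qed

section \<open>The Wiener process as the limit of refined walks\<close>

definition walk_at :: "nat \<Rightarrow> real \<Rightarrow> (nat \<times> nat \<Rightarrow> bool) \<Rightarrow> real" where
  "walk_at m t c = real_of_int (walk (coin_row 0 ((zoom ^^ m) c)) (nat \<lfloor>4 ^ m * t\<rfloor>)) / 2 ^ m"

text \<open>The limit exists only almost surely; elsewhere \<open>lim\<close> is arbitrary.\<close>

definition wiener :: "real \<Rightarrow> (nat \<times> nat \<Rightarrow> bool) \<Rightarrow> real" where
  "wiener t c = lim (\<lambda>m. walk_at m t c)"

lemma measurable_walk_at [measurable]: "walk_at m t \<in> borel_measurable coins"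
proof -
  have "(\<lambda>c. real_of_int (walk c n)) \<circ> coin_row 0 \<circ> (zoom ^^ m) \<in> borel_measurable coins" for n
    by (intro measurable_comp[OF measurable_zoom_pow] measurable_comp[OF measurable_row]) measurable
  then show ?thesis unfolding walk_at_def[abs_def] comp_def by measurable
qed

lemma measurable_wiener [measurable]: "wiener t \<in> borel_measurable coins"
  unfolding wiener_def[abs_def] by (rule borel_measurable_lim_metric) measurable

lemma row_zoom: "coin_row 0 (zoom c) = refine (coin_row 0 c) (coin_row 1 c) (coin_row 2 c)"
  by (rule ext) (simp add: coin_row_def[abs_def] zoom_def)

lemma walk_zoom: "walk (coin_row 0 (zoom c)) (2 * n) = 2 * walk (coin_row 0 c) (exits (coin_row 1 c) n)"
  unfolding row_zoom by (rule walk_refine)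

lemma exits_le: "exits e n \<le> n"
  using sum_bounded_above[of "{..<n}" "\<lambda>i. of_bool (e i)" "1::nat"] by (simp add: exits_def)

lemma abs_walk_diff_le: "\<bar>real_of_int (walk x (a + r)) - real_of_int (walk x a)\<bar> \<le> real r"
proof (induction r)
  case (Suc r)
  have "real_of_int (walk x (a + Suc r)) = real_of_int (walk x (a + r)) + coin_sign (x (a + r))"
    by (simp add: walk_def)
  then show ?case using Suc by (auto split: if_splits)
qed simp

lemma tameD:
  assumes "tame \<delta> n\<^sub>0 c" "n\<^sub>0 \<le> n" "m \<le> n" "r \<le> 1" "a \<le> n" "b \<le> n"
  shows "\<bar>real_of_int (walk (coin_row r ((zoom ^^ m) c)) a) - real_of_int (walk (coin_row r ((zoom ^^ m) c)) b)\<bar>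
    \<le> real n powr \<delta> * sqrt \<bar>real a - real b\<bar>"
proof (cases "b \<le> a")
  case True
  then show ?thesis using assms unfolding tame_def by auto
next
  case False
  then have "\<bar>real_of_int (walk (coin_row r ((zoom ^^ m) c)) b) - real_of_int (walk (coin_row r ((zoom ^^ m) c)) a)\<bar>
    \<le> real n powr \<delta> * sqrt (real b - real a)"
    using assms unfolding tame_def by auto
  then show ?thesis using False by (simp add: abs_minus_commute)
qed

text \<open>The refined walk at time \<open>4 * a\<close> is twice the coarse walk at time
  \<open>k\<close>, the number of successes of \<open>2 * a\<close> fair coins. Since
  \<open>k - a\<close> is of order \<open>sqrt a\<close>, the coarse walk moves by about
  \<open>a powr (1/4)\<close> between \<open>a\<close> and \<open>k\<close>. With \<open>a\<close>
  near \<open>4 ^ m * t\<close>, division by \<open>2 ^ m\<close> leaves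
  \<open>2 powr (- m / 2)\<close>; the factors \<open>n powr \<delta>\<close> give back at most
  \<open>2 powr (m / 4)\<close> because \<open>\<delta> \<le> 1/16\<close>.\<close>

lemma walk_at_step:
  assumes T: "tame \<delta> n\<^sub>0 c" and \<delta>: "0 < \<delta>" "\<delta> \<le> 1/16" and t: "0 \<le> t"
  defines "C \<equiv> 2 + 2 * (real n\<^sub>0 + 4) powr (2 * \<delta>)"
  shows "\<bar>walk_at (Suc m) t c - walk_at m t c\<bar> \<le> C * (t + 1) powr (1/4 + 2 * \<delta>) * (2 powr (-1/4)) ^ m"
proof -
  define c' where "c' = (zoom ^^ m) c"
  define a where "a = nat \<lfloor>4 ^ m * t\<rfloor>"
  define b where "b = nat \<lfloor>4 ^ Suc m * t\<rfloor>"
  define k where "k = exits (coin_row 1 c') (2 * a)"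
  \<comment> \<open>Large enough for \<open>tame\<close> to apply at level \<open>m\<close> and at
    all times up to \<open>2 * a\<close>.\<close>
  define n where "n = n\<^sub>0 + m + 2 * a + 1"
  let ?S = "\<lambda>j. real_of_int (walk (coin_row 0 c') j)"
  let ?S' = "\<lambda>j. real_of_int (walk (coin_row 0 (zoom c')) j)"
  have a_le: "real a \<le> 4 ^ m * t" "4 ^ m * t < real a + 1"
    using t by (simp_all add: a_def)
  have a_le3: "real a \<le> 4 ^ m * (t + 1)"
    by (rule order_trans[OF a_le(1)]) simp
  \<comment> \<open>Rounding before or after multiplying by four differs by at most three
    steps.\<close>
  have ab: "4 * a \<le> b" "b \<le> 4 * a + 3"
  proof -
    have b': "real b \<le> 4 ^ Suc m * t" "4 ^ Suc m * t < real b + 1"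
      using t by (simp_all add: b_def)
    from b' a_le show "4 * a \<le> b" "b \<le> 4 * a + 3" by auto
  qed
  have s1: "\<bar>?S' b - ?S' (4 * a)\<bar> \<le> 3"
    using abs_walk_diff_le[of "coin_row 0 (zoom c')" "4 * a" "b - 4 * a"] ab by auto
  have s2: "?S' (4 * a) = 2 * ?S k"
    using walk_zoom[of c' "2 * a"] by (simp add: k_def)
  have k: "\<bar>real k - real a\<bar> \<le> real n powr \<delta> * sqrt (real (2 * a))"
  proof -
    \<comment> \<open>Twice the deviation of \<open>k\<close> from its mean \<open>a\<close> is the
      walk of the exit coins, to which \<open>tame\<close> applies.\<close>
    have "real_of_int (2 * int k - int (2 * a)) = real_of_int (walk (coin_row 1 c') (2 * a))"
      unfolding k_def walk_exits ..
    then have "2 * real k - 2 * real a = real_of_int (walk (coin_row 1 c') (2 * a))" by simp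
    then have "2 * \<bar>real k - real a\<bar> = \<bar>real_of_int (walk (coin_row 1 c') (2 * a))\<bar>"
      by (metis abs_mult abs_numeral right_diff_distrib)
    also have "\<dots> \<le> real n powr \<delta> * sqrt (real (2 * a))"
      using tameD[OF T, of n m 1 "2 * a" 0] by (simp add: n_def c'_def walk_def)
    finally show ?thesis by (rule order_trans[rotated]) simp
  qed
  have "\<bar>?S k - ?S a\<bar> \<le> real n powr \<delta> * sqrt \<bar>real k - real a\<bar>"
    unfolding c'_def using exits_le[of "coin_row 1 c'" "2 * a"]
    by (intro tameD[OF T]) (auto simp: n_def k_def)
  also have "\<dots> \<le> real n powr \<delta> * sqrt (real n powr \<delta> * sqrt (real (2 * a)))"
    using k by (intro mult_left_mono) auto
  also have "\<dots> = real n powr \<delta> * (real n powr (\<delta> / 2) * real (2 * a) powr (1/4))"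
    by (simp add: real_sqrt_mult powr_half_sqrt[symmetric] powr_powr powr_mult)
  also have "\<dots> \<le> real n powr (2 * \<delta>) * real (2 * a) powr (1/4)"
    unfolding mult.assoc[symmetric] powr_add[symmetric]
    using \<delta> by (intro mult_right_mono powr_mono) (auto simp: n_def)
  finally have s3: "\<bar>?S k - ?S a\<bar> \<le> real n powr (2 * \<delta>) * real (2 * a) powr (1/4)" .
  have m4: "real m + 1 \<le> 4 ^ m" by (induction m) auto
  have "real n \<le> (real n\<^sub>0 + 4) * 4 ^ m * (t + 1)"
  proof -
    have "real n\<^sub>0 * 1 \<le> real n\<^sub>0 * (4 ^ m * (t + 1))"
      using t by (intro mult_left_mono) (auto intro!: mult_ge1_I)
    moreover have "real m + 1 \<le> 4 ^ m * (t + 1)"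
      using m4 t by (smt (verit, ccfv_SIG) mult_left_le mult_le_cancel_left1 zero_le_power)
    moreover have "2 * real a \<le> 2 * (4 ^ m * (t + 1))" using a_le3 by simp
    moreover have "0 \<le> 4 ^ m * (t + 1)" using t by simp
    ultimately show ?thesis by (simp add: n_def algebra_simps)
  qed
  then have "real n powr (2 * \<delta>) \<le> ((real n\<^sub>0 + 4) * 4 ^ m * (t + 1)) powr (2 * \<delta>)"
    using \<delta> by (intro powr_mono2) auto
  also have "\<dots> = (real n\<^sub>0 + 4) powr (2 * \<delta>) * 2 powr (4 * \<delta> * m) * (t + 1) powr (2 * \<delta>)"
  proof -
    have "(4::real) ^ m = 2 powr (2 * m)"
      by (simp add: powr_realpow[symmetric] powr_powr[symmetric])
    then show ?thesis using t by (simp add: powr_mult powr_powr mult_ac)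
  qed
  also have "\<dots> \<le> (real n\<^sub>0 + 4) powr (2 * \<delta>) * 2 powr (m / 4) * (t + 1) powr (2 * \<delta>)"
    using \<delta> t mult_right_mono[of "4 * \<delta>" "1/4" "real m"]
    by (intro mult_right_mono mult_left_mono powr_mono) auto
  finally have n_le: "real n powr (2 * \<delta>) \<le> (real n\<^sub>0 + 4) powr (2 * \<delta>) * 2 powr (m / 4) * (t + 1) powr (2 * \<delta>)" .
  have "real (2 * a) powr (1/4) \<le> (16 * (4 ^ m * (t + 1))) powr (1/4)"
  proof (intro powr_mono2)
    have "0 \<le> 4 ^ m * (t + 1)" using t by simp
    moreover have "real (2 * a) = 2 * real a" by simp
    ultimately show "real (2 * a) \<le> 16 * (4 ^ m * (t + 1))" using a_le3 by linarith
  qed auto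
  also have "\<dots> = 2 * 2 powr (m / 2) * (t + 1) powr (1/4)"
  proof -
    have "(4::real) ^ m = 2 powr (2 * m)" "(16::real) = 2 powr 4"
      by (simp_all add: powr_realpow[symmetric] powr_powr[symmetric])
    then show ?thesis using t by (simp add: powr_mult powr_powr mult_ac)
  qed
  finally have a4: "real (2 * a) powr (1/4) \<le> 2 * 2 powr (m / 2) * (t + 1) powr (1/4)" .
  have "\<bar>?S k - ?S a\<bar> \<le> ((real n\<^sub>0 + 4) powr (2 * \<delta>) * 2 powr (m / 4) * (t + 1) powr (2 * \<delta>)) * (2 * 2 powr (m / 2) * (t + 1) powr (1/4))"
    by (rule order_trans[OF s3]) (intro mult_mono n_le a4, auto)
  also have "\<dots> = 2 * (real n\<^sub>0 + 4) powr (2 * \<delta>) * (t + 1) powr (1/4 + 2 * \<delta>) * 2 powr (3 * m / 4)"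
  proof -
    have "2 powr (3 * m / 4) = 2 powr (m / 4) * 2 powr (m / 2)"
      by (simp add: powr_add[symmetric])
    then show ?thesis by (simp add: powr_add)
  qed
  finally have s4: "\<bar>?S k - ?S a\<bar> \<le> 2 * (real n\<^sub>0 + 4) powr (2 * \<delta>) * (t + 1) powr (1/4 + 2 * \<delta>) * 2 powr (3 * m / 4)" .
  \<comment> \<open>Both factors are at least 1, so the constant rounding error fits under the same
    product; it is the summand 2 in \<open>C\<close>.\<close>
  have "1 \<le> (t + 1) powr (1/4 + 2 * \<delta>)" using t \<delta> by (intro ge_one_powr_ge_zero) auto
  moreover have "1 \<le> 2 powr (3 * m / 4)" by (intro ge_one_powr_ge_zero) auto
  ultimately have one: "1 * 1 \<le> (t + 1) powr (1/4 + 2 * \<delta>) * 2 powr (3 * m / 4)"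
    by (intro mult_mono) auto
  have "walk_at (Suc m) t c - walk_at m t c = ((?S' b - ?S' (4 * a)) / 2 + (?S k - ?S a)) / 2 ^ m"
  proof -
    have "walk_at m t c = ?S a / 2 ^ m" "walk_at (Suc m) t c = ?S' b / 2 ^ Suc m"
      by (simp_all only: walk_at_def c'_def a_def b_def funpow.simps o_apply)
    then show ?thesis using s2 by (simp add: field_simps)
  qed
  also have "\<bar>\<dots>\<bar> \<le> (2 + \<bar>?S k - ?S a\<bar>) / 2 ^ m"
  proof -
    have "\<bar>u / 2 + v\<bar> \<le> 2 + \<bar>v\<bar>" if "\<bar>u\<bar> \<le> 3" for u v :: real
      using that by linarith
    from divide_right_mono[OF this[OF s1], of "2 ^ m"] show ?thesis by (simp add: abs_divide)
  qed
  also have "\<dots> \<le> (C * ((t + 1) powr (1/4 + 2 * \<delta>) * 2 powr (3 * m / 4))) / 2 ^ m"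
    using s4 one by (intro divide_right_mono) (auto simp: C_def algebra_simps)
  also have "2 powr (3 * m / 4) / 2 ^ m = (2 powr (-1/4)) ^ m"
    by (simp add: powr_realpow[symmetric] powr_powr powr_diff[symmetric])
  then have "(C * ((t + 1) powr (1/4 + 2 * \<delta>) * 2 powr (3 * m / 4))) / 2 ^ m = C * (t + 1) powr (1/4 + 2 * \<delta>) * (2 powr (-1/4)) ^ m"
    by (metis (no_types, lifting) mult.assoc times_divide_eq_right)
  finally show ?thesis .
qed

lemma geometric_Cauchy:
  fixes x :: "nat \<Rightarrow> real"
  assumes step: "\<And>m. \<bar>x (Suc m) - x m\<bar> \<le> K * q ^ m" and q: "0 \<le> q" "q < 1"
  shows "x \<longlonglongrightarrow> lim x" "\<bar>lim x - x m\<bar> \<le> K / (1 - q) * q ^ m"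
proof -
  have sum: "summable (\<lambda>m. K * q ^ m)" using q by (intro summable_mult summable_geometric) auto
  have s: "summable (\<lambda>m. x (Suc m) - x m)"
    by (rule summable_comparison_test'[OF sum, of 0]) (use step in auto)
  have "(\<lambda>n. x 0 + (\<Sum>m<n. x (Suc m) - x m)) \<longlonglongrightarrow> x 0 + (\<Sum>m. x (Suc m) - x m)"
    by (intro tendsto_intros summable_LIMSEQ s)
  then have "convergent x" unfolding sum_lessThan_telescope by (auto simp: convergent_def)
  then show L: "x \<longlonglongrightarrow> lim x" by (simp add: convergent_LIMSEQ_iff)
  have d: "\<bar>x (m + k) - x m\<bar> \<le> K * q ^ m * (\<Sum>i<k. q ^ i)" for k
  proof (induction k)
    case (Suc k)
    then show ?case using step[of "m + k"] by (simp add: power_add algebra_simps)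
  qed simp
  have K: "0 \<le> K" using step[of 0] by auto
  have "\<bar>x (m + k) - x m\<bar> \<le> K / (1 - q) * q ^ m" for k
  proof -
    have "(\<Sum>i<k. q ^ i) \<le> 1 / (1 - q)"
      using q sum_le_suminf[OF summable_geometric[of q], of "{..<k}"] by (simp add: suminf_geometric)
    then have "K * q ^ m * (\<Sum>i<k. q ^ i) \<le> K * q ^ m * (1 / (1 - q))"
      using K q by (intro mult_left_mono) auto
    with d[of k] show ?thesis by simp
  qed
  moreover have "(\<lambda>k. \<bar>x (m + k) - x m\<bar>) \<longlonglongrightarrow> \<bar>lim x - x m\<bar>"
    using LIMSEQ_ignore_initial_segment[OF L, of m] by (intro tendsto_intros) (simp add: add.commute)
  ultimately show "\<bar>lim x - x m\<bar> \<le> K / (1 - q) * q ^ m"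
    by (intro LIMSEQ_le_const2) auto
qed

text \<open>The constant of \<open>walk_at_step\<close> summed over the geometric series of ratio
  \<open>2 powr (-1/4)\<close>.\<close>

definition rate :: "real \<Rightarrow> nat \<Rightarrow> real" where
  "rate \<delta> n\<^sub>0 = (2 + 2 * (real n\<^sub>0 + 4) powr (2 * \<delta>)) / (1 - 2 powr (-1/4))"

lemma two_powr_less_1: "(2::real) powr (-1/4) < 1"
  using powr_less_mono[of "-1/4" 0 "2::real"] by simp

lemma wiener_walk_at:
  assumes "tame \<delta> n\<^sub>0 c" "0 < \<delta>" "\<delta> \<le> 1/16" "0 \<le> t"
  shows "(\<lambda>m. walk_at m t c) \<longlonglongrightarrow> wiener t c"
    and "\<bar>wiener t c - walk_at m t c\<bar> \<le> rate \<delta> n\<^sub>0 * (t + 1) powr (1/4 + 2 * \<delta>) * (2 powr (-1/4)) ^ m"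
  using geometric_Cauchy[of "\<lambda>m. walk_at m t c", OF walk_at_step[OF assms]] two_powr_less_1
  by (auto simp: wiener_def rate_def)

lemma rate_nonneg: "0 \<le> rate \<delta> n\<^sub>0"
  using two_powr_less_1 by (simp add: rate_def)

text \<open>The approximations converge uniformly on bounded time intervals, and at two times less
  than \<open>(1/4) ^ m\<close> apart the approximation of level \<open>m\<close> differs by at most
  a single step of size \<open>(1/2) ^ m\<close>.\<close>

lemma continuous_wiener:
  assumes T: "tame \<delta> n\<^sub>0 c" "0 < \<delta>" "\<delta> \<le> 1/16"
  shows "continuous_on {0..} (\<lambda>t. wiener t c)"
  unfolding continuous_on_iff
proof (intro ballI allI impI)
  fix t e :: real assume t: "t \<in> {0..}" and e: "0 < e"
  define K where "K = rate \<delta> n\<^sub>0 * (t + 2) powr (1/4 + 2 * \<delta>)"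
  have "(\<lambda>m. (1/2) ^ m + 2 * K * (2 powr (-1/4)) ^ m) \<longlonglongrightarrow> 0 + 2 * K * 0"
    using two_powr_less_1 by (intro tendsto_intros LIMSEQ_power_zero) auto
  then have "\<forall>\<^sub>F m in sequentially. (1/2) ^ m + 2 * K * (2 powr (-1/4)) ^ m < e"
    using e by (auto dest: order_tendstoD(2))
  then obtain m where m: "(1/2) ^ m + 2 * K * (2 powr (-1/4)) ^ m < e"
    by (auto simp: eventually_sequentially)
  have near: "\<bar>wiener s c - walk_at m s c\<bar> \<le> K * (2 powr (-1/4)) ^ m" if "0 \<le> s" "s \<le> t + 1" for s
  proof -
    have "(s + 1) powr (1/4 + 2 * \<delta>) \<le> (t + 2) powr (1/4 + 2 * \<delta>)"
      using that assms by (intro powr_mono2) auto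
    then have "rate \<delta> n\<^sub>0 * (s + 1) powr (1/4 + 2 * \<delta>) * (2 powr (-1/4)) ^ m \<le> K * (2 powr (-1/4)) ^ m"
      unfolding K_def by (intro mult_right_mono mult_left_mono rate_nonneg) auto
    with wiener_walk_at(2)[OF T that(1), of m] show ?thesis by linarith
  qed
  show "\<exists>d>0. \<forall>t'\<in>{0..}. dist t' t < d \<longrightarrow> dist (wiener t' c) (wiener t c) < e"
  proof (intro exI conjI ballI impI)
    show "0 < (1/4::real) ^ m" by simp
    fix s :: real assume s: "s \<in> {0..}" "dist s t < (1/4) ^ m"
    have "(1/4::real) ^ m \<le> 1" by (intro power_le_one) auto
    then have st1: "s \<le> t + 1"
      using s unfolding dist_real_def by linarith
    have "\<bar>4 ^ m * s - 4 ^ m * t\<bar> = 4 ^ m * \<bar>s - t\<bar>"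
      by (simp add: right_diff_distrib[symmetric] abs_mult)
    also have "\<dots> < 4 ^ m * (1/4) ^ m"
      using s by (intro mult_strict_left_mono) (auto simp: dist_real_def)
    also have "\<dots> = (1::real)" by (simp add: power_mult_distrib[symmetric])
    finally have st2: "\<bar>4 ^ m * s - 4 ^ m * t\<bar> < 1" .
    have "\<bar>walk_at m s c - walk_at m t c\<bar> \<le> (1/2) ^ m"
    proof -
      define i j where "i = nat \<lfloor>4 ^ m * s\<rfloor>" and "j = nat \<lfloor>4 ^ m * t\<rfloor>"
      have "real i \<le> 4 ^ m * s" "4 ^ m * s < real i + 1" "real j \<le> 4 ^ m * t" "4 ^ m * t < real j + 1"
        using s t by (simp_all add: i_def j_def)
      then have "i = j \<or> i = j + 1 \<or> j = i + 1" using st2 by linarith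
      then have "\<bar>real_of_int (walk (coin_row 0 ((zoom ^^ m) c)) i) - real_of_int (walk (coin_row 0 ((zoom ^^ m) c)) j)\<bar> \<le> 1"
        using abs_walk_diff_le[of _ i 1] abs_walk_diff_le[of _ j 1] by (auto simp: abs_minus_commute)
      then show ?thesis
        unfolding walk_at_def i_def[symmetric] j_def[symmetric] diff_divide_distrib[symmetric] abs_divide
        by (simp add: power_divide divide_right_mono)
    qed
    moreover have "\<bar>wiener s c - walk_at m s c\<bar> \<le> K * (2 powr (-1/4)) ^ m"
      "\<bar>wiener t c - walk_at m t c\<bar> \<le> K * (2 powr (-1/4)) ^ m"
      using near s t st1 by auto
    ultimately show "dist (wiener s c) (wiener t c) < e"
      using m unfolding dist_real_def by linarith
  qed
qed

lemma wiener_0: "wiener 0 c = 0"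
  by (simp add: wiener_def walk_at_def walk_def)

text \<open>Level 0 of \<open>walk_at\<close> is the unrefined walk, so the sum of all level changes
  bounds its distance from the limit.\<close>

lemma wiener_walk:
  assumes "tame \<delta> n\<^sub>0 c" "0 < \<delta>" "\<delta> \<le> 1/16" "0 \<le> t"
  shows "\<bar>wiener t c - real_of_int (walk (coin_row 0 c) (nat \<lfloor>t\<rfloor>))\<bar> \<le> rate \<delta> n\<^sub>0 * (t + 1) powr (1/4 + 2 * \<delta>)"
  using wiener_walk_at(2)[OF assms, of 0] by (simp add: walk_at_def)

section \<open>Independence and characteristic functions of the increments\<close>

lemma (in prob_space) indep_vars_empty: "indep_vars M' X {}"
  by (simp add: indep_vars_def2 indep_sets_def)

text \<open>Independence says that the joint law is the product of the marginal laws, and pulling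
  back along \<open>\<phi>\<close> changes none of these laws.\<close>

lemma (in prob_space) indep_vars_measure_preserving:
  assumes \<phi>: "\<phi> \<in> measurable M N" "distr M N \<phi> = N"
    and X: "prob_space.indep_vars N S X I"
  shows "indep_vars S (\<lambda>i \<omega>. X i (\<phi> \<omega>)) I"
proof (cases "I = {}")
  case True then show ?thesis by (simp add: indep_vars_empty)
next
  case False
  interpret N: prob_space N using prob_space_distr[OF \<phi>(1)] \<phi>(2) by simp
  have rv: "X i \<in> measurable N (S i)" if "i \<in> I" for i
    using X that by (auto simp: N.indep_vars_def)
  note [measurable] = \<phi>(1)
  have m: "(\<lambda>x. \<lambda>i\<in>I. X i x) \<in> measurable N (PiM I S)"
    by (intro measurable_restrict rv)
  have "distr M (PiM I S) (\<lambda>x. \<lambda>i\<in>I. X i (\<phi> x)) = distr (distr M N \<phi>) (PiM I S) (\<lambda>x. \<lambda>i\<in>I. X i x)"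
    by (subst distr_distr[OF m \<phi>(1)]) (simp add: comp_def)
  also have "\<dots> = PiM I (\<lambda>i. distr N (S i) (X i))"
    using X N.indep_vars_iff_distr_eq_PiM'[OF False rv] by (simp add: \<phi>(2))
  also have "\<dots> = PiM I (\<lambda>i. distr M (S i) (\<lambda>x. X i (\<phi> x)))"
  proof (rule PiM_cong[OF refl])
    fix i assume "i \<in> I"
    have "distr N (S i) (X i) = distr (distr M N \<phi>) (S i) (X i)" by (simp add: \<phi>(2))
    also have "\<dots> = distr M (S i) (\<lambda>x. X i (\<phi> x))"
      by (subst distr_distr[OF rv[OF \<open>i \<in> I\<close>] \<phi>(1)]) (simp add: comp_def)
    finally show "distr N (S i) (X i) = distr M (S i) (\<lambda>x. X i (\<phi> x))" .
  qed
  finally show ?thesis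
    by (subst indep_vars_iff_distr_eq_PiM'[OF False]) (auto intro!: measurable_compose[OF \<phi>(1)] rv)
qed

text \<open>The tents \<open>max 0 (1 - k * infdist x A)\<close> equal 1 on \<open>A\<close> and
  eventually vanish at each point outside it, where closedness makes the distance positive.\<close>

lemma closed_indicator_limit:
  fixes A :: "real set"
  assumes "closed A"
  shows "\<exists>g. (\<forall>k. continuous_on UNIV (g k)) \<and> (\<forall>k x. 0 \<le> g k x) \<and> (\<forall>k x. g k x \<le> 1) \<and>
    (\<forall>x. (\<lambda>k::nat. g k x) \<longlonglongrightarrow> (indicator A x :: real))"
proof (cases "A = {}")
  case True
  show ?thesis by (rule exI[of _ "\<lambda>_ _. 0"]) (auto simp: True)
next
  case False
  show ?thesis
  proof (intro exI[of _ "\<lambda>k x. max 0 (1 - real k * infdist x A)"] conjI allI)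
    fix x
    show "(\<lambda>k. max 0 (1 - real k * infdist x A)) \<longlonglongrightarrow> indicator A x"
    proof (cases "x \<in> A")
      case True then show ?thesis by simp
    next
      case x: False
      then have pos: "0 < infdist x A"
        using assms False in_closed_iff_infdist_zero[of A x] infdist_nonneg[of x A] by fastforce
      obtain k0 where k0: "1 / infdist x A \<le> real k0" using real_arch_simple by blast
      have "max 0 (1 - real k * infdist x A) = 0" if "k0 \<le> k" for k
      proof -
        have "1 / infdist x A \<le> real k" using k0 that by (meson of_nat_le_iff order_trans)
        then have "1 \<le> real k * infdist x A" using pos by (simp add: field_simps)
        then show ?thesis by simp
      qed
      then show ?thesis using x by (auto intro!: tendsto_eventually exI[of _ k0] simp: eventually_sequentially)
    qed
  qed (auto intro!: continuous_intros mult_nonneg_nonneg infdist_nonneg)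
qed

text \<open>Product formulas for bounded continuous functions survive almost sure limits by
  dominated convergence. Approximating indicators carries them to closed sets, an
  intersection-stable generator of the Borel sets.\<close>

lemma (in prob_space) indep_vars_AE_limit:
  fixes Y :: "nat \<Rightarrow> 'i \<Rightarrow> 'a \<Rightarrow> real"
  assumes fin: "finite I" and Y: "\<And>m. indep_vars (\<lambda>_. borel) (Y m) I"
    and Z: "\<And>i. i \<in> I \<Longrightarrow> Z i \<in> borel_measurable M"
    and lim: "AE \<omega> in M. \<forall>i\<in>I. (\<lambda>m. Y m i \<omega>) \<longlonglongrightarrow> Z i \<omega>"
  shows "indep_vars (\<lambda>_. borel) Z I"
proof (cases "I = {}")
  case True then show ?thesis by (simp add: indep_vars_empty)
next
  case False
  note [measurable] = Z
  have [measurable]: "Y m i \<in> borel_measurable M" if "i \<in> I" for m i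
    using Y[of m] that by (auto simp: indep_vars_def)
  have cont: "(\<integral>\<omega>. (\<Prod>i\<in>I. g i (Z i \<omega>)) \<partial>M) = (\<Prod>i\<in>I. \<integral>\<omega>. g i (Z i \<omega>) \<partial>M)"
    if g: "\<And>i. continuous_on UNIV (g i)" "\<And>i x. 0 \<le> g i x" "\<And>i x. g i x \<le> 1" for g :: "'i \<Rightarrow> real \<Rightarrow> real"
  proof -
    have [measurable]: "g i \<in> borel_measurable borel" for i
      by (rule borel_measurable_continuous_onI[OF g(1)])
    have gl: "(\<lambda>m. g i (Y m i \<omega>)) \<longlonglongrightarrow> g i (Z i \<omega>)" if "(\<lambda>m. Y m i \<omega>) \<longlonglongrightarrow> Z i \<omega>" for i \<omega>
      using g(1)[of i] that by (intro isCont_tendsto_compose[of _ "g i"]) (auto simp: continuous_on_eq_continuous_at)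
    have "(\<lambda>m. \<integral>\<omega>. (\<Prod>i\<in>I. g i (Y m i \<omega>)) \<partial>M) \<longlonglongrightarrow> (\<integral>\<omega>. (\<Prod>i\<in>I. g i (Z i \<omega>)) \<partial>M)"
    proof (rule integral_dominated_convergence[where w = "\<lambda>_. 1"])
      show "AE \<omega> in M. (\<lambda>m. \<Prod>i\<in>I. g i (Y m i \<omega>)) \<longlonglongrightarrow> (\<Prod>i\<in>I. g i (Z i \<omega>))"
        using lim by eventually_elim (auto intro!: tendsto_prod gl)
      show "AE \<omega> in M. norm (\<Prod>i\<in>I. g i (Y m i \<omega>)) \<le> 1" for m
        using g by (auto intro!: AE_I2 prod_le_1 simp: abs_prod)
    qed auto
    moreover have "(\<integral>\<omega>. (\<Prod>i\<in>I. g i (Y m i \<omega>)) \<partial>M) = (\<Prod>i\<in>I. \<integral>\<omega>. g i (Y m i \<omega>) \<partial>M)" for m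
    proof (rule indep_vars_lebesgue_integral[OF fin])
      show "indep_vars (\<lambda>_. borel) (\<lambda>i \<omega>. g i (Y m i \<omega>)) I"
        by (rule indep_vars_compose2[OF Y]) auto
      show "integrable M (\<lambda>\<omega>. g i (Y m i \<omega>))" if "i \<in> I" for i
        using that g by (intro integrable_const_bound[where B = 1]) auto
    qed
    moreover have "(\<lambda>m. \<Prod>i\<in>I. \<integral>\<omega>. g i (Y m i \<omega>) \<partial>M) \<longlonglongrightarrow> (\<Prod>i\<in>I. \<integral>\<omega>. g i (Z i \<omega>) \<partial>M)"
    proof (rule tendsto_prod)
      fix i assume i: "i \<in> I"
      show "(\<lambda>m. \<integral>\<omega>. g i (Y m i \<omega>) \<partial>M) \<longlonglongrightarrow> (\<integral>\<omega>. g i (Z i \<omega>) \<partial>M)"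
      proof (rule integral_dominated_convergence[where w = "\<lambda>_. 1"])
        show "AE \<omega> in M. (\<lambda>m. g i (Y m i \<omega>)) \<longlonglongrightarrow> g i (Z i \<omega>)"
          using lim by eventually_elim (auto intro!: gl i)
      qed (use i g in auto)
    qed
    ultimately show ?thesis using LIMSEQ_unique by (metis (no_types, lifting) ext)
  qed
  have closed_prod: "prob (\<Inter>j\<in>I. Z j -` A j \<inter> space M) = (\<Prod>j\<in>I. prob (Z j -` A j \<inter> space M))"
    if A: "\<And>i. i \<in> I \<Longrightarrow> closed (A i)" for A :: "'i \<Rightarrow> real set"
  proof -
    \<comment> \<open>A closed set is supplied outside \<open>I\<close> as well, so that the
      approximating functions can be chosen for all indices at once.\<close>
    define A' where "A' i = (if i \<in> I then A i else UNIV)" for i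
    have A': "closed (A' i)" for i using A by (simp add: A'_def)
    have "\<forall>i. \<exists>g. (\<forall>k. continuous_on UNIV (g k)) \<and> (\<forall>k x. 0 \<le> g k x) \<and> (\<forall>k x. g k x \<le> 1) \<and>
      (\<forall>x. (\<lambda>k. g k x) \<longlonglongrightarrow> (indicator (A' i) x :: real))"
      by (intro allI closed_indicator_limit A')
    from choice[OF this] obtain g :: "'i \<Rightarrow> nat \<Rightarrow> real \<Rightarrow> real" where
      g': "\<forall>i. (\<forall>k. continuous_on UNIV (g i k)) \<and> (\<forall>k x. 0 \<le> g i k x) \<and> (\<forall>k x. g i k x \<le> 1) \<and>
      (\<forall>x. (\<lambda>k. g i k x) \<longlonglongrightarrow> (indicator (A' i) x :: real))" by (rule exE)
    have g: "continuous_on UNIV (g i k)" "0 \<le> g i k x" "g i k x \<le> 1"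
      "(\<lambda>k. g i k x) \<longlonglongrightarrow> indicator (A' i) x" for i k x
      using g' by simp_all
    have [measurable]: "g i k \<in> borel_measurable borel" for i k
      by (rule borel_measurable_continuous_onI[OF g(1)])
    have [measurable]: "A' i \<in> sets borel" for i by (rule borel_closed[OF A'])
    have "(\<lambda>k. \<integral>\<omega>. (\<Prod>i\<in>I. g i k (Z i \<omega>)) \<partial>M) \<longlonglongrightarrow> (\<integral>\<omega>. (\<Prod>i\<in>I. indicator (A' i) (Z i \<omega>)) \<partial>M)"
    proof (rule integral_dominated_convergence[where w = "\<lambda>_. 1"])
      show "AE \<omega> in M. (\<lambda>k. \<Prod>i\<in>I. g i k (Z i \<omega>)) \<longlonglongrightarrow> (\<Prod>i\<in>I. indicator (A' i) (Z i \<omega>))"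
        by (auto intro!: AE_I2 tendsto_prod g)
      show "AE \<omega> in M. norm (\<Prod>i\<in>I. g i k (Z i \<omega>)) \<le> 1" for k
        using g by (auto intro!: AE_I2 prod_le_1 simp: abs_prod)
    qed auto
    moreover have "(\<integral>\<omega>. (\<Prod>i\<in>I. g i k (Z i \<omega>)) \<partial>M) = (\<Prod>i\<in>I. \<integral>\<omega>. g i k (Z i \<omega>) \<partial>M)" for k
      using g by (intro cont)
    moreover have "(\<lambda>k. \<Prod>i\<in>I. \<integral>\<omega>. g i k (Z i \<omega>) \<partial>M) \<longlonglongrightarrow> (\<Prod>i\<in>I. \<integral>\<omega>. indicator (A' i) (Z i \<omega>) \<partial>M)"
    proof (rule tendsto_prod)
      fix i assume i: "i \<in> I"
      show "(\<lambda>k. \<integral>\<omega>. g i k (Z i \<omega>) \<partial>M) \<longlonglongrightarrow> (\<integral>\<omega>. indicator (A' i) (Z i \<omega>) \<partial>M)"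
        by (rule integral_dominated_convergence[where w = "\<lambda>_. 1"]) (use i g in auto)
    qed
    ultimately have eq: "(\<integral>\<omega>. (\<Prod>i\<in>I. indicator (A' i) (Z i \<omega>)) \<partial>M) = (\<Prod>i\<in>I. \<integral>\<omega>. indicator (A' i) (Z i \<omega>) \<partial>M :: real)"
      using LIMSEQ_unique by (metis (no_types, lifting) ext)
    have "(\<integral>\<omega>. indicator (A' i) (Z i \<omega>) \<partial>M :: real) = prob (Z i -` A i \<inter> space M)" if "i \<in> I" for i
    proof -
      have "(\<integral>\<omega>. indicator (A' i) (Z i \<omega>) \<partial>M :: real) = (\<integral>\<omega>. indicator (Z i -` A i \<inter> space M) \<omega> \<partial>M)"
        using that by (intro Bochner_Integration.integral_cong) (auto simp: A'_def indicator_def)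
      then show ?thesis by simp
    qed
    moreover have "(\<integral>\<omega>. (\<Prod>i\<in>I. indicator (A' i) (Z i \<omega>)) \<partial>M :: real) = prob (\<Inter>j\<in>I. Z j -` A j \<inter> space M)"
    proof -
      have "(\<integral>\<omega>. (\<Prod>i\<in>I. indicator (A' i) (Z i \<omega>)) \<partial>M :: real) = (\<integral>\<omega>. indicator (\<Inter>j\<in>I. Z j -` A j \<inter> space M) \<omega> \<partial>M)"
      proof (rule Bochner_Integration.integral_cong[OF refl])
        fix \<omega> assume "\<omega> \<in> space M"
        show "(\<Prod>i\<in>I. indicator (A' i) (Z i \<omega>)) = (indicator (\<Inter>j\<in>I. Z j -` A j \<inter> space M) \<omega> :: real)"
        proof (cases "\<forall>i\<in>I. Z i \<omega> \<in> A i")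
          case True then show ?thesis using \<open>\<omega> \<in> space M\<close> by (simp add: A'_def)
        next
          case False
          then obtain i where "i \<in> I" "Z i \<omega> \<notin> A i" by blast
          then have "(\<Prod>i\<in>I. indicator (A' i) (Z i \<omega>)) = (0 :: real)"
            using fin by (intro prod_zero bexI[of _ i]) (auto simp: A'_def)
          moreover have "indicator (\<Inter>j\<in>I. Z j -` A j \<inter> space M) \<omega> = (0 :: real)"
            using \<open>i \<in> I\<close> \<open>Z i \<omega> \<notin> A i\<close> by (auto simp: indicator_def)
          ultimately show ?thesis by simp
        qed
      qed
      moreover have "(\<Inter>j\<in>I. Z j -` A j \<inter> space M) \<inter> space M = (\<Inter>j\<in>I. Z j -` A j \<inter> space M)"
        using False by auto
      ultimately show ?thesis by simp
    qed
    ultimately show ?thesis using eq by simp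
  qed
  show ?thesis
  proof (subst indep_vars_finite[OF False fin, where E = "\<lambda>_. Collect closed"])
    show "sets (borel :: real measure) = sigma_sets (space borel) (Collect closed)"
      by (simp add: borel_eq_closed)
    show "Int_stable (Collect closed :: real set set)" by (auto simp: Int_stable_def)
    show "\<forall>A\<in>I \<rightarrow> Collect closed. prob (\<Inter>j\<in>I. Z j -` A j \<inter> space M) = (\<Prod>j\<in>I. prob (Z j -` A j \<inter> space M))"
      using closed_prod by (auto simp: Pi_iff)
  qed (use Z in auto)
qed

section \<open>Independence and laws of walk increments, and their limits\<close>

lemma borel_measurable_coin: "f \<in> borel_measurable coin"
  by (simp add: coin_def)

lemma indep_vars_coins:
  "prob_space.indep_vars (coins :: ('i \<Rightarrow> bool) measure) (\<lambda>_. coin) (\<lambda>i c. c i) UNIV"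
proof -
  interpret prob_space "coins :: ('i \<Rightarrow> bool) measure" by (rule prob_space_coins)
  have m: "(\<lambda>c::'i \<Rightarrow> bool. c i) \<in> measurable coins coin" for i by measurable
  have "distr coins coin (\<lambda>c::'i \<Rightarrow> bool. c i) = coin" for i
    by (rule distr_PiM_component) (auto simp: prob_space_coin)
  moreover have "distr coins coins (\<lambda>x::'i \<Rightarrow> bool. \<lambda>i\<in>UNIV. x i) = coins"
    by (simp add: restrict_def)
  ultimately show ?thesis
    using indep_vars_iff_distr_eq_PiM[where I = "UNIV :: 'i set" and M' = "\<lambda>_. coin" and X = "\<lambda>i c. c i"] m
    by simp
qed

definition walk_incr :: "nat \<Rightarrow> nat \<Rightarrow> (nat \<Rightarrow> bool) \<Rightarrow> real" where
  "walk_incr a b x = (\<Sum>i=a..<b. coin_sign (x i))"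

lemma walk_incr: "a \<le> b \<Longrightarrow> real_of_int (walk x b) - real_of_int (walk x a) = walk_incr a b x"
  using sum.atLeastLessThan_concat[of 0 a b "\<lambda>i. coin_sign (x i)"]
  by (simp add: of_int_walk walk_incr_def atLeast0LessThan del: of_int_sum)

text \<open>Monotonicity of \<open>a\<close> makes the blocks of coins disjoint, and each increment
  is a function of its own block.\<close>

lemma indep_walk_incr:
  assumes a: "mono a"
  shows "prob_space.indep_vars coins (\<lambda>_. borel) (\<lambda>j x. k * walk_incr (a j) (a (Suc j)) x) UNIV"
proof -
  interpret prob_space "coins :: (nat \<Rightarrow> bool) measure" by (rule prob_space_coins)
  have disj: "disjoint_family_on (\<lambda>j. {a j..<a (Suc j)}) UNIV"
    unfolding disjoint_family_on_def
  proof (intro ballI impI)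
    fix m n :: nat assume "m \<noteq> n"
    have "{a i..<a (Suc i)} \<inter> {a j..<a (Suc j)} = {}" if "i < j" for i j
      using monoD[OF a, of "Suc i" j] that by auto
    then show "{a m..<a (Suc m)} \<inter> {a n..<a (Suc n)} = {}"
      using \<open>m \<noteq> n\<close> by (metis Int_commute linorder_neqE_nat)
  qed
  have "indep_vars (\<lambda>_. borel) (\<lambda>j x. (\<lambda>y. k * (\<Sum>i=a j..<a (Suc j). coin_sign (y i))) (restrict (\<lambda>i. x i) {a j..<a (Suc j)})) UNIV"
  proof (rule indep_vars_compose2[OF indep_vars_restrict[OF indep_vars_coins _ disj]])
    fix j :: nat
    show "(\<lambda>y. k * (\<Sum>i=a j..<a (Suc j). coin_sign (y i))) \<in> borel_measurable (PiM {a j..<a (Suc j)} (\<lambda>_. coin))"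
    proof (intro borel_measurable_times borel_measurable_const borel_measurable_sum)
      fix i assume "i \<in> {a j..<a (Suc j)}"
      then have "(\<lambda>y. y i) \<in> measurable (PiM {a j..<a (Suc j)} (\<lambda>_. coin)) coin"
        by (rule measurable_component_singleton)
      then show "(\<lambda>y. coin_sign (y i)) \<in> borel_measurable (PiM {a j..<a (Suc j)} (\<lambda>_. coin))"
        by (rule measurable_compose) (rule borel_measurable_coin)
    qed
  qed simp
  moreover have "(\<lambda>y. k * (\<Sum>i=a j..<a (Suc j). coin_sign (y i))) (restrict (\<lambda>i. x i) {a j..<a (Suc j)})
      = k * walk_incr (a j) (a (Suc j)) x" for j x
    by (auto simp: walk_incr_def intro!: sum.cong)
  ultimately show ?thesis by (simp only:)
qed

lemma char_walk_incr:
  "char (distr coins borel (walk_incr a b)) u = of_real (cos u ^ (b - a))"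
proof -
  interpret prob_space "coins :: (nat \<Rightarrow> bool) measure" by (rule prob_space_coins)
  have "indep_vars (\<lambda>_. borel) (\<lambda>i c. coin_sign (c i)) (UNIV :: nat set)"
    by (rule indep_vars_compose2[where X = "\<lambda>i c. c i" and Y = "\<lambda>_. coin_sign", OF indep_vars_coins]) (rule borel_measurable_coin)
  then have ind: "indep_vars (\<lambda>_. borel) (\<lambda>i c. coin_sign (c i)) {a..<b}"
    by (rule indep_vars_subset) auto
  have char1: "char (distr coins borel (\<lambda>c. coin_sign (c i))) u = of_real (cos u)" for i :: nat
  proof -
    have m: "(\<lambda>c::nat \<Rightarrow> bool. c i) \<in> measurable coins coin" by measurable
    have "distr coins borel (\<lambda>c. coin_sign (c i)) = distr (distr coins coin (\<lambda>c. c i)) borel coin_sign"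
      by (subst distr_distr[OF borel_measurable_coin m]) (simp add: comp_def)
    also have "distr coins coin (\<lambda>c. c i) = coin"
      by (rule distr_PiM_component) (auto simp: prob_space_coin)
    finally have "char (distr coins borel (\<lambda>c. coin_sign (c i))) u = (\<integral>y. iexp (u * coin_sign y) \<partial>coin)"
      unfolding char_def by (simp add: integral_distr[OF borel_measurable_coin])
    also have "\<dots> = (\<Sum>y\<in>UNIV. pmf (bernoulli_pmf (1/2)) y *\<^sub>R iexp (u * coin_sign y))"
      unfolding coin_def by (rule integral_measure_pmf) auto
    also have "\<dots> = of_real (cos u)"
      by (simp add: UNIV_bool cos_of_real[symmetric] cos_exp_eq exp_minus scaleR_conv_of_real field_simps)
    finally show ?thesis .
  qed
  have "char (distr coins borel (\<lambda>c. \<Sum>i\<in>{a..<b}. coin_sign (c i))) u = (\<Prod>i\<in>{a..<b}. char (distr coins borel (\<lambda>c. coin_sign (c i))) u)"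
    by (rule char_distr_sum[OF ind])
  also have "\<dots> = of_real (cos u ^ (b - a))" by (simp add: char1)
  finally show ?thesis by (simp add: walk_incr_def[abs_def])
qed

lemma AE_tame_16: "AE c in coins. \<exists>n\<^sub>0. tame (1/16) n\<^sub>0 c"
  by (rule AE_tame) simp

lemma borel_measurable_walk_incr [measurable]: "walk_incr a b \<in> borel_measurable coins"
  unfolding walk_incr_def[abs_def] by measurable

lemma
  shows measurable_level: "(\<lambda>c. coin_row 0 ((zoom ^^ m) c)) \<in> measurable coins coins"
    and distr_level: "distr coins coins (\<lambda>c. coin_row 0 ((zoom ^^ m) c)) = coins"
proof -
  show "(\<lambda>c. coin_row 0 ((zoom ^^ m) c)) \<in> measurable coins coins"
    by (rule measurable_compose[OF measurable_zoom_pow measurable_row])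
  have "distr coins coins (\<lambda>c. coin_row 0 ((zoom ^^ m) c)) = distr (distr coins coins (zoom ^^ m)) coins (coin_row 0)"
    by (subst distr_distr[OF measurable_row measurable_zoom_pow]) (simp add: comp_def)
  then show "distr coins coins (\<lambda>c. coin_row 0 ((zoom ^^ m) c)) = coins"
    by (simp only: distr_zoom_pow distr_row)
qed

lemma walk_at_diff:
  assumes "0 \<le> s" "s \<le> t"
  shows "walk_at m t c - walk_at m s c =
    1 / 2 ^ m * walk_incr (nat \<lfloor>4 ^ m * s\<rfloor>) (nat \<lfloor>4 ^ m * t\<rfloor>) (coin_row 0 ((zoom ^^ m) c))"
proof -
  have "nat \<lfloor>4 ^ m * s\<rfloor> \<le> nat \<lfloor>4 ^ m * t\<rfloor>"
    using assms by (intro nat_mono floor_mono mult_left_mono) auto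
  from walk_incr[OF this] show ?thesis
    by (simp add: walk_at_def diff_divide_distrib[symmetric])
qed

lemma floor_scaled_limit:
  assumes "0 \<le> t"
  shows "(\<lambda>m. real (nat \<lfloor>4 ^ m * t\<rfloor>) / 4 ^ m) \<longlonglongrightarrow> t"
proof (rule tendsto_sandwich)
  show "\<forall>\<^sub>F m in sequentially. t - (1/4) ^ m \<le> real (nat \<lfloor>4 ^ m * t\<rfloor>) / 4 ^ m"
  proof (rule always_eventually, rule allI)
    fix m :: nat
    have "4 ^ m * t - 1 \<le> real (nat \<lfloor>4 ^ m * t\<rfloor>)" by linarith
    then have "(4 ^ m * t - 1) / 4 ^ m \<le> real (nat \<lfloor>4 ^ m * t\<rfloor>) / 4 ^ m"
      by (rule divide_right_mono) simp
    then show "t - (1/4) ^ m \<le> real (nat \<lfloor>4 ^ m * t\<rfloor>) / 4 ^ m"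
      by (simp add: diff_divide_distrib power_divide)
  qed
  show "\<forall>\<^sub>F m in sequentially. real (nat \<lfloor>4 ^ m * t\<rfloor>) / 4 ^ m \<le> t"
  proof (rule always_eventually, rule allI)
    fix m :: nat
    have "real (nat \<lfloor>4 ^ m * t\<rfloor>) \<le> 4 ^ m * t" using assms by simp
    then have "real (nat \<lfloor>4 ^ m * t\<rfloor>) / 4 ^ m \<le> (4 ^ m * t) / 4 ^ m"
      by (rule divide_right_mono) simp
    then show "real (nat \<lfloor>4 ^ m * t\<rfloor>) / 4 ^ m \<le> t" by simp
  qed
  have "(\<lambda>m. t - (1/4) ^ m) \<longlonglongrightarrow> t - 0" by (intro tendsto_intros LIMSEQ_power_zero) auto
  then show "(\<lambda>m. t - (1/4) ^ m) \<longlonglongrightarrow> t" by simp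
qed simp

text \<open>The central limit theorem at the level of characteristic functions:
  \<open>ln (cos x)\<close> behaves like \<open>- x\<^sup>2 / 2\<close> near 0, and the square of
  the spatial scale \<open>1 / 2 ^ m\<close> is the time scale \<open>1 / 4 ^ m\<close>.\<close>

lemma cos_power_limit:
  fixes N :: "nat \<Rightarrow> nat" and v w :: real
  assumes "(\<lambda>m. real (N m) / 4 ^ m) \<longlonglongrightarrow> w"
  shows "(\<lambda>m. cos (v / 2 ^ m) ^ N m) \<longlonglongrightarrow> exp (- (v\<^sup>2 * w / 2))"
proof -
  have top: "filterlim (\<lambda>m. 2 ^ m :: real) at_top sequentially" by real_asymp
  have "((\<lambda>y. y\<^sup>2 * ln (cos (v / y))) \<longlongrightarrow> - (v * v / 2)) at_top" by real_asymp
  then have "((\<lambda>y. y\<^sup>2 * ln (cos (v / y))) \<longlongrightarrow> - (v\<^sup>2 / 2)) at_top"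
    by (simp only: power2_eq_square[of v])
  from filterlim_compose[OF this top]
  have "(\<lambda>m. (2 ^ m)\<^sup>2 * ln (cos (v / 2 ^ m))) \<longlonglongrightarrow> - (v\<^sup>2 / 2)" .
  moreover have "(2 ^ m)\<^sup>2 = (4 :: real) ^ m" for m by (simp add: power_mult[symmetric] power_mult_distrib[symmetric] power2_eq_square)
  ultimately have l: "(\<lambda>m. 4 ^ m * ln (cos (v / 2 ^ m))) \<longlonglongrightarrow> - (v\<^sup>2 / 2)" by simp
  have "((\<lambda>y. cos (v / y)) \<longlongrightarrow> 1) at_top" by real_asymp
  from filterlim_compose[OF this top] have "(\<lambda>m. cos (v / 2 ^ m)) \<longlonglongrightarrow> 1" .
  then have pos: "\<forall>\<^sub>F m in sequentially. 0 < cos (v / 2 ^ m)"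
    by (rule order_tendstoD) simp
  have "(\<lambda>m. exp (real (N m) / 4 ^ m * (4 ^ m * ln (cos (v / 2 ^ m))))) \<longlonglongrightarrow> exp (w * - (v\<^sup>2 / 2))"
    by (intro tendsto_intros assms l)
  then have "(\<lambda>m. exp (real (N m) / 4 ^ m * (4 ^ m * ln (cos (v / 2 ^ m))))) \<longlonglongrightarrow> exp (- (v\<^sup>2 * w / 2))"
    by (simp add: mult.commute)
  moreover have "\<forall>\<^sub>F m in sequentially. exp (real (N m) / 4 ^ m * (4 ^ m * ln (cos (v / 2 ^ m)))) = cos (v / 2 ^ m) ^ N m"
    using pos by eventually_elim (simp add: exp_of_nat_mult)
  ultimately show ?thesis by (rule Lim_transform_eventually)
qed

lemma distributed_wiener_increment:
  assumes st: "0 \<le> s" "s < t"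
  shows "distributed coins lborel (\<lambda>c. wiener t c - wiener s c) (normal_density 0 (sqrt (t - s)))"
proof -
  interpret prob_space "coins :: (nat \<times> nat \<Rightarrow> bool) measure" by (rule prob_space_coins)
  define \<sigma> where "\<sigma> = sqrt (t - s)"
  have \<sigma>: "0 < \<sigma>" "\<sigma>\<^sup>2 = t - s" using st by (simp_all add: \<sigma>_def)
  \<comment> \<open>Normalisation to unit variance allows comparison with the standard normal
    characteristic function and Levy's uniqueness theorem.\<close>
  define Z where "Z c = (wiener t c - wiener s c) / \<sigma>" for c
  define Zm where "Zm m c = (walk_at m t c - walk_at m s c) / \<sigma>" for m c
  define N where "N m = nat \<lfloor>4 ^ m * t\<rfloor> - nat \<lfloor>4 ^ m * s\<rfloor>" for m
  have [measurable]: "Z \<in> borel_measurable coins" "Zm m \<in> borel_measurable coins" for m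
    unfolding Z_def[abs_def] Zm_def[abs_def] by measurable
  have lim: "AE c in coins. (\<lambda>m. Zm m c) \<longlonglongrightarrow> Z c"
    using AE_tame_16
  proof eventually_elim
    case (elim c)
    then obtain n\<^sub>0 where T: "tame (1/16) n\<^sub>0 c" by auto
    show "(\<lambda>m. Zm m c) \<longlonglongrightarrow> Z c"
      unfolding Zm_def Z_def using st \<sigma> by (intro tendsto_intros wiener_walk_at(1)[OF T]) auto
  qed
  have char_Zm: "char (distr coins borel (Zm m)) u = of_real (cos (u / \<sigma> / 2 ^ m) ^ N m)" for m u
  proof -
    define a b where "a = nat \<lfloor>4 ^ m * s\<rfloor>" and "b = nat \<lfloor>4 ^ m * t\<rfloor>"
    have "char (distr coins borel (Zm m)) u = (\<integral>c. iexp (u * Zm m c) \<partial>coins)"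
      by (simp add: char_def integral_distr)
    also have "\<dots> = (\<integral>c. iexp (u / \<sigma> / 2 ^ m * walk_incr a b (coin_row 0 ((zoom ^^ m) c))) \<partial>coins)"
      using st by (simp add: Zm_def walk_at_diff a_def b_def field_simps)
    also have "\<dots> = (\<integral>x. iexp (u / \<sigma> / 2 ^ m * walk_incr a b x) \<partial>distr coins coins (\<lambda>c. coin_row 0 ((zoom ^^ m) c)))"
      by (rule integral_distr[OF measurable_level, symmetric]) measurable
    also have "\<dots> = char (distr coins borel (walk_incr a b)) (u / \<sigma> / 2 ^ m)"
      by (simp add: distr_level char_def integral_distr)
    also have "\<dots> = of_real (cos (u / \<sigma> / 2 ^ m) ^ N m)"
      by (simp add: char_walk_incr N_def a_def b_def)
    finally show ?thesis .
  qed
  have "char (distr coins borel Z) u = of_real (exp (- u\<^sup>2 / 2))" for u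
  proof (rule LIMSEQ_unique)
    show "(\<lambda>m. char (distr coins borel (Zm m)) u) \<longlonglongrightarrow> char (distr coins borel Z) u"
      unfolding char_def by (simp add: integral_distr)
        (rule integral_dominated_convergence[where w = "\<lambda>_. 1"],
          use lim in \<open>auto elim!: eventually_mono intro!: tendsto_intros\<close>)
    have "(\<lambda>m. real (N m) / 4 ^ m) \<longlonglongrightarrow> t - s"
    proof -
      have "real (N m) = real (nat \<lfloor>4 ^ m * t\<rfloor>) - real (nat \<lfloor>4 ^ m * s\<rfloor>)" for m
        unfolding N_def using st by (intro of_nat_diff nat_mono floor_mono mult_left_mono) auto
      moreover have "(\<lambda>m. real (nat \<lfloor>4 ^ m * t\<rfloor>) / 4 ^ m - real (nat \<lfloor>4 ^ m * s\<rfloor>) / 4 ^ m) \<longlonglongrightarrow> t - s"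
        using st by (intro tendsto_diff floor_scaled_limit) auto
      ultimately show ?thesis by (simp only: diff_divide_distrib)
    qed
    from cos_power_limit[OF this, of "u / \<sigma>"]
    have "(\<lambda>m. cos (u / \<sigma> / 2 ^ m) ^ N m) \<longlonglongrightarrow> exp (- u\<^sup>2 / 2)"
      using \<sigma> st by (simp add: power_divide)
    then show "(\<lambda>m. char (distr coins borel (Zm m)) u) \<longlonglongrightarrow> of_real (exp (- u\<^sup>2 / 2))"
      unfolding char_Zm by (intro tendsto_of_real)
  qed
  then have "char (distr coins borel Z) = char std_normal_distribution"
    by (simp add: char_std_normal_distribution fun_eq_iff)
  then have "distr coins borel Z = std_normal_distribution"
    by (intro Levy_uniqueness real_dist_normal_dist) simp_all
  moreover have "distr coins lborel Z = distr coins borel Z" by (intro distr_cong) auto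
  ultimately have "distributed coins lborel Z std_normal_density"
    by (simp add: distributed_def)
  then show ?thesis
    using normal_standard_normal_convert[OF \<sigma>(1), of "\<lambda>c. wiener t c - wiener s c" 0]
    by (simp add: Z_def[abs_def] \<sigma>_def)
qed

lemma indep_wiener_increments:
  assumes t: "0 \<le> t 0" "\<And>i. i < n \<Longrightarrow> t i < t (Suc i)"
  shows "prob_space.indep_vars coins (\<lambda>_. borel) (\<lambda>i c. wiener (t (Suc i)) c - wiener (t i) c) {..<n::nat}"
proof -
  interpret prob_space "coins :: (nat \<times> nat \<Rightarrow> bool) measure" by (rule prob_space_coins)
  have mono_t: "t i \<le> t j" if "i \<le> j" "j \<le> n" for i j
    using that
  proof (induction j rule: dec_induct)
    case (step k) then show ?case using t(2)[of k] by simp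
  qed simp
  have nonneg: "0 \<le> t i" if "i \<le> n" for i using mono_t[of 0 i] t(1) that by simp
  show ?thesis
  proof (rule indep_vars_AE_limit[where Y = "\<lambda>m i c. walk_at m (t (Suc i)) c - walk_at m (t i) c"])
    show "AE c in coins. \<forall>i\<in>{..<n}. (\<lambda>m. walk_at m (t (Suc i)) c - walk_at m (t i) c) \<longlonglongrightarrow> wiener (t (Suc i)) c - wiener (t i) c"
      using AE_tame_16
    proof eventually_elim
      case (elim c)
      then obtain n\<^sub>0 where T: "tame (1/16) n\<^sub>0 c" by auto
      show ?case
        by (intro ballI tendsto_diff wiener_walk_at(1)[OF T] nonneg) auto
    qed
    fix m
    \<comment> \<open>Freezing the times after index \<open>n\<close> makes \<open>a\<close>
      monotone on all indices, although \<open>t\<close> is known to increase only up to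
      \<open>n\<close>.\<close>
    define a where "a i = nat \<lfloor>4 ^ m * t (min i n)\<rfloor>" for i
    have "mono a"
      unfolding a_def by (intro monoI nat_mono floor_mono mult_left_mono mono_t) auto
    have "indep_vars (\<lambda>_. borel) (\<lambda>i c. 1 / 2 ^ m * walk_incr (a i) (a (Suc i)) (coin_row 0 ((zoom ^^ m) c))) UNIV"
      by (rule indep_vars_measure_preserving[OF measurable_level distr_level indep_walk_incr[OF \<open>mono a\<close>]])
    then have "indep_vars (\<lambda>_. borel) (\<lambda>i c. 1 / 2 ^ m * walk_incr (a i) (a (Suc i)) (coin_row 0 ((zoom ^^ m) c))) {..<n}"
      by (rule indep_vars_subset) auto
    also have "?this \<longleftrightarrow> indep_vars (\<lambda>_. borel) (\<lambda>i c. walk_at m (t (Suc i)) c - walk_at m (t i) c) {..<n}"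
      by (rule indep_vars_cong) (auto simp: a_def walk_at_diff[OF nonneg mono_t] fun_eq_iff)
    finally show "indep_vars (\<lambda>_. borel) (\<lambda>i c. walk_at m (t (Suc i)) c - walk_at m (t i) c) {..<n}" .
  qed auto
qed

theorem wiener_process_wiener: "wiener_process coins wiener"
  unfolding wiener_process_def
proof (intro conjI allI impI)
  show "AE c in coins. continuous_on {0..} (\<lambda>t. wiener t c)"
    using AE_tame_16 by eventually_elim (auto intro: continuous_wiener[where \<delta> = "1/16"])
qed (auto simp: prob_space_coins wiener_0 distributed_wiener_increment indep_wiener_increments)

lemma wiener_process_measure_preserving:
  assumes M: "prob_space M" and \<phi>: "\<phi> \<in> measurable M N" "distr M N \<phi> = N" and W: "wiener_process N W"
  shows "wiener_process M (\<lambda>t \<omega>. W t (\<phi> \<omega>))"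
  unfolding wiener_process_def
proof (intro conjI allI impI)
  interpret prob_space M by (rule M)
  have AE: "AE \<omega> in M. P (\<phi> \<omega>)" if "AE x in N. P x" for P
    by (rule AE_distrD[OF \<phi>(1)]) (simp only: \<phi>(2) that)
  show "AE \<omega> in M. W 0 (\<phi> \<omega>) = 0" "AE \<omega> in M. continuous_on {0..} (\<lambda>t. W t (\<phi> \<omega>))"
    using W by (auto intro!: AE simp: wiener_process_def)
  show "(\<lambda>\<omega>. W t (\<phi> \<omega>)) \<in> borel_measurable M" if "0 \<le> t" for t
    using W that by (auto intro!: measurable_compose[OF \<phi>(1)] simp: wiener_process_def)
  show "distributed M lborel (\<lambda>\<omega>. W t (\<phi> \<omega>) - W s (\<phi> \<omega>)) (normal_density 0 (sqrt (t - s)))"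
    if "0 \<le> s \<and> s < t" for s t
  proof -
    have D: "distributed N lborel (\<lambda>\<omega>. W t \<omega> - W s \<omega>) (normal_density 0 (sqrt (t - s)))"
      using W that by (auto simp: wiener_process_def)
    then have m: "(\<lambda>\<omega>. W t \<omega> - W s \<omega>) \<in> measurable N lborel" by (simp add: distributed_def)
    have "distr M lborel (\<lambda>\<omega>. W t (\<phi> \<omega>) - W s (\<phi> \<omega>)) = distr (distr M N \<phi>) lborel (\<lambda>\<omega>. W t \<omega> - W s \<omega>)"
      by (subst distr_distr[OF m \<phi>(1)]) (simp add: comp_def)
    then show ?thesis
      using D measurable_compose[OF \<phi>(1) m] by (simp add: distributed_def \<phi>(2))
  qed
  show "prob_space.indep_vars M (\<lambda>_. borel) (\<lambda>i \<omega>. W (t (Suc i)) (\<phi> \<omega>) - W (t i) (\<phi> \<omega>)) {..<n}"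
    if "0 \<le> t 0 \<and> (\<forall>i<n. t i < t (Suc i))" for n :: nat and t
    using indep_vars_measure_preserving[OF \<phi>, of "\<lambda>_. borel" "\<lambda>i \<omega>. W (t (Suc i)) \<omega> - W (t i) \<omega>" "{..<n}"] W that
    by (auto simp: wiener_process_def)
qed (rule M)

section \<open>Additive functionals of the simple random walk\<close>

text \<open>The discrete primitive vanishing at 0. The minus sign on the left half-line makes the
  difference identity of \<open>antidiff_step\<close> valid on all integers.\<close>

definition antidiff :: "(int \<Rightarrow> real) \<Rightarrow> int \<Rightarrow> real" where
  "antidiff h j = sum h {0..<j} - sum h {j..<0}"

lemma antidiff_step: "antidiff h (j + 1) = antidiff h j + h j"
proof (cases "0 \<le> j")
  case True
  then have "{0..<j + 1} = insert j {0..<j}" by auto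
  then show ?thesis using True by (simp add: antidiff_def)
next
  case False
  then have "{j..<0} = insert j {j + 1..<0}" by auto
  then show ?thesis using False by (simp add: antidiff_def)
qed

lemma antidiff_bound:
  assumes "\<And>i. \<bar>i\<bar> \<le> \<bar>j\<bar> \<Longrightarrow> \<bar>h i\<bar> \<le> B"
  shows "\<bar>antidiff h j\<bar> \<le> \<bar>real_of_int j\<bar> * B"
proof (cases "0 \<le> j")
  case True
  have "\<bar>sum h {0..<j}\<bar> \<le> (\<Sum>i\<in>{0..<j}. B)"
    using assms True by (intro order_trans[OF sum_abs] sum_mono) auto
  then show ?thesis using True by (simp add: antidiff_def)
next
  case False
  have "\<bar>sum h {j..<0}\<bar> \<le> (\<Sum>i\<in>{j..<0}. B)"
    using assms False by (intro order_trans[OF sum_abs] sum_mono) auto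
  then show ?thesis using False by (simp add: antidiff_def)
qed

text \<open>The generator of the walk is half the second difference, whence the factor 2; the shift
  by one centres that second difference at \<open>j\<close>.\<close>

definition potential :: "(int \<Rightarrow> real) \<Rightarrow> int \<Rightarrow> real" where
  "potential f = antidiff (\<lambda>j. 2 * antidiff f (j + 1))"

text \<open>Half of \<open>potential f (j + 1) - potential f (j - 1)\<close>, which is the
  martingale increment of the potential at \<open>j\<close> on an upward step.\<close>

definition gradient :: "(int \<Rightarrow> real) \<Rightarrow> int \<Rightarrow> real" where
  "gradient f j = antidiff f (j + 1) + antidiff f j"

text \<open>The potential solves the discrete Poisson equation with right-hand side \<open>f\<close>, so it turns an
  additive functional of the walk into a boundary term and a martingale.\<close>

lemma additive_functional:
  "(\<Sum>k<n. f (walk x k)) = potential f (walk x n) - (\<Sum>k<n. gradient f (walk x k) * coin_sign (x k))"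
proof (induction n)
  case 0 show ?case by (simp add: walk_def potential_def antidiff_def)
next
  case (Suc n)
  let ?s = "walk x n"
  have up: "potential f (?s + 1) = potential f ?s + 2 * antidiff f (?s + 1)"
    unfolding potential_def by (rule antidiff_step)
  have down: "potential f ?s = potential f (?s - 1) + 2 * antidiff f ?s"
    unfolding potential_def using antidiff_step[of "\<lambda>j. 2 * antidiff f (j + 1)" "?s - 1"] by simp
  have f: "antidiff f (?s + 1) = antidiff f ?s + f ?s" by (rule antidiff_step)
  have "walk x (Suc n) = (if x n then ?s + 1 else ?s - 1)" by (simp add: walk_def)
  then show ?case using Suc up down f by (simp add: gradient_def)
qed

text \<open>Uniformity in \<open>r\<close> lets the function vary with the time horizon: the strip
  around 0 whose visits are counted widens with \<open>n\<close>.\<close>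

lemma AE_walk_transform:
  fixes h :: "nat \<Rightarrow> int \<Rightarrow> real" and H :: "nat \<Rightarrow> nat \<Rightarrow> real"
  assumes \<delta>: "0 < \<delta>" and h: "\<And>r n j. r \<le> n \<Longrightarrow> \<bar>j\<bar> \<le> int n \<Longrightarrow> \<bar>h r j\<bar> \<le> H r n" and H: "\<And>r n. 0 < H r n"
  shows "AE x in coins. \<forall>\<^sub>F n in sequentially. \<forall>r\<le>n. \<forall>k\<le>n.
    \<bar>\<Sum>i<k. h r (walk x i) * coin_sign (x i)\<bar> \<le> real n powr \<delta> * (sqrt (real n) * H r n)"
proof -
  define E where "E n = (\<lambda>(r, k). {x \<in> space coins. real n powr \<delta> * sqrt (real n * (H r n)\<^sup>2)
    < \<bar>\<Sum>i<k. h r (walk x i) * coin_sign (x i)\<bar>})" for n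
  have meas [measurable]: "(\<lambda>x. \<Sum>i<k. h r (walk x i) * coin_sign (x i)) \<in> borel_measurable coins" for r k
    using borel_measurable_walk[of "h r"] by (intro borel_measurable_sum borel_measurable_times) simp_all
  have "AE x in coins. \<forall>\<^sub>F n in sequentially. \<forall>i\<in>{..n} \<times> {..n}. x \<notin> E n i"
  proof (rule Borel_Cantelli_polynomially_many[OF prob_space_coins \<delta>, where K = 1 and k = 2])
    show "E n i \<in> sets coins" for n i
    proof -
      obtain r k where [simp]: "i = (r, k)" by (cases i)
      have "{x \<in> space coins. real n powr \<delta> * sqrt (real n * (H r n)\<^sup>2)
        < \<bar>\<Sum>i<k. h r (walk x i) * coin_sign (x i)\<bar>} \<in> sets coins" by measurable
      then show ?thesis by (simp add: E_def)
    qed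
    show "measure coins (E n i) \<le> 2 * exp (- (real n powr \<delta>)\<^sup>2 / 2)" if n: "1 \<le> n" and i: "i \<in> {..n} \<times> {..n}" for n i
    proof -
      obtain r k where [simp]: "i = (r, k)" and rk: "r \<le> n" "k \<le> n" using i by (cases i) auto
      define h' where "h' j s = (if \<bar>s\<bar> \<le> int n then h r s else 0)" for j :: nat and s
      have eq: "(\<Sum>i<k. h r (walk x i) * coin_sign (x i)) = (\<Sum>i<k. h' i (walk x i) * coin_sign (x i))" for x
      proof (rule sum.cong[OF refl])
        fix i assume "i \<in> {..<k}"
        then have "\<bar>walk x i\<bar> \<le> int n" using rk abs_walk_le[of x i] by simp
        then show "h r (walk x i) * coin_sign (x i) = h' i (walk x i) * coin_sign (x i)" by (simp only: h'_def if_True)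
      qed
      have "measure coins {x. real n powr \<delta> * sqrt (real n * (H r n)\<^sup>2) \<le> \<bar>\<Sum>i<k. h' i (walk x i) * coin_sign (x i)\<bar>}
        \<le> 2 * exp (- (real n powr \<delta>)\<^sup>2 / 2)"
      proof (rule walk_transform_tail[where H = "\<lambda>_. H r n"])
        show "\<bar>h' j s\<bar> \<le> H r n" for j s using h[OF rk(1), of s] H[of r n] by (auto simp: h'_def)
        show "(\<Sum>i<k. (H r n)\<^sup>2) \<le> real n * (H r n)\<^sup>2" using rk by (simp add: mult_right_mono)
        show "0 < real n * (H r n)\<^sup>2" "0 < real n powr \<delta>" using n H[of r n] by (auto intro!: mult_pos_pos)
      qed
      moreover have "measure coins (E n i) \<le> measure coins {x. real n powr \<delta> * sqrt (real n * (H r n)\<^sup>2) \<le> \<bar>\<Sum>i<k. h' i (walk x i) * coin_sign (x i)\<bar>}"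
      proof (rule finite_measure.finite_measure_mono)
        interpret prob_space "coins :: (nat \<Rightarrow> bool) measure" by (rule prob_space_coins)
        show "finite_measure (coins :: (nat \<Rightarrow> bool) measure)" by (rule finite_measure_axioms)
        have "{x \<in> space coins. real n powr \<delta> * sqrt (real n * (H r n)\<^sup>2) \<le> \<bar>\<Sum>i<k. h' i (walk x i) * coin_sign (x i)\<bar>} \<in> sets coins"
          unfolding eq[symmetric] by measurable
        then show "{x. real n powr \<delta> * sqrt (real n * (H r n)\<^sup>2) \<le> \<bar>\<Sum>i<k. h' i (walk x i) * coin_sign (x i)\<bar>} \<in> sets coins" by simp
      qed (auto simp: E_def eq)
      ultimately show ?thesis by linarith
    qed
  qed (auto simp: card_cartesian_product power2_eq_square)
  then show ?thesis
  proof eventually_elim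
    case (elim x)
    then show ?case
    proof eventually_elim
      case (elim n)
      show ?case
      proof (intro allI impI)
        fix r k assume "r \<le> n" "k \<le> n"
        then have "x \<notin> E n (r, k)" using elim by auto
        then have "\<bar>\<Sum>i<k. h r (walk x i) * coin_sign (x i)\<bar> \<le> real n powr \<delta> * sqrt (real n * (H r n)\<^sup>2)"
          by (simp add: E_def)
        then show "\<bar>\<Sum>i<k. h r (walk x i) * coin_sign (x i)\<bar> \<le> real n powr \<delta> * (sqrt (real n) * H r n)"
          using H[of r n] by (simp add: real_sqrt_mult)
      qed
    qed
  qed
qed

text \<open>For the indicator of \<open>{- r..r}\<close> the primitive is bounded by the number
  \<open>2 * r + 1\<close> of its points. Hence the potential grows at most linearly, and the number
  of visits is at most of the order of the strip width times the size of the walk.\<close>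

lemma AE_visits:
  assumes "0 < \<delta>"
  shows "AE x in coins. \<forall>\<^sub>F n in sequentially. \<forall>r\<le>n. \<forall>m\<le>n.
    (\<Sum>k<m. of_bool (\<bar>walk x k\<bar> \<le> int r)) \<le>
      2 * (2 * real r + 1) * (\<bar>real_of_int (walk x m)\<bar> + real n powr \<delta> * sqrt (real n))"
proof -
  define f where "f r j = (of_bool (\<bar>j\<bar> \<le> int r) :: real)" for r :: nat and j :: int
  have A: "\<bar>antidiff (f r) j\<bar> \<le> 2 * real r + 1" for r j
  proof -
    have bd: "\<bar>sum (f r) A\<bar> \<le> 2 * real r + 1" if "finite A" for A
    proof -
      have "sum (f r) A = (\<Sum>j\<in>A \<inter> {- int r..int r}. 1)"
        unfolding f_def using that by (intro sum.mono_neutral_cong_right) auto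
      also have "\<dots> \<le> (\<Sum>j\<in>{- int r..int r}. 1)" by (intro sum_mono2) auto
      finally have "sum (f r) A \<le> 2 * real r + 1" by simp
      moreover have "0 \<le> sum (f r) A" by (intro sum_nonneg) (simp add: f_def)
      ultimately show ?thesis by simp
    qed
    show ?thesis
      using bd[of "{0..<j}"] bd[of "{j..<0}"] by (cases "0 \<le> j") (simp_all add: antidiff_def)
  qed
  have pot: "\<bar>potential (f r) j\<bar> \<le> \<bar>real_of_int j\<bar> * (2 * (2 * real r + 1))" for r j
    unfolding potential_def
  proof (rule antidiff_bound)
    fix i :: int
    show "\<bar>2 * antidiff (f r) (i + 1)\<bar> \<le> 2 * (2 * real r + 1)"
      using A[of r "i + 1"] by (simp add: abs_mult)
  qed
  have "AE x in coins. \<forall>\<^sub>F n in sequentially. \<forall>r\<le>n. \<forall>k\<le>n.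
    \<bar>\<Sum>i<k. gradient (f r) (walk x i) * coin_sign (x i)\<bar> \<le> real n powr \<delta> * (sqrt (real n) * (2 * (2 * real r + 1)))"
  proof (rule AE_walk_transform[OF assms])
    show "\<bar>gradient (f r) j\<bar> \<le> 2 * (2 * real r + 1)" for r j
      unfolding gradient_def by (rule order_trans[OF abs_triangle_ineq]) (use A[of r j] A[of r "j + 1"] in simp)
  qed simp
  then show ?thesis
  proof eventually_elim
    case (elim x)
    then show ?case
    proof eventually_elim
      case (elim n)
      show ?case
      proof (intro allI impI)
        fix r m assume "r \<le> n" "m \<le> n"
        then have "\<bar>\<Sum>i<m. gradient (f r) (walk x i) * coin_sign (x i)\<bar> \<le> real n powr \<delta> * (sqrt (real n) * (2 * (2 * real r + 1)))"
          using elim by blast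
        with additive_functional[of "f r" x m] pot[of r "walk x m"]
        have "(\<Sum>k<m. f r (walk x k)) \<le> \<bar>real_of_int (walk x m)\<bar> * (2 * (2 * real r + 1))
           + real n powr \<delta> * (sqrt (real n) * (2 * (2 * real r + 1)))" by linarith
        then show "(\<Sum>k<m. of_bool (\<bar>walk x k\<bar> \<le> int r)) \<le>
          2 * (2 * real r + 1) * (\<bar>real_of_int (walk x m)\<bar> + real n powr \<delta> * sqrt (real n))"
          by (simp add: f_def algebra_simps)
      qed
    qed
  qed
qed

text \<open>Only the primitive of \<open>f\<close> is bounded, so cancellation between neighbouring
  rows counts, not the size of \<open>f\<close>. A primitive of order \<open>\<beta>\<close> gives a
  gradient of order \<open>\<beta>\<close> and a potential of order \<open>1 + \<beta>\<close>; the
  use is with \<open>\<beta> = 1 - \<tau>\<close>, for the excess of the waiting times over their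
  mean.\<close>

lemma AE_additive_functional:
  fixes \<beta> K :: real
  assumes \<delta>: "0 < \<delta>" and f: "\<And>j. \<bar>antidiff f j\<bar> \<le> K * (1 + \<bar>real_of_int j\<bar>) powr \<beta>" and \<beta>: "0 \<le> \<beta>" and K: "0 < K"
  shows "AE x in coins. \<forall>\<^sub>F n in sequentially. \<forall>m\<le>n.
    \<bar>\<Sum>k<m. f (walk x k)\<bar> \<le> 2 * K * (2 + \<bar>real_of_int (walk x m)\<bar>) powr (1 + \<beta>)
      + real n powr \<delta> * (sqrt (real n) * (2 * K * (2 + real n) powr \<beta>))"
proof -
  have A: "\<bar>antidiff f j\<bar> \<le> K * (2 + \<bar>real_of_int j\<bar>) powr \<beta>"
          "\<bar>antidiff f (j + 1)\<bar> \<le> K * (2 + \<bar>real_of_int j\<bar>) powr \<beta>" for j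
    using K \<beta> by (auto intro!: order_trans[OF f] mult_left_mono powr_mono2)
  have pot: "\<bar>potential f j\<bar> \<le> 2 * K * (2 + \<bar>real_of_int j\<bar>) powr (1 + \<beta>)" for j
  proof -
    have "\<bar>2 * antidiff f (i + 1)\<bar> \<le> 2 * K * (2 + \<bar>real_of_int j\<bar>) powr \<beta>" if "\<bar>i\<bar> \<le> \<bar>j\<bar>" for i
    proof -
      have "\<bar>real_of_int i\<bar> \<le> \<bar>real_of_int j\<bar>" using that by linarith
      then have "(2 + \<bar>real_of_int i\<bar>) powr \<beta> \<le> (2 + \<bar>real_of_int j\<bar>) powr \<beta>"
        using \<beta> by (intro powr_mono2) auto
      then have "K * (2 + \<bar>real_of_int i\<bar>) powr \<beta> \<le> K * (2 + \<bar>real_of_int j\<bar>) powr \<beta>"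
        using K by (intro mult_left_mono) auto
      with A(2)[of i] show ?thesis by (simp add: abs_mult)
    qed
    then have "\<bar>potential f j\<bar> \<le> \<bar>real_of_int j\<bar> * (2 * K * (2 + \<bar>real_of_int j\<bar>) powr \<beta>)"
      unfolding potential_def by (rule antidiff_bound)
    also have "\<dots> \<le> (2 + \<bar>real_of_int j\<bar>) * (2 * K * (2 + \<bar>real_of_int j\<bar>) powr \<beta>)"
      using K by (intro mult_right_mono) auto
    also have "\<dots> = 2 * K * (2 + \<bar>real_of_int j\<bar>) powr (1 + \<beta>)"
      by (simp add: powr_add)
    finally show ?thesis .
  qed
  have "AE x in coins. \<forall>\<^sub>F n in sequentially. \<forall>r\<le>n. \<forall>k\<le>n.
    \<bar>\<Sum>i<k. gradient f (walk x i) * coin_sign (x i)\<bar> \<le> real n powr \<delta> * (sqrt (real n) * (2 * K * (2 + real n) powr \<beta>))"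
  proof (rule AE_walk_transform[OF \<delta>])
    show "\<bar>gradient f j\<bar> \<le> 2 * K * (2 + real n) powr \<beta>" if "\<bar>j\<bar> \<le> int n" for j n
    proof -
      have "\<bar>real_of_int j\<bar> \<le> real n" using that by linarith
      then have "K * (2 + \<bar>real_of_int j\<bar>) powr \<beta> \<le> K * (2 + real n) powr \<beta>"
        using K \<beta> by (intro mult_left_mono powr_mono2) auto
      with A[of j] show ?thesis unfolding gradient_def by linarith
    qed
    show "0 < 2 * K * (2 + real n) powr \<beta>" for n using K by simp
  qed
  then show ?thesis
  proof eventually_elim
    case (elim x)
    then show ?case
    proof eventually_elim
      case (elim n)
      show ?case
      proof (intro allI impI)
        fix m assume "m \<le> n"
        then have "\<bar>\<Sum>i<m. gradient f (walk x i) * coin_sign (x i)\<bar> \<le> real n powr \<delta> * (sqrt (real n) * (2 * K * (2 + real n) powr \<beta>))"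
          using elim by blast
        with additive_functional[of f x m] pot[of "walk x m"]
        show "\<bar>\<Sum>k<m. f (walk x k)\<bar> \<le> 2 * K * (2 + \<bar>real_of_int (walk x m)\<bar>) powr (1 + \<beta>)
          + real n powr \<delta> * (sqrt (real n) * (2 * K * (2 + real n) powr \<beta>))" by linarith
      qed
    qed
  qed
qed

text \<open>Multiplication by \<open>n / 2\<close> turns the error of the average into one of order
  \<open>n powr (1 - \<tau>)\<close>; the finitely many sums before the asymptotics take effect are
  absorbed into \<open>K\<close>.\<close>

lemma centred_partial_sums:
  fixes s :: "nat \<Rightarrow> real" and \<gamma> \<tau> :: real
  assumes o: "(\<lambda>n. (\<Sum>j=1..n. s j) / real n - 2 * \<gamma>) \<in> o(\<lambda>n. real n powr (- \<tau>))" and \<tau>: "\<tau> \<le> 1"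
  shows "\<exists>K>0. \<forall>n. \<bar>\<Sum>j=1..n. s j / 2 - \<gamma>\<bar> \<le> K * (1 + real n) powr (1 - \<tau>)"
proof -
  have "\<forall>\<^sub>F n in sequentially. norm ((\<Sum>j=1..n. s j) / real n - 2 * \<gamma>) \<le> 1 * norm (real n powr (- \<tau>))"
    using landau_o.smallD[OF o, of 1] by simp
  then obtain N where N: "\<And>n. N \<le> n \<Longrightarrow> \<bar>(\<Sum>j=1..n. s j) / real n - 2 * \<gamma>\<bar> \<le> real n powr (- \<tau>)"
    by (auto simp: eventually_sequentially)
  let ?S = "\<lambda>n. \<Sum>j=1..n. s j / 2 - \<gamma>"
  define K where "K = 1 + (\<Sum>n\<le>N. \<bar>?S n\<bar>)"
  have K1: "1 \<le> K" by (simp add: K_def sum_nonneg)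
  have "\<bar>?S n\<bar> \<le> K * (1 + real n) powr (1 - \<tau>)" for n
  proof (cases "n \<le> N")
    case True
    have "\<bar>?S n\<bar> \<le> (\<Sum>n\<le>N. \<bar>?S n\<bar>)" using True by (intro member_le_sum) auto
    then have "\<bar>?S n\<bar> \<le> K * 1" by (simp add: K_def)
    also have "\<dots> \<le> K * (1 + real n) powr (1 - \<tau>)"
      using K1 \<tau> by (intro mult_left_mono ge_one_powr_ge_zero) auto
    finally show ?thesis .
  next
    case False
    then have n: "0 < n" "N \<le> n" by auto
    have "?S n = real n / 2 * ((\<Sum>j=1..n. s j) / real n - 2 * \<gamma>)"
      using n by (simp add: sum_subtractf sum_divide_distrib[symmetric] field_simps)
    then have "\<bar>?S n\<bar> = real n / 2 * \<bar>(\<Sum>j=1..n. s j) / real n - 2 * \<gamma>\<bar>"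
      by (simp only: abs_mult abs_divide abs_of_nat abs_numeral)
    also have "\<dots> \<le> real n / 2 * real n powr (- \<tau>)"
      using N[OF n(2)] by (intro mult_left_mono) auto
    also have "\<dots> \<le> real n powr 1 * real n powr (- \<tau>)" using n by (intro mult_right_mono) auto
    also have "\<dots> = real n powr (1 - \<tau>)" by (simp only: powr_add[symmetric]) simp
    also have "\<dots> \<le> 1 * (1 + real n) powr (1 - \<tau>)" using \<tau> by (simp add: powr_mono2)
    also have "\<dots> \<le> K * (1 + real n) powr (1 - \<tau>)" using K1 by (intro mult_right_mono) auto
    finally show ?thesis .
  qed
  then show ?thesis using K1 by (intro exI[of _ K]) auto
qed

section \<open>The anisotropic walk\<close>

definition unif :: "real measure" where "unif = uniform_measure lborel {0..1}"

abbreviation uniforms :: "(nat \<Rightarrow> real) measure" where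
  "uniforms \<equiv> PiM UNIV (\<lambda>_. unif)"

lemma prob_space_unif: "prob_space unif"
  unfolding unif_def by (rule prob_space_uniform_measure) auto

lemma sets_unif [simp, measurable_cong]: "sets unif = sets borel"
  by (simp add: unif_def)

lemma space_unif [simp]: "space unif = UNIV"
  by (simp add: unif_def)

lemma prob_space_uniforms: "prob_space uniforms"
  by (intro prob_space_PiM prob_space_unif)

lemma space_uniforms [simp]: "space uniforms = UNIV"
  by (simp add: space_PiM)

lemma measure_unif_less: "0 \<le> a \<Longrightarrow> a \<le> 1 \<Longrightarrow> measure unif {..<a} = a"
proof -
  assume a: "0 \<le> a" "a \<le> 1"
  have "{0..1} \<inter> {..<a} = {0..<a}" using a by auto
  then show ?thesis using a by (simp add: unif_def measure_uniform_measure)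
qed

lemma measure_unif_ge: "0 \<le> a \<Longrightarrow> a \<le> 1 \<Longrightarrow> measure unif {a..} = 1 - a"
proof -
  assume a: "0 \<le> a" "a \<le> 1"
  have "{0..1} \<inter> {a..} = {a..1}" using a by auto
  then show ?thesis using a by (simp add: unif_def measure_uniform_measure)
qed

text \<open>The path \<open>s\<close> of the vertical walk is indexed by its own steps and given in
  advance; \<open>u n\<close> decides whether time \<open>n\<close> advances along it. This is what
  allows conditioning on the whole vertical path.\<close>

primrec vert :: "(int \<Rightarrow> real) \<Rightarrow> (nat \<Rightarrow> int) \<Rightarrow> (nat \<Rightarrow> real) \<Rightarrow> nat \<Rightarrow> nat" where
  "vert p s u 0 = 0"
| "vert p s u (Suc n) = vert p s u n + (if u n < 2 * p (s (vert p s u n)) then 1 else 0)"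

lemma vert_le: "vert p s u n \<le> n"
  by (induction n) auto

lemma vert_cong: "(\<And>j. j < n \<Longrightarrow> u j = u' j) \<Longrightarrow> vert p s u n = vert p s u' n"
  by (induction n) auto

lemma measurable_vert [measurable]:
  assumes s: "\<And>k. (\<lambda>\<omega>. s \<omega> k) \<in> measurable M (count_space UNIV)"
    and u: "\<And>k. (\<lambda>\<omega>. u \<omega> k) \<in> borel_measurable M"
  shows "(\<lambda>\<omega>. vert p (s \<omega>) (u \<omega>) n) \<in> measurable M (count_space UNIV)"
proof (induction n)
  case 0 show ?case by simp
next
  case (Suc n)
  note [measurable] = s u Suc
  have "(\<lambda>\<omega>. p (s \<omega> k)) \<in> borel_measurable M" for k
    by (rule measurable_compose[OF s]) simp
  then have [measurable]: "(\<lambda>\<omega>. p (s \<omega> (vert p (s \<omega>) (u \<omega>) n))) \<in> borel_measurable M"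
    by (rule measurable_compose_countable[OF _ Suc])
  show ?case by simp
qed

text \<open>Compensating each vertical step made in row \<open>j\<close> by its expected waiting time \<open>1 / (2 * p j)\<close>
  makes the elapsed time a martingale.\<close>

lemma vert_tail:
  assumes p: "\<And>j. 0 < p j" "\<And>j. p j \<le> 1 / 2" and s: "\<And>k. \<bar>s k\<bar> \<le> int k"
    and Q: "\<And>j. \<bar>j\<bar> \<le> int n \<Longrightarrow> 1 / (2 * p j) \<le> Q" and x: "0 < x" "0 < n"
  shows "measure uniforms {u. x * (sqrt (real n) * Q) \<le> \<bar>real n - (\<Sum>k<vert p s u n. 1 / (2 * p (s k)))\<bar>}
    \<le> 2 * exp (- x\<^sup>2 / 2)"
proof -
  define D where "D i u = (if i < n then 1 - (if u i < 2 * p (s (vert p s u i)) then 1 / (2 * p (s (vert p s u i))) else 0) else 0)" for i u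
  have Q1: "1 \<le> Q"
  proof -
    have "1 \<le> 1 / (2 * p 0)" using p[of 0] by (simp add: field_simps)
    then show ?thesis using Q[of 0] by simp
  qed
  have eq: "real m - (\<Sum>k<vert p s u m. 1 / (2 * p (s k))) = (\<Sum>i<m. D i u)" if "m \<le> n" for u m
    using that by (induction m) (auto simp: D_def)
  have vm[measurable]: "(\<lambda>u. vert p s u m) \<in> measurable uniforms (count_space UNIV)" for m
    by (rule measurable_vert) auto
  have [measurable]: "(\<lambda>u. p (s (vert p s u m))) \<in> borel_measurable uniforms" for m
    by (rule measurable_compose[OF vm]) simp
  have "measure uniforms {\<omega> \<in> space uniforms. x * sqrt (real n * Q\<^sup>2) \<le> \<bar>\<Sum>i<n. D i \<omega>\<bar>} \<le> 2 * exp (- x\<^sup>2 / 2)"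
  proof (rule Azuma_tail[OF prob_space_unif, where c = "\<lambda>_. Q"])
    show "D i \<in> borel_measurable uniforms" for i
      unfolding D_def[abs_def] by measurable
    show "D i \<omega> = D i \<omega>'" if "\<And>j. j \<le> i \<Longrightarrow> \<omega> j = \<omega>' j" for i \<omega> \<omega>'
      using that vert_cong[of i \<omega> \<omega>' p s] by (simp add: D_def)
    show "(\<integral>y. D i (\<omega> (i := y)) \<partial>unif) = 0" for i \<omega>
    proof (cases "i < n")
      case True
      interpret prob_space unif by (rule prob_space_unif)
      define j where "j = s (vert p s \<omega> i)"
      have v: "vert p s (\<omega> (i := y)) i = vert p s \<omega> i" for y by (rule vert_cong) auto
      have "D i (\<omega> (i := y)) = 1 - 1 / (2 * p j) * indicator {..<2 * p j} y" for y
        using True by (simp add: D_def v j_def)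
      then have "(\<integral>y. D i (\<omega> (i := y)) \<partial>unif) = (\<integral>y. 1 - 1 / (2 * p j) * indicator {..<2 * p j} y \<partial>unif)"
        by (simp only:)
      also have "\<dots> = 1 - 1 / (2 * p j) * measure unif {..<2 * p j}"
      proof -
        have "integrable unif (\<lambda>y. 1 / (2 * p j) * indicator {..<2 * p j} y)"
          by (intro integrable_mult_right integrable_real_indicator) (auto simp: emeasure_eq_measure)
        then show ?thesis using prob_space by (subst Bochner_Integration.integral_diff) auto
      qed
      also have "\<dots> = 0" using p[of j] by (simp add: measure_unif_less)
      finally show ?thesis .
    qed (simp add: D_def)
    show "\<bar>D i \<omega>\<bar> \<le> Q" for i \<omega>
    proof (cases "i < n")
      case True
      define j where "j = s (vert p s \<omega> i)"
      have "\<bar>j\<bar> \<le> int n" using s[of "vert p s \<omega> i"] vert_le[of p s \<omega> i] True by (simp add: j_def)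
      moreover have "1 \<le> 1 / (2 * p j)" using p[of j] by (simp add: field_simps)
      ultimately show ?thesis using Q[of j] Q1 True unfolding D_def j_def[symmetric] by auto
    qed (use Q1 in \<open>simp add: D_def\<close>)
  qed (use x Q1 in auto)
  then show ?thesis using Q1 by (simp add: eq real_sqrt_mult)
qed

text \<open>By Fubini the vertical path may be fixed. Then only the uniforms are random, and
  \<open>vert_tail\<close> applies with \<open>Q n\<close> bounding the waiting times in all rows
  that the path can reach within \<open>n\<close> steps.\<close>

lemma AE_vert:
  fixes Q :: "nat \<Rightarrow> real"
  assumes p: "\<And>j. 0 < p j" "\<And>j. p j \<le> 1 / 2" and \<delta>: "0 < \<delta>"
    and Q: "\<And>n j. \<bar>j\<bar> \<le> int n \<Longrightarrow> 1 / (2 * p j) \<le> Q n"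
  shows "AE (x, u) in coins \<Otimes>\<^sub>M uniforms. \<forall>\<^sub>F n in sequentially.
    \<bar>real n - (\<Sum>k<vert p (walk x) u n. 1 / (2 * p (walk x k)))\<bar> \<le> real n powr \<delta> * (sqrt (real n) * Q n)"
proof -
  interpret C: prob_space "coins :: (nat \<Rightarrow> bool) measure" by (rule prob_space_coins)
  interpret U: prob_space uniforms by (rule prob_space_uniforms)
  interpret pair_sigma_finite "coins :: (nat \<Rightarrow> bool) measure" uniforms by unfold_locales
  have vm[measurable]: "(\<lambda>\<omega>. vert p (walk (fst \<omega>)) (snd \<omega>) m) \<in> measurable (coins \<Otimes>\<^sub>M uniforms) (count_space UNIV)" for m
    by (rule measurable_vert) auto
  have [measurable]: "(\<lambda>\<omega>. \<Sum>k<vert p (walk (fst \<omega>)) (snd \<omega>) n. 1 / (2 * p (walk (fst \<omega>) k))) \<in> borel_measurable (coins \<Otimes>\<^sub>M uniforms)" for n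
  proof (rule measurable_compose_countable[OF _ vm])
    fix v
    have "(\<lambda>\<omega>. 1 / (2 * p (walk (fst \<omega>) k))) \<in> borel_measurable (coins \<Otimes>\<^sub>M uniforms)" for k
      by (rule measurable_compose[OF measurable_fst borel_measurable_walk])
    then show "(\<lambda>\<omega>. \<Sum>k<v. 1 / (2 * p (walk (fst \<omega>) k))) \<in> borel_measurable (coins \<Otimes>\<^sub>M uniforms)"
      by (intro borel_measurable_sum)
  qed
  have vu[measurable]: "(\<lambda>u. \<Sum>k<vert p s u n. 1 / (2 * p (s k))) \<in> borel_measurable uniforms" for s n
    by (rule measurable_compose_countable[OF _ measurable_vert]) auto
  have "AE \<omega> in coins \<Otimes>\<^sub>M uniforms. \<forall>\<^sub>F n in sequentially.
    \<bar>real n - (\<Sum>k<vert p (walk (fst \<omega>)) (snd \<omega>) n. 1 / (2 * p (walk (fst \<omega>) k)))\<bar> \<le> real n powr \<delta> * (sqrt (real n) * Q n)"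
  proof (rule AE_pair_measure)
    show "{\<omega> \<in> space (coins \<Otimes>\<^sub>M uniforms). \<forall>\<^sub>F n in sequentially.
      \<bar>real n - (\<Sum>k<vert p (walk (fst \<omega>)) (snd \<omega>) n. 1 / (2 * p (walk (fst \<omega>) k)))\<bar> \<le> real n powr \<delta> * (sqrt (real n) * Q n)}
      \<in> sets (coins \<Otimes>\<^sub>M uniforms)"
      by measurable
    show "AE x in coins. AE u in uniforms. \<forall>\<^sub>F n in sequentially.
      \<bar>real n - (\<Sum>k<vert p (walk (fst (x, u))) (snd (x, u)) n. 1 / (2 * p (walk (fst (x, u)) k)))\<bar> \<le> real n powr \<delta> * (sqrt (real n) * Q n)"
    proof (rule AE_I2)
      fix x :: "nat \<Rightarrow> bool"
      \<comment> \<open>The index type \<open>unit\<close> reflects that one event per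
        \<open>n\<close> has to be excluded.\<close>
      define E where "E n (i::unit) = {u \<in> space uniforms. real n powr \<delta> * (sqrt (real n) * Q n) < \<bar>real n - (\<Sum>k<vert p (walk x) u n. 1 / (2 * p (walk x k)))\<bar>}" for n i
      have "AE u in uniforms. \<forall>\<^sub>F n in sequentially. \<forall>i\<in>UNIV. u \<notin> E n i"
      proof (rule Borel_Cantelli_polynomially_many[OF prob_space_uniforms \<delta>, where K = 1 and k = 0])
        show "E n i \<in> sets uniforms" for n i unfolding E_def by measurable
        show "measure uniforms (E n i) \<le> 2 * exp (- (real n powr \<delta>)\<^sup>2 / 2)" if n: "1 \<le> n" for n i
        proof -
          have "{u \<in> space uniforms. real n powr \<delta> * (sqrt (real n) * Q n) \<le> \<bar>real n - (\<Sum>k<vert p (walk x) u n. 1 / (2 * p (walk x k)))\<bar>} \<in> sets uniforms"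
            by measurable
          then have "measure uniforms (E n i) \<le> measure uniforms {u. real n powr \<delta> * (sqrt (real n) * Q n) \<le> \<bar>real n - (\<Sum>k<vert p (walk x) u n. 1 / (2 * p (walk x k)))\<bar>}"
            by (intro U.finite_measure_mono) (auto simp: E_def)
          also have "\<dots> \<le> 2 * exp (- (real n powr \<delta>)\<^sup>2 / 2)"
            using n by (intro vert_tail p abs_walk_le Q) auto
          finally show ?thesis .
        qed
      qed auto
      then show "AE u in uniforms. \<forall>\<^sub>F n in sequentially.
      \<bar>real n - (\<Sum>k<vert p (walk (fst (x, u))) (snd (x, u)) n. 1 / (2 * p (walk (fst (x, u)) k)))\<bar> \<le> real n powr \<delta> * (sqrt (real n) * Q n)"
        by eventually_elim (auto elim!: eventually_mono simp: E_def not_less)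
    qed
  qed
  then show ?thesis by (simp add: case_prod_beta)
qed

section \<open>The coupled walk and the probabilities of its histories\<close>

definition aniso :: "(int \<Rightarrow> real) \<Rightarrow> nat \<Rightarrow> (nat \<Rightarrow> bool) \<times> (nat \<Rightarrow> bool) \<times> (nat \<Rightarrow> real) \<Rightarrow> int \<times> int" where
  "aniso p n = (\<lambda>(x, y, u). (walk x (n - vert p (walk y) u n), walk y (vert p (walk y) u n)))"

abbreviation drivers :: "((nat \<Rightarrow> bool) \<times> (nat \<Rightarrow> bool) \<times> (nat \<Rightarrow> real)) measure" where
  "drivers \<equiv> coins \<Otimes>\<^sub>M (coins \<Otimes>\<^sub>M uniforms)"

lemma space_drivers [simp]: "space drivers = UNIV"
  by (simp add: space_pair_measure)

lemma measurable_aniso [measurable]: "aniso p n \<in> measurable drivers (count_space UNIV)"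
proof -
  have vm[measurable]: "(\<lambda>\<omega>. vert p (walk (fst (snd \<omega>))) (snd (snd \<omega>)) m) \<in> measurable drivers (count_space UNIV)" for m
    by (rule measurable_vert) auto
  have [measurable]: "(\<lambda>\<omega>. walk (fst \<omega>) k) \<in> measurable drivers (count_space UNIV)"
    "(\<lambda>\<omega>. walk (fst (snd \<omega>)) k) \<in> measurable drivers (count_space UNIV)" for k
    by (auto intro!: measurable_walk)
  have "(\<lambda>\<omega>. walk (fst \<omega>) (n - vert p (walk (fst (snd \<omega>))) (snd (snd \<omega>)) n)) \<in> measurable drivers (count_space UNIV)"
    "(\<lambda>\<omega>. walk (fst (snd \<omega>)) (vert p (walk (fst (snd \<omega>))) (snd (snd \<omega>)) n)) \<in> measurable drivers (count_space UNIV)"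
    by (rule measurable_compose_countable[OF _ vm], simp)+
  then have "(\<lambda>\<omega>. (walk (fst \<omega>) (n - vert p (walk (fst (snd \<omega>))) (snd (snd \<omega>)) n),
      walk (fst (snd \<omega>)) (vert p (walk (fst (snd \<omega>))) (snd (snd \<omega>)) n)))
    \<in> measurable drivers (count_space UNIV \<Otimes>\<^sub>M count_space UNIV)"
    by (rule measurable_Pair)
  then show ?thesis
    by (simp add: aniso_def[abs_def] case_prod_beta pair_measure_countable)
qed

lemma aniso_0: "aniso p 0 \<omega> = (0, 0)"
  by (cases \<omega>) (simp add: aniso_def walk_def)

lemma aniso_Suc:
  fixes x y u p n
  defines "v \<equiv> vert p (walk y) u n" and "\<omega> \<equiv> (x, y, u)"
  shows "aniso p (Suc n) \<omega> = (if u n < 2 * p (snd (aniso p n \<omega>))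
    then (fst (aniso p n \<omega>), snd (aniso p n \<omega>) + (if y v then 1 else - 1))
    else (fst (aniso p n \<omega>) + (if x (n - v) then 1 else - 1), snd (aniso p n \<omega>)))"
  using vert_le[of p "walk y" u n]
  by (auto simp: aniso_def \<omega>_def v_def Suc_diff_le walk_def)

definition neighbour :: "int \<times> int \<Rightarrow> int \<times> int \<Rightarrow> bool" where
  "neighbour a b \<longleftrightarrow> (\<exists>s. b = (fst a + (if s then 1 else - 1), snd a) \<or> b = (fst a, snd a + (if s then 1 else - 1)))"

lemma neighbour_aniso: "neighbour (aniso p n \<omega>) (aniso p (Suc n) \<omega>)"
  by (cases \<omega>) (auto simp: aniso_Suc neighbour_def)

lemma step_prob_not_neighbour: "\<not> neighbour a b \<Longrightarrow> step_prob p a b = 0"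
proof -
  assume "\<not> neighbour a b"
  then have "b \<noteq> (fst a + 1, snd a)" "b \<noteq> (fst a - 1, snd a)" "b \<noteq> (fst a, snd a + 1)" "b \<noteq> (fst a, snd a - 1)"
    unfolding neighbour_def by (metis (full_types) diff_conv_add_uminus)+
  then show ?thesis by (cases a) (simp add: step_prob_def)
qed

text \<open>A history of the anisotropic walk fixes an initial segment of each of the three independent
  driving sequences.\<close>

definition history_box where
  "history_box p z n h v a b B \<longleftrightarrow> h + v = n \<and> (\<forall>i. B i \<in> sets borel) \<and>
    (\<forall>x y u. (\<forall>i\<le>n. aniso p i (x, y, u) = z i) \<longleftrightarrow>
      (\<forall>k\<in>{..<h}. x k = a k) \<and> (\<forall>k\<in>{..<v}. y k = b k) \<and> (\<forall>i\<in>{..<n}. u i \<in> B i)) \<and>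
    (\<forall>x y u. (\<forall>i\<le>n. aniso p i (x, y, u) = z i) \<longrightarrow> vert p (walk y) u n = v) \<and>
    (1/2) ^ h * ((1/2) ^ v * (\<Prod>i<n. measure unif (B i))) = (\<Prod>i<n. step_prob p (z i) (z (Suc i)))"

lemma history_rectangle:
  assumes p: "\<And>j. 0 < p j" "\<And>j. p j \<le> 1 / 2" and "z 0 = (0, 0)"
    and nn: "\<And>i. i < n \<Longrightarrow> neighbour (z i) (z (Suc i))"
  shows "\<exists>h v a b B. history_box p z n h v a b B"
  using nn
proof (induction n)
  case 0
  show ?case using assms(3)
    by (intro exI[of _ 0] exI[of _ "\<lambda>_. True"] exI[of _ "\<lambda>_. {}"]) (simp add: history_box_def aniso_0)
next
  case (Suc n)
  define H where "H m x y u \<longleftrightarrow> (\<forall>i\<le>m. aniso p i (x, y, u) = z i)" for m x y u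
  have HS: "H (Suc n) x y u \<longleftrightarrow> H n x y u \<and> aniso p (Suc n) (x, y, u) = z (Suc n)" for x y u
    by (auto simp: H_def le_Suc_eq)
  obtain h v a b B where box: "history_box p z n h v a b B"
    using Suc.IH Suc.prems by (meson less_SucI)
  note box' = box[unfolded history_box_def, folded H_def]
  have hv: "h + v = n" by (rule box'[THEN conjunct1])
  have B: "B i \<in> sets borel" for i by (rule box'[THEN conjunct2, THEN conjunct1, THEN spec])
  have iff: "H n x y u \<longleftrightarrow>
      (\<forall>k\<in>{..<h}. x k = a k) \<and> (\<forall>k\<in>{..<v}. y k = b k) \<and> (\<forall>i\<in>{..<n}. u i \<in> B i)" for x y u
    by (rule box'[THEN conjunct2, THEN conjunct2, THEN conjunct1, THEN spec, THEN spec, THEN spec])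
  have vert: "H n x y u \<Longrightarrow> vert p (walk y) u n = v" for x y u
    by (rule box'[THEN conjunct2, THEN conjunct2, THEN conjunct2, THEN conjunct1, THEN spec, THEN spec, THEN spec, THEN mp])
  have prod: "(1/2) ^ h * ((1/2) ^ v * (\<Prod>i<n. measure unif (B i))) = (\<Prod>i<n. step_prob p (z i) (z (Suc i)))"
    by (rule box'[THEN conjunct2, THEN conjunct2, THEN conjunct2, THEN conjunct2])
  obtain k j where zn: "z n = (k, j)" by (cases "z n")
  have an: "aniso p n (x, y, u) = (k, j)" if "H n x y u" for x y u
    using that by (simp add: H_def zn)
  have coin_row: "walk y v = j" if "H n x y u" for x y u
    using an[OF that] vert[OF that] by (simp add: aniso_def)
  have next_step: "aniso p (Suc n) (x, y, u) = (if u n < 2 * p j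
    then (k, j + (if y v then 1 else - 1)) else (k + (if x h then 1 else - 1), j))" if "H n x y u" for x y u
  proof -
    have "n - v = h" using hv by simp
    then show ?thesis using aniso_Suc[of p n x y u] an[OF that] vert[OF that] by simp
  qed
  have vert_Suc: "vert p (walk y) u (Suc n) = (if u n < 2 * p j then Suc v else v)" if "H n x y u" for x y u
    using vert[OF that] coin_row[OF that] by simp
  have meas: "measure unif {..<2 * p j} = 2 * p j" "measure unif {2 * p j..} = 1 - 2 * p j"
    using p[of j] by (auto simp: measure_unif_less measure_unif_ge)
  have pr: "(\<Prod>i<n. measure unif ((B(n := A)) i)) = (\<Prod>i<n. measure unif (B i))" for A
    by (intro prod.cong) auto
  consider (horiz) s where "z (Suc n) = (k + (if s then 1 else - 1), j)" | (vert) s where "z (Suc n) = (k, j + (if s then 1 else - 1))"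
    using Suc.prems[of n] by (auto simp: neighbour_def zn)
  then show ?case
  proof cases
    case (horiz s)
    \<comment> \<open>The factor \<open>1/2\<close> is paid by the coin, the rest by the
      uniform.\<close>
    have sp: "step_prob p (z n) (z (Suc n)) = 1/2 * (1 - 2 * p j)"
      by (simp add: zn horiz step_prob_def)
    show ?thesis
      unfolding history_box_def H_def[symmetric]
    proof (intro exI conjI allI impI)
      show "Suc h + v = Suc n" using hv by simp
      show "(B(n := {2 * p j..})) i \<in> sets borel" for i using B by simp
      show "H (Suc n) x y u \<longleftrightarrow> (\<forall>k\<in>{..<Suc h}. x k = (a(h := s)) k) \<and> (\<forall>k\<in>{..<v}. y k = b k) \<and> (\<forall>i\<in>{..<Suc n}. u i \<in> (B(n := {2 * p j..})) i)" for x y u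
      proof -
        have "H (Suc n) x y u \<longleftrightarrow> H n x y u \<and> x h = s \<and> 2 * p j \<le> u n"
          unfolding HS using next_step[of x y u] by (auto simp: horiz split: if_splits)
        then show ?thesis unfolding iff by (auto simp: less_Suc_eq)
      qed
      show "vert p (walk y) u (Suc n) = v" if "H (Suc n) x y u" for x y u
        using that next_step[of x y u] vert_Suc[of x y u] unfolding HS by (auto simp: horiz split: if_splits)
      show "(1/2) ^ Suc h * ((1/2) ^ v * (\<Prod>i<Suc n. measure unif ((B(n := {2 * p j..})) i))) = (\<Prod>i<Suc n. step_prob p (z i) (z (Suc i)))"
        unfolding prod.lessThan_Suc pr sp prod[symmetric] by (simp add: meas)
    qed
  next
    case (vert s)
    have sp: "step_prob p (z n) (z (Suc n)) = 1/2 * (2 * p j)"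
      by (auto simp: zn vert step_prob_def)
    show ?thesis
      unfolding history_box_def H_def[symmetric]
    proof (intro exI conjI allI impI)
      show "h + Suc v = Suc n" using hv by simp
      show "(B(n := {..<2 * p j})) i \<in> sets borel" for i using B by simp
      show "H (Suc n) x y u \<longleftrightarrow> (\<forall>k\<in>{..<h}. x k = a k) \<and> (\<forall>k\<in>{..<Suc v}. y k = (b(v := s)) k) \<and> (\<forall>i\<in>{..<Suc n}. u i \<in> (B(n := {..<2 * p j})) i)" for x y u
      proof -
        have "H (Suc n) x y u \<longleftrightarrow> H n x y u \<and> y v = s \<and> u n < 2 * p j"
          unfolding HS using next_step[of x y u] by (auto simp: vert split: if_splits)
        then show ?thesis unfolding iff by (auto simp: less_Suc_eq)
      qed
      show "vert p (walk y) u (Suc n) = Suc v" if "H (Suc n) x y u" for x y u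
        using that next_step[of x y u] vert_Suc[of x y u] unfolding HS by (auto simp: vert split: if_splits)
      show "(1/2) ^ h * ((1/2) ^ Suc v * (\<Prod>i<Suc n. measure unif ((B(n := {..<2 * p j})) i))) = (\<Prod>i<Suc n. step_prob p (z i) (z (Suc i)))"
        unfolding prod.lessThan_Suc pr sp prod[symmetric] by (simp add: meas)
    qed
  qed
qed

lemma measure_cylinder:
  assumes "finite J"
  shows "measure coins {c. \<forall>i\<in>J. c i = \<eta> i} = (1/2) ^ card J"
  by (simp add: measure_def emeasure_cylinder[OF assms])

lemma uniform_box:
  assumes J: "finite J" and B: "\<And>i. B i \<in> sets borel"
  shows "{u. \<forall>i\<in>J. u i \<in> B i} \<in> sets uniforms"
    and "measure uniforms {u. \<forall>i\<in>J. u i \<in> B i} = (\<Prod>i\<in>J. measure unif (B i))"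
proof -
  interpret unif: prob_space unif by (rule prob_space_unif)
  interpret P: product_prob_space "\<lambda>_. unif" "UNIV :: nat set" by unfold_locales
  have emb: "{u. \<forall>i\<in>J. u i \<in> B i} = prod_emb UNIV (\<lambda>_. unif) J (Pi\<^sub>E J B)"
    by (auto simp: prod_emb_def space_PiM PiE_iff)
  show "{u. \<forall>i\<in>J. u i \<in> B i} \<in> sets uniforms"
    unfolding emb using J B by (intro sets_PiM_I) simp_all
  show "measure uniforms {u. \<forall>i\<in>J. u i \<in> B i} = (\<Prod>i\<in>J. measure unif (B i))"
    unfolding emb using J B by (intro P.measure_PiM_emb) simp_all
qed

text \<open>With a transition between non-neighbours both sides vanish; every other history is the
  product set supplied by \<open>history_rectangle\<close>.\<close>

lemma history_probability:
  assumes p: "\<And>j. 0 < p j" "\<And>j. p j \<le> 1 / 2" and z0: "z 0 = (0, 0)"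
  shows "measure drivers {\<omega>. \<forall>i\<le>n. aniso p i \<omega> = z i} = (\<Prod>i<n. step_prob p (z i) (z (Suc i)))"
proof (cases "\<exists>i<n. \<not> neighbour (z i) (z (Suc i))")
  case True
  then obtain i where i: "i < n" "\<not> neighbour (z i) (z (Suc i))" by auto
  have False if "\<forall>i\<le>n. aniso p i \<omega> = z i" for \<omega>
    using that[rule_format, of i] that[rule_format, of "Suc i"] neighbour_aniso[of p i \<omega>] i by simp
  then have "{\<omega>. \<forall>i\<le>n. aniso p i \<omega> = z i} = {}" by blast
  moreover have "(\<Prod>i<n. step_prob p (z i) (z (Suc i))) = 0"
    using i step_prob_not_neighbour[of "z i" "z (Suc i)" p] by (intro prod_zero) auto
  ultimately show ?thesis by (simp only: measure_empty)
next
  case False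
  obtain h v a b B where box: "history_box p z n h v a b B"
    using history_rectangle[of p z n] p z0 False by blast
  note box' = box[unfolded history_box_def]
  have B: "B i \<in> sets borel" for i by (rule box'[THEN conjunct2, THEN conjunct1, THEN spec])
  have iff: "(\<forall>i\<le>n. aniso p i (x, y, u) = z i) \<longleftrightarrow>
      (\<forall>k\<in>{..<h}. x k = a k) \<and> (\<forall>k\<in>{..<v}. y k = b k) \<and> (\<forall>i\<in>{..<n}. u i \<in> B i)" for x y u
    by (rule box'[THEN conjunct2, THEN conjunct2, THEN conjunct1, THEN spec, THEN spec, THEN spec])
  have prod: "(1/2) ^ h * ((1/2) ^ v * (\<Prod>i<n. measure unif (B i))) = (\<Prod>i<n. step_prob p (z i) (z (Suc i)))"
    by (rule box'[THEN conjunct2, THEN conjunct2, THEN conjunct2, THEN conjunct2])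
  interpret C: prob_space "coins :: (nat \<Rightarrow> bool) measure" by (rule prob_space_coins)
  interpret U: prob_space uniforms by (rule prob_space_uniforms)
  interpret CU: prob_space "(coins :: (nat \<Rightarrow> bool) measure) \<Otimes>\<^sub>M uniforms" by (intro prob_space_pair prob_space_coins prob_space_uniforms)
  let ?X = "{x. \<forall>k\<in>{..<h}. x k = a k}" and ?Y = "{y. \<forall>k\<in>{..<v}. y k = b k}" and ?U = "{u. \<forall>i\<in>{..<n}. u i \<in> B i}"
  have U: "?U \<in> sets uniforms" "measure uniforms ?U = (\<Prod>i<n. measure unif (B i))"
    by (rule uniform_box[OF finite_lessThan B])+
  have XY: "?X \<in> sets coins" "?Y \<in> sets coins"
    using cylinder_sets[of "{..<h}" "\<lambda>i. {a i}"] cylinder_sets[of "{..<v}" "\<lambda>i. {b i}"] by auto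
  have "{\<omega>. \<forall>i\<le>n. aniso p i \<omega> = z i} = ?X \<times> (?Y \<times> ?U)"
  proof (rule set_eqI)
    fix \<omega> :: "(nat \<Rightarrow> bool) \<times> (nat \<Rightarrow> bool) \<times> (nat \<Rightarrow> real)"
    obtain x y u where [simp]: "\<omega> = (x, y, u)" by (cases \<omega>)
    show "\<omega> \<in> {\<omega>. \<forall>i\<le>n. aniso p i \<omega> = z i} \<longleftrightarrow> \<omega> \<in> ?X \<times> (?Y \<times> ?U)"
      using iff[of x y u] by simp
  qed
  then have "measure drivers {\<omega>. \<forall>i\<le>n. aniso p i \<omega> = z i} = measure coins ?X * (measure coins ?Y * measure uniforms ?U)"
    using XY U(1) by (simp add: measure_def CU.emeasure_pair_measure_Times U.emeasure_pair_measure_Times enn2real_mult pair_measureI)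
  also have "\<dots> = (\<Prod>i<n. step_prob p (z i) (z (Suc i)))"
    unfolding U(2) prod[symmetric] by (simp add: measure_cylinder)
  finally show ?thesis .
qed

section \<open>The probability space\<close>

definition measure_preserving :: "'a measure \<Rightarrow> 'b measure \<Rightarrow> ('a \<Rightarrow> 'b) \<Rightarrow> bool" where
  "measure_preserving M N \<phi> \<longleftrightarrow> \<phi> \<in> measurable M N \<and> distr M N \<phi> = N"

lemma measure_preserving_compose:
  assumes "measure_preserving M N \<phi>" "measure_preserving N K \<psi>"
  shows "measure_preserving M K (\<lambda>x. \<psi> (\<phi> x))"
proof -
  have "distr M K (\<psi> \<circ> \<phi>) = distr (distr M N \<phi>) K \<psi>"
    using assms by (subst distr_distr) (auto simp: measure_preserving_def)
  then show ?thesis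
    using assms by (auto simp: measure_preserving_def comp_def intro: measurable_compose)
qed

lemma AE_measure_preserving:
  assumes "measure_preserving M N \<phi>" "AE x in N. P x"
  shows "AE x in M. P (\<phi> x)"
proof (rule AE_distrD[where f = \<phi> and M' = N and P = P])
  have m: "\<phi> \<in> measurable M N" and d: "distr M N \<phi> = N"
    using assms(1) by (simp_all add: measure_preserving_def)
  show "\<phi> \<in> measurable M N" by (rule m)
  show "AE x in distr M N \<phi>. P x" unfolding d by (rule assms(2))
qed

lemma measure_preserving_fst:
  assumes "prob_space M2" shows "measure_preserving (M1 \<Otimes>\<^sub>M M2) M1 fst"
  using prob_space.distr_pair_fst[OF assms] by (auto simp: measure_preserving_def)

lemma measure_preserving_snd:
  assumes "prob_space M1" "prob_space M2" shows "measure_preserving (M1 \<Otimes>\<^sub>M M2) M2 snd"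
  unfolding measure_preserving_def
proof (intro conjI measure_eqI)
  interpret M1: prob_space M1 by fact
  interpret M2: prob_space M2 by fact
  fix A assume "A \<in> sets (distr (M1 \<Otimes>\<^sub>M M2) M2 snd)"
  then have A: "A \<in> sets M2" by simp
  have "snd -` A \<inter> space (M1 \<Otimes>\<^sub>M M2) = space M1 \<times> A"
    using sets.sets_into_space[OF A] by (auto simp: space_pair_measure)
  then show "emeasure (distr (M1 \<Otimes>\<^sub>M M2) M2 snd) A = emeasure M2 A"
    using A by (simp add: emeasure_distr M2.emeasure_pair_measure_Times M1.emeasure_space_1)
qed auto

lemma measure_preserving_id: "measure_preserving M M (\<lambda>x. x)"
  using distr_id2[of M M] by (simp add: measure_preserving_def)

lemma measure_preserving_prod:
  assumes "measure_preserving M N \<phi>" "measure_preserving M' N' \<psi>" "prob_space N'"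
  shows "measure_preserving (M \<Otimes>\<^sub>M M') (N \<Otimes>\<^sub>M N') (\<lambda>(x, y). (\<phi> x, \<psi> y))"
proof -
  have m: "\<phi> \<in> measurable M N" "\<psi> \<in> measurable M' N'" and d: "distr M N \<phi> = N" "distr M' N' \<psi> = N'"
    using assms by (auto simp: measure_preserving_def)
  note [measurable] = m
  have "sigma_finite_measure (distr M' N' \<psi>)"
    using assms(3) d(2) by (simp add: prob_space_imp_sigma_finite)
  from pair_measure_distr[OF m this] show ?thesis
    unfolding measure_preserving_def by (simp add: d)
qed

text \<open>The conditional probability is the quotient of the probabilities of two histories that
  differ by one step, and in the product formula all factors but the last cancel.\<close>

lemma anisotropic_walk_aniso:
  assumes M: "prob_space M" and \<phi>: "measure_preserving M drivers \<phi>"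
    and p: "\<And>j. 0 < p j" "\<And>j. p j \<le> 1 / 2"
  shows "anisotropic_walk M p (\<lambda>n \<omega>. aniso p n (\<phi> \<omega>))"
  unfolding anisotropic_walk_def
proof (intro conjI allI ballI impI)
  have m: "\<phi> \<in> measurable M drivers" and d: "distr M drivers \<phi> = drivers"
    using \<phi> by (auto simp: measure_preserving_def)
  show "(\<lambda>\<omega>. aniso p n (\<phi> \<omega>)) \<in> measurable M (count_space UNIV)" for n
    by (rule measurable_compose[OF m measurable_aniso])
  fix n x y
  define H where "H m z = {\<omega>. \<forall>i\<le>m. aniso p i \<omega> = z i}" for m z
  have H: "H m z \<in> sets drivers" for m z
  proof -
    have "{\<omega> \<in> space drivers. \<forall>i\<le>m. aniso p i \<omega> = z i} \<in> sets drivers" by measurable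
    then show ?thesis by (simp add: H_def)
  qed
  have prob: "measure M {\<omega> \<in> space M. \<forall>i\<le>m. aniso p i (\<phi> \<omega>) = z i} = measure drivers (H m z)" for m z
    using measure_preserving_vimage[OF d m H[of m z]] by (simp add: H_def)
  assume pos: "0 < measure M {\<omega> \<in> space M. \<forall>i\<le>n. aniso p i (\<phi> \<omega>) = x i}"
  \<comment> \<open>Positive probability forces the history to start at the origin, as
    \<open>history_probability\<close> requires.\<close>
  have x0: "x 0 = (0, 0)"
  proof (rule ccontr)
    assume "x 0 \<noteq> (0, 0)"
    then have "{\<omega> \<in> space M. \<forall>i\<le>n. aniso p i (\<phi> \<omega>) = x i} = {}"
      using aniso_0[of p] by (metis (mono_tags, lifting) empty_Collect_eq le0)
    then have "measure M {\<omega> \<in> space M. \<forall>i\<le>n. aniso p i (\<phi> \<omega>) = x i} = 0" by (simp only: measure_empty)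
    with pos show False by simp
  qed
  let ?x = "x(Suc n := y)"
  have *: "measure M {\<omega> \<in> space M. aniso p (Suc n) (\<phi> \<omega>) = y \<and> (\<forall>i\<le>n. aniso p i (\<phi> \<omega>) = x i)}
      = measure M {\<omega> \<in> space M. \<forall>i\<le>Suc n. aniso p i (\<phi> \<omega>) = ?x i}"
    by (rule arg_cong[where f = "measure M"]) (auto simp: le_Suc_eq)
  have "measure drivers (H (Suc n) ?x) = (\<Prod>i<Suc n. step_prob p (?x i) (?x (Suc i)))"
    unfolding H_def using x0 by (intro history_probability p) simp
  also have "\<dots> = (\<Prod>i<n. step_prob p (x i) (x (Suc i))) * step_prob p (x n) y"
    by simp
  also have "(\<Prod>i<n. step_prob p (x i) (x (Suc i))) = measure drivers (H n x)"
    unfolding H_def using x0 by (intro history_probability[symmetric] p) simp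
  finally show "\<P>(\<omega> in M. aniso p (Suc n) (\<phi> \<omega>) = y \<bar> \<forall>i\<le>n. aniso p i (\<phi> \<omega>) = x i) = step_prob p (x n) y"
    using pos unfolding cond_prob_def * prob by simp
qed (simp_all add: M aniso_0)

section \<open>The sources of randomness and their coding by real sequences\<close>

abbreviation source :: "((nat \<times> nat \<Rightarrow> bool) \<times> (nat \<times> nat \<Rightarrow> bool) \<times> (nat \<Rightarrow> real)) measure" where
  "source \<equiv> coins \<Otimes>\<^sub>M (coins \<Otimes>\<^sub>M uniforms)"

lemma prob_space_source: "prob_space source"
  by (intro prob_space_pair prob_space_coins prob_space_uniforms)

lemma space_source [simp]: "space source = UNIV"
  by (simp add: space_pair_measure)

text \<open>Sample points have to be real sequences, while the construction lives on
  \<open>source\<close>. A measurable coding with a measurable left inverse transports the measure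
  without changing any law.\<close>

definition encode :: "(nat \<times> nat \<Rightarrow> bool) \<times> (nat \<times> nat \<Rightarrow> bool) \<times> (nat \<Rightarrow> real) \<Rightarrow> sample_point" where
  "encode = (\<lambda>(c, d, u) n. if n mod 3 = 0 then of_bool (c (prod_decode (n div 3)))
    else if n mod 3 = 1 then of_bool (d (prod_decode (n div 3))) else u (n div 3))"

definition decode :: "sample_point \<Rightarrow> (nat \<times> nat \<Rightarrow> bool) \<times> (nat \<times> nat \<Rightarrow> bool) \<times> (nat \<Rightarrow> real)" where
  "decode \<omega> = (\<lambda>a. \<omega> (3 * prod_encode a) = 1, \<lambda>a. \<omega> (3 * prod_encode a + 1) = 1, \<lambda>n. \<omega> (3 * n + 2))"

lemma decode_encode: "decode (encode x) = x"
proof -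
  have "Suc (3 * m) mod 3 = 1" "Suc (3 * m) div 3 = m" "Suc (Suc (3 * m)) mod 3 = 2" "Suc (Suc (3 * m)) div 3 = m" for m :: nat
    by presburger+
  then show ?thesis by (cases x) (auto simp: decode_def encode_def)
qed

definition sample_space :: "sample_point measure" where
  "sample_space = distr source (PiM UNIV (\<lambda>_. borel)) encode"

lemma measurable_encode: "encode \<in> measurable source (PiM UNIV (\<lambda>_. borel))"
proof (rule measurable_PiM_single')
  fix n :: nat
  have [measurable]: "(\<lambda>x. fst x a) \<in> measurable source (count_space UNIV)" "(\<lambda>x. fst (snd x) a) \<in> measurable source (count_space UNIV)" for a
    by measurable
  have [measurable]: "(\<lambda>x. snd (snd x) k) \<in> borel_measurable source" for k by measurable
  show "(\<lambda>x. encode x n) \<in> borel_measurable source"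
    unfolding encode_def case_prod_beta by measurable
qed (simp add: space_PiM)

lemma measurable_decode: "decode \<in> measurable (PiM UNIV (\<lambda>_. borel)) source"
  unfolding decode_def
  by (intro measurable_Pair measurable_coinsI measurable_PiM_single') (auto simp: space_PiM)

lemma prob_space_sample_space: "prob_space sample_space"
  unfolding sample_space_def
  by (rule prob_space.prob_space_distr[OF prob_space_source measurable_encode])

lemma measure_preserving_decode: "measure_preserving sample_space source decode"
proof -
  have "decode \<circ> encode = (\<lambda>x. x)" by (simp add: fun_eq_iff decode_encode)
  moreover have "distr source source (\<lambda>x. x) = source" by (rule distr_id2) simp
  ultimately have "distr sample_space source decode = source"
    unfolding sample_space_def by (subst distr_distr[OF measurable_decode measurable_encode]) simp
  then show ?thesis
    using measurable_decode by (simp add: measure_preserving_def sample_space_def)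
qed

text \<open>Each process is a function of its own coin array, and the joint law of the two arrays is
  the product measure.\<close>

lemma independent_processes_wiener:
  assumes M: "prob_space M" and \<phi>: "measure_preserving M source \<phi>"
  shows "independent_processes M (\<lambda>t \<omega>. wiener t (fst (\<phi> \<omega>))) (\<lambda>t \<omega>. wiener t (fst (snd (\<phi> \<omega>))))"
proof -
  interpret prob_space M by (rule M)
  let ?C = "coins :: (nat \<times> nat \<Rightarrow> bool) measure"
  note ps = prob_space_coins prob_space_uniforms prob_space_pair
  have "measure_preserving source ?C fst"
    by (intro measure_preserving_fst ps)
  moreover have "measure_preserving source ?C (\<lambda>x. fst (snd x))"
    by (rule measure_preserving_compose[OF measure_preserving_snd measure_preserving_fst]) (intro ps)+
  ultimately have mp: "measure_preserving M ?C (\<lambda>\<omega>. fst (\<phi> \<omega>))" "measure_preserving M ?C (\<lambda>\<omega>. fst (snd (\<phi> \<omega>)))"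
    using measure_preserving_compose[OF \<phi>] by blast+
  have "measure_preserving source (?C \<Otimes>\<^sub>M ?C) (\<lambda>(x, y). (x, fst y))"
    by (intro measure_preserving_prod measure_preserving_id measure_preserving_fst ps)
  from measure_preserving_compose[OF \<phi> this]
  have "measure_preserving M (?C \<Otimes>\<^sub>M ?C) (\<lambda>\<omega>. (fst (\<phi> \<omega>), fst (snd (\<phi> \<omega>))))"
    by (simp add: case_prod_beta)
  then have ind: "indep_var ?C (\<lambda>\<omega>. fst (\<phi> \<omega>)) ?C (\<lambda>\<omega>. fst (snd (\<phi> \<omega>)))"
    using mp unfolding indep_var_distribution_eq measure_preserving_def by simp
  have F: "(\<lambda>c. \<lambda>t\<in>{0..}. wiener t c) \<in> measurable ?C (PiM {0..} (\<lambda>_. borel))"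
    by (intro measurable_restrict measurable_wiener)
  from indep_var_compose[OF ind F F] show ?thesis
    unfolding independent_processes_def comp_def .
qed

section \<open>The clock of the limit\<close>

definition occupation :: "real set \<Rightarrow> (real \<Rightarrow> real) \<Rightarrow> real \<Rightarrow> real" where
  "occupation B w t = (LBINT s:{0..t}. indicator B (w s))"

lemma A2_occupation: "A2 \<gamma>\<^sub>1 \<gamma>\<^sub>2 w t = \<gamma>\<^sub>1 * occupation {0..} w t + \<gamma>\<^sub>2 * occupation {..<0} w t"
  by (simp add: A2_def occupation_def)

lemma set_integrable_indicator_path:
  fixes w :: "real \<Rightarrow> real"
  assumes w: "continuous_on {0..} w" and B: "B \<in> sets borel" and A: "A \<in> sets borel" "A \<subseteq> {0..t}"
  shows "set_integrable lborel A (\<lambda>s. indicator B (w s) :: real)"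
proof -
  have [measurable]: "(\<lambda>s. indicator {0..} s *\<^sub>R w s) \<in> borel_measurable borel"
    using w by (intro borel_measurable_continuous_on_indicator) auto
  note [measurable] = B A(1)
  have eq: "indicator A s *\<^sub>R (indicator B (w s) :: real) = indicator A s *\<^sub>R indicator B (indicator {0..} s *\<^sub>R w s)" for s
    using A(2) by (auto simp: indicator_def)
  have "integrable lborel (\<lambda>s. indicator A s *\<^sub>R (indicator B (indicator {0..} s *\<^sub>R w s) :: real))"
  proof (rule Bochner_Integration.integrable_bound)
    show "integrable lborel (indicator {0..t} :: real \<Rightarrow> real)"
      by (intro integrable_real_indicator) (auto simp: emeasure_lborel_Icc_eq)
    show "AE s in lborel. norm (indicator A s *\<^sub>R (indicator B (indicator {0..} s *\<^sub>R w s) :: real)) \<le> norm (indicator {0..t} s :: real)"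
      using A(2) by (intro AE_I2) (auto simp: indicator_def)
  qed measurable
  then show ?thesis unfolding set_integrable_def eq .
qed

lemma occupation_diff:
  assumes w: "continuous_on {0..} w" and B: "B \<in> sets borel" and st: "0 \<le> s" "s \<le> t"
  shows "occupation B w t - occupation B w s = (LBINT x:{s<..t}. indicator B (w x))"
proof -
  have "{0..t} = {0..s} \<union> {s<..t}" using st by auto
  then have "occupation B w t = (LBINT x:{0..s} \<union> {s<..t}. indicator B (w x))"
    by (simp only: occupation_def)
  also have "\<dots> = occupation B w s + (LBINT x:{s<..t}. indicator B (w x))"
    unfolding occupation_def using st
    by (intro set_integral_Un set_integrable_indicator_path[OF w B, where t = t]) auto
  finally show ?thesis by simp
qed

lemma occupation_diff_nonneg:
  assumes "continuous_on {0..} w" "B \<in> sets borel" "0 \<le> s" "s \<le> t"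
  shows "0 \<le> occupation B w t - occupation B w s"
  unfolding occupation_diff[OF assms] set_lebesgue_integral_def
  by (intro Bochner_Integration.integral_nonneg) (auto simp: indicator_def)

lemma occupation_diff_split:
  assumes w: "continuous_on {0..} w" and st: "0 \<le> s" "s \<le> t"
  shows "(occupation {0..} w t - occupation {0..} w s) + (occupation {..<0} w t - occupation {..<0} w s) = t - s"
proof -
  have "(occupation {0..} w t - occupation {0..} w s) + (occupation {..<0} w t - occupation {..<0} w s)
    = (LBINT x:{s<..t}. indicator {0..} (w x) + indicator {..<0} (w x))"
    using st by (simp add: occupation_diff[OF w _ st], intro set_integral_add(2)[symmetric] set_integrable_indicator_path[OF w, where t = t]) auto
  also have "\<dots> = (LBINT x:{s<..t}. 1)"
    by (intro set_lebesgue_integral_cong) (auto simp: indicator_def)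
  also have "\<dots> = t - s" using st by (simp add: set_lebesgue_integral_def)
  finally show ?thesis .
qed

lemma occupation_diff_const:
  assumes w: "continuous_on {0..} w" and B: "B \<in> sets borel" and st: "0 \<le> s" "s \<le> t"
    and "\<And>x. s < x \<Longrightarrow> x \<le> t \<Longrightarrow> w x \<notin> B"
  shows "occupation B w t - occupation B w s = 0"
proof -
  have "(LBINT x:{s<..t}. indicator B (w x)) = (LBINT x:{s<..t}. (0::real))"
    using assms(5) by (intro set_lebesgue_integral_cong) auto
  then show ?thesis unfolding occupation_diff[OF w B st] by (simp add: set_lebesgue_integral_def)
qed

context
  fixes \<gamma>\<^sub>1 \<gamma>\<^sub>2 :: real and w :: "real \<Rightarrow> real"
  assumes \<gamma>: "1 \<le> \<gamma>\<^sub>2" "\<gamma>\<^sub>2 < \<gamma>\<^sub>1" and w: "continuous_on {0..} w"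
begin

lemma A2_diff:
  assumes "0 \<le> s" "s \<le> t"
  shows "\<gamma>\<^sub>2 * (t - s) \<le> A2 \<gamma>\<^sub>1 \<gamma>\<^sub>2 w t - A2 \<gamma>\<^sub>1 \<gamma>\<^sub>2 w s"
    and "A2 \<gamma>\<^sub>1 \<gamma>\<^sub>2 w t - A2 \<gamma>\<^sub>1 \<gamma>\<^sub>2 w s \<le> \<gamma>\<^sub>1 * (t - s)"
proof -
  define a b where "a = occupation {0..} w t - occupation {0..} w s" and "b = occupation {..<0} w t - occupation {..<0} w s"
  have ab: "0 \<le> a" "0 \<le> b" "a + b = t - s"
    unfolding a_def b_def using occupation_diff_split[OF w assms]
    by (auto intro!: occupation_diff_nonneg[OF w _ assms, simplified])
  have eq: "A2 \<gamma>\<^sub>1 \<gamma>\<^sub>2 w t - A2 \<gamma>\<^sub>1 \<gamma>\<^sub>2 w s = \<gamma>\<^sub>1 * a + \<gamma>\<^sub>2 * b"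
    by (simp add: A2_occupation a_def b_def algebra_simps)
  have "\<gamma>\<^sub>2 * a \<le> \<gamma>\<^sub>1 * a" "\<gamma>\<^sub>2 * b \<le> \<gamma>\<^sub>1 * b" using ab \<gamma> by (auto intro!: mult_right_mono)
  then show "\<gamma>\<^sub>2 * (t - s) \<le> A2 \<gamma>\<^sub>1 \<gamma>\<^sub>2 w t - A2 \<gamma>\<^sub>1 \<gamma>\<^sub>2 w s"
    "A2 \<gamma>\<^sub>1 \<gamma>\<^sub>2 w t - A2 \<gamma>\<^sub>1 \<gamma>\<^sub>2 w s \<le> \<gamma>\<^sub>1 * (t - s)"
    unfolding eq ab(3)[symmetric] by (simp_all add: distrib_left)
qed

text \<open>Both rates are at least 1. An error in the value of \<open>A2\<close> therefore bounds
  the error in time, which is how closeness of the clocks passes to \<open>A2_inv\<close>.\<close>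

lemma A2_expanding:
  assumes "0 \<le> s" "0 \<le> t"
  shows "\<bar>t - s\<bar> \<le> \<bar>A2 \<gamma>\<^sub>1 \<gamma>\<^sub>2 w t - A2 \<gamma>\<^sub>1 \<gamma>\<^sub>2 w s\<bar>"
proof -
  have "t - s \<le> A2 \<gamma>\<^sub>1 \<gamma>\<^sub>2 w t - A2 \<gamma>\<^sub>1 \<gamma>\<^sub>2 w s" if "0 \<le> s" "s \<le> t" for s t
  proof -
    have "1 * (t - s) \<le> \<gamma>\<^sub>2 * (t - s)" using \<gamma> that by (intro mult_right_mono) auto
    then show ?thesis using A2_diff(1)[OF that] by simp
  qed
  from this[of s t] this[of t s] assms show ?thesis by (cases "s \<le> t") auto
qed

lemma A2_0: "A2 \<gamma>\<^sub>1 \<gamma>\<^sub>2 w 0 = 0"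
proof -
  have "occupation B w 0 = 0" if "B \<in> sets borel" for B
  proof -
    have "(\<lambda>s. indicator {0..0} s *\<^sub>R (indicator B (w s) :: real)) = (\<lambda>s. indicator B (w 0) *\<^sub>R indicator {0} s)"
      by (auto simp: indicator_def)
    then show ?thesis by (simp add: occupation_def set_lebesgue_integral_def)
  qed
  then show ?thesis by (simp add: A2_occupation)
qed

text \<open>\<open>A2\<close> is Lipschitz, vanishes at 0 and is at least \<open>N\<close> at time
  \<open>N\<close>, so the intermediate value theorem yields a preimage in \<open>{0..N}\<close>;
  expansion makes it unique and so identifies the value of \<open>inv_into\<close>.\<close>

lemma A2_inv:
  assumes N: "0 \<le> N"
  shows "0 \<le> A2_inv \<gamma>\<^sub>1 \<gamma>\<^sub>2 w N" "A2_inv \<gamma>\<^sub>1 \<gamma>\<^sub>2 w N \<le> N" "A2 \<gamma>\<^sub>1 \<gamma>\<^sub>2 w (A2_inv \<gamma>\<^sub>1 \<gamma>\<^sub>2 w N) = N"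
proof -
  let ?A = "A2 \<gamma>\<^sub>1 \<gamma>\<^sub>2 w"
  have "\<gamma>\<^sub>1-lipschitz_on {0..N} ?A"
  proof (rule lipschitz_onI)
    fix s t assume st: "s \<in> {0..N}" "t \<in> {0..N}"
    have *: "\<bar>?A t - ?A s\<bar> \<le> \<gamma>\<^sub>1 * \<bar>t - s\<bar>" if "0 \<le> s" "s \<le> t" for s t
    proof -
      have "0 \<le> \<gamma>\<^sub>2 * (t - s)" using \<gamma> that by simp
      then show ?thesis using A2_diff[OF that] that by simp
    qed
    show "dist (?A s) (?A t) \<le> \<gamma>\<^sub>1 * dist s t"
      using *[of s t] *[of t s] st by (cases "s \<le> t") (auto simp: dist_real_def abs_minus_commute)
  qed (use \<gamma> in simp)
  then have cont: "continuous_on {0..N} ?A" by (rule lipschitz_on_continuous_on)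
  have "N \<le> ?A N"
    using A2_diff(1)[of 0 N] mult_right_mono[OF \<gamma>(1) N] N by (simp add: A2_0)
  then obtain a where a: "0 \<le> a" "a \<le> N" "?A a = N"
    using IVT'[of ?A 0 N N] cont N by (auto simp: A2_0)
  have "inj_on ?A {0..}"
    using A2_expanding by (intro inj_onI) fastforce
  then have "A2_inv \<gamma>\<^sub>1 \<gamma>\<^sub>2 w N = a"
    unfolding A2_inv_def using a by (metis atLeast_iff inv_into_f_f)
  then show "0 \<le> A2_inv \<gamma>\<^sub>1 \<gamma>\<^sub>2 w N" "A2_inv \<gamma>\<^sub>1 \<gamma>\<^sub>2 w N \<le> N" "A2 \<gamma>\<^sub>1 \<gamma>\<^sub>2 w (A2_inv \<gamma>\<^sub>1 \<gamma>\<^sub>2 w N) = N"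
    using a by auto
qed

text \<open>If \<open>\<bar>S k\<bar> > r\<close>, the path keeps the sign of \<open>S k\<close> for
  one unit of time after \<open>k\<close>, and \<open>A2\<close> gains exactly the rate that appears
  in the sum. Only steps within the strip err, each by at most
  \<open>\<gamma>\<^sub>1 - \<gamma>\<^sub>2\<close>.\<close>

lemma A2_discretisation:
  fixes S :: "nat \<Rightarrow> int" and r :: nat
  assumes near: "\<And>k s. k < v \<Longrightarrow> real k \<le> s \<Longrightarrow> s \<le> real k + 1 \<Longrightarrow> \<bar>w s - real_of_int (S k)\<bar> \<le> real r"
  shows "\<bar>A2 \<gamma>\<^sub>1 \<gamma>\<^sub>2 w (real v) - (\<Sum>k<v. if 0 \<le> S k then \<gamma>\<^sub>1 else \<gamma>\<^sub>2)\<bar>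
    \<le> (\<gamma>\<^sub>1 - \<gamma>\<^sub>2) * (\<Sum>k<v. of_bool (\<bar>S k\<bar> \<le> int r))"
  using near
proof (induction v)
  case 0 show ?case by (simp add: A2_0)
next
  case (Suc v)
  let ?A = "A2 \<gamma>\<^sub>1 \<gamma>\<^sub>2 w"
  define d where "d = ?A (real (Suc v)) - ?A (real v) - (if 0 \<le> S v then \<gamma>\<^sub>1 else \<gamma>\<^sub>2)"
  have near: "\<bar>w s - real_of_int (S v)\<bar> \<le> real r" if "real v \<le> s" "s \<le> real v + 1" for s
    using Suc.prems[of v s] that by simp
  have d: "\<bar>d\<bar> \<le> (\<gamma>\<^sub>1 - \<gamma>\<^sub>2) * of_bool (\<bar>S v\<bar> \<le> int r)"
  proof (cases "\<bar>S v\<bar> \<le> int r")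
    case True
    have "\<gamma>\<^sub>2 \<le> ?A (real (Suc v)) - ?A (real v)" "?A (real (Suc v)) - ?A (real v) \<le> \<gamma>\<^sub>1"
      using A2_diff[of "real v" "real (Suc v)"] by auto
    then show ?thesis using True \<gamma> by (auto simp: d_def)
  next
    case False
    let ?a = "\<lambda>B. occupation B w (real v + 1) - occupation B w (real v)"
    have split: "?a {0..} + ?a {..<0} = 1"
      using occupation_diff_split[OF w, of "real v" "real v + 1"] by simp
    have A: "?A (real (Suc v)) - ?A (real v) = \<gamma>\<^sub>1 * ?a {0..} + \<gamma>\<^sub>2 * ?a {..<0}"
      by (simp add: A2_occupation algebra_simps)
    have "d = 0"
    proof (cases "0 \<le> S v")
      case pos: True
      have "?a {..<0} = 0"
      proof (rule occupation_diff_const[OF w])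
        fix x assume "real v < x" "x \<le> real v + 1"
        with near[of x] have "\<bar>w x - real_of_int (S v)\<bar> \<le> real r" by simp
        moreover have "real r < real_of_int (S v)" using False pos by linarith
        ultimately show "w x \<notin> {..<0}" by auto
      qed auto
      then show ?thesis using split A pos by (simp add: d_def)
    next
      case neg: False
      have "?a {0..} = 0"
      proof (rule occupation_diff_const[OF w])
        fix x assume "real v < x" "x \<le> real v + 1"
        with near[of x] have "\<bar>w x - real_of_int (S v)\<bar> \<le> real r" by simp
        moreover have "real_of_int (S v) < - real r" using False neg by linarith
        ultimately show "w x \<notin> {0..}" by auto
      qed auto
      then show ?thesis using split A neg by (simp add: d_def)
    qed
    then show ?thesis using \<gamma> by simp
  qed
  have "\<bar>?A (real v) - (\<Sum>k<v. if 0 \<le> S k then \<gamma>\<^sub>1 else \<gamma>\<^sub>2)\<bar> \<le> (\<gamma>\<^sub>1 - \<gamma>\<^sub>2) * (\<Sum>k<v. of_bool (\<bar>S k\<bar> \<le> int r))"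
    using Suc.prems by (intro Suc.IH) auto
  moreover have "?A (real (Suc v)) - (\<Sum>k<Suc v. if 0 \<le> S k then \<gamma>\<^sub>1 else \<gamma>\<^sub>2) =
      (?A (real v) - (\<Sum>k<v. if 0 \<le> S k then \<gamma>\<^sub>1 else \<gamma>\<^sub>2)) + d"
    by (simp add: d_def)
  moreover have "(\<gamma>\<^sub>1 - \<gamma>\<^sub>2) * (\<Sum>k<Suc v. of_bool (\<bar>S k\<bar> \<le> int r)) =
      (\<gamma>\<^sub>1 - \<gamma>\<^sub>2) * (\<Sum>k<v. of_bool (\<bar>S k\<bar> \<le> int r)) + (\<gamma>\<^sub>1 - \<gamma>\<^sub>2) * of_bool (\<bar>S v\<bar> \<le> int r)"
    by (simp add: distrib_left)
  ultimately show ?case using d by linarith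
qed

end

section \<open>Strong approximation\<close>

text \<open>The first term is the increment of the walk over the time gap, with \<open>+ 1\<close>
  for rounding \<open>t\<close> down; the second is the distance between walk and Wiener path at
  time \<open>t\<close>.\<close>

lemma walk_wiener_close:
  assumes T: "tame \<delta> n\<^sub>0 c" and \<delta>: "0 < \<delta>" "\<delta> \<le> 1/16" and n: "n\<^sub>0 \<le> n" "1 \<le> n"
    and m: "m \<le> n" and t: "0 \<le> t" "t \<le> real n" and E: "\<bar>real m - t\<bar> \<le> E"
  shows "\<bar>real_of_int (walk (coin_row 0 c) m) - wiener t c\<bar>
    \<le> real n powr \<delta> * sqrt (E + 1) + 2 * rate \<delta> n\<^sub>0 * real n powr (1/4 + 2 * \<delta>)"
proof -
  define k where "k = nat \<lfloor>t\<rfloor>"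
  have k: "real k \<le> t" "t < real k + 1" using t by (simp_all add: k_def)
  have "k \<le> n" using k t by linarith
  then have "\<bar>real_of_int (walk (coin_row 0 c) m) - real_of_int (walk (coin_row 0 c) k)\<bar> \<le> real n powr \<delta> * sqrt \<bar>real m - real k\<bar>"
    using tameD[OF T n(1), of 0 0 m k] m by simp
  also have "\<dots> \<le> real n powr \<delta> * sqrt (E + 1)"
    using k E by (intro mult_left_mono real_sqrt_le_mono) auto
  finally have "\<bar>real_of_int (walk (coin_row 0 c) m) - real_of_int (walk (coin_row 0 c) k)\<bar> \<le> real n powr \<delta> * sqrt (E + 1)" .
  moreover have "\<bar>wiener t c - real_of_int (walk (coin_row 0 c) k)\<bar> \<le> rate \<delta> n\<^sub>0 * (t + 1) powr (1/4 + 2 * \<delta>)"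
    unfolding k_def by (rule wiener_walk[OF T \<delta> t(1)])
  moreover have "rate \<delta> n\<^sub>0 * (t + 1) powr (1/4 + 2 * \<delta>) \<le> rate \<delta> n\<^sub>0 * (2 * real n powr (1/4 + 2 * \<delta>))"
  proof (intro mult_left_mono rate_nonneg)
    have "(t + 1) powr (1/4 + 2 * \<delta>) \<le> (2 * real n) powr (1/4 + 2 * \<delta>)"
      using t n \<delta> by (intro powr_mono2) auto
    also have "\<dots> = 2 powr (1/4 + 2 * \<delta>) * real n powr (1/4 + 2 * \<delta>)" by (simp add: powr_mult)
    also have "\<dots> \<le> 2 powr 1 * real n powr (1/4 + 2 * \<delta>)"
      using \<delta> by (intro mult_right_mono powr_mono) auto
    finally show "(t + 1) powr (1/4 + 2 * \<delta>) \<le> 2 * real n powr (1/4 + 2 * \<delta>)" by simp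
  qed
  ultimately show ?thesis by linarith
qed

section \<open>Comparing the clock of the anisotropic walk with the limit clock\<close>

locale environment =
  fixes p :: "int \<Rightarrow> real" and \<gamma>\<^sub>1 \<gamma>\<^sub>2 \<tau> :: real
  assumes p: "\<And>j. 0 < p j" "\<And>j. p j \<le> 1 / 2"
    and \<gamma>: "1 \<le> \<gamma>\<^sub>2" "\<gamma>\<^sub>2 < \<gamma>\<^sub>1"
    and \<tau>: "1 / 2 < \<tau>" "\<tau> \<le> 1"
    and right: "(\<lambda>n::nat. (\<Sum>j=1..n. 1 / p (int j)) / real n - 2 * \<gamma>\<^sub>1) \<in> o(\<lambda>n. real n powr (- \<tau>))"
    and left: "(\<lambda>n::nat. (\<Sum>j=1..n. 1 / p (- int j)) / real n - 2 * \<gamma>\<^sub>2) \<in> o(\<lambda>n. real n powr (- \<tau>))"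
begin

definition wait :: "int \<Rightarrow> real" where "wait j = 1 / (2 * p j)"

definition drift :: "int \<Rightarrow> real" where "drift j = (if 0 \<le> j then \<gamma>\<^sub>1 else \<gamma>\<^sub>2)"

text \<open>On each side the primitive is a centred partial sum from the hypotheses. Row 0 belongs
  to neither of these sums but enters for positive \<open>j\<close>; it accounts for the summand
  \<open>\<bar>?f 0\<bar>\<close> of the constant.\<close>

lemma antidiff_fluctuation:
  "\<exists>K>0. \<forall>j. \<bar>antidiff (\<lambda>j. wait j - drift j) j\<bar> \<le> K * (1 + \<bar>real_of_int j\<bar>) powr (1 - \<tau>)"
proof -
  obtain K1 where K1: "0 < K1" "\<And>n. \<bar>\<Sum>j=1..n. 1 / p (int j) / 2 - \<gamma>\<^sub>1\<bar> \<le> K1 * (1 + real n) powr (1 - \<tau>)"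
    using centred_partial_sums[OF right \<tau>(2)] by auto
  obtain K2 where K2: "0 < K2" "\<And>n. \<bar>\<Sum>j=1..n. 1 / p (- int j) / 2 - \<gamma>\<^sub>2\<bar> \<le> K2 * (1 + real n) powr (1 - \<tau>)"
    using centred_partial_sums[OF left \<tau>(2)] by auto
  let ?f = "\<lambda>j. wait j - drift j"
  define K where "K = \<bar>?f 0\<bar> + K1 + K2"
  have "\<bar>antidiff ?f j\<bar> \<le> K * (1 + \<bar>real_of_int j\<bar>) powr (1 - \<tau>)" for j
  proof -
    let ?P = "(1 + \<bar>real_of_int j\<bar>) powr (1 - \<tau>)"
    have P1: "1 \<le> ?P" using \<tau> by (intro ge_one_powr_ge_zero) auto
    consider "j = 0" | "0 < j" | "j < 0" by linarith
    then show ?thesis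
    proof cases
      case 1
      then show ?thesis using K1(1) K2(1) by (simp add: antidiff_def K_def)
    next
      case 2
      define n where "n = nat j - 1"
      have n: "j = int n + 1" using 2 by (simp add: n_def)
      have "{0..<j} = insert 0 {1..<j}" using 2 by auto
      then have "antidiff ?f j = ?f 0 + sum ?f {1..<j}" using 2 by (simp add: antidiff_def)
      also have "sum ?f {1..<j} = (\<Sum>i=1..n. 1 / p (int i) / 2 - \<gamma>\<^sub>1)"
        by (rule sum.reindex_bij_witness[where i = int and j = nat]) (auto simp: n wait_def drift_def)
      finally have "\<bar>antidiff ?f j\<bar> \<le> \<bar>?f 0\<bar> + K1 * (1 + real n) powr (1 - \<tau>)"
        using K1(2)[of n] by linarith
      also have "\<dots> \<le> \<bar>?f 0\<bar> * ?P + K1 * ?P"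
        using P1 K1(1) \<tau> n mult_left_mono[OF P1, of "\<bar>?f 0\<bar>"]
        by (intro add_mono mult_left_mono powr_mono2) auto
      also have "\<dots> \<le> K * ?P" using K2(1) P1 by (simp add: K_def algebra_simps)
      finally show ?thesis .
    next
      case 3
      define n where "n = nat (- j)"
      have n: "j = - int n" using 3 by (simp add: n_def)
      have "antidiff ?f j = - sum ?f {j..<0}" using 3 by (simp add: antidiff_def)
      also have "sum ?f {j..<0} = (\<Sum>i=1..n. 1 / p (- int i) / 2 - \<gamma>\<^sub>2)"
        by (rule sum.reindex_bij_witness[where i = "\<lambda>i. - int i" and j = "\<lambda>j. nat (- j)"]) (auto simp: n wait_def drift_def)
      finally have "\<bar>antidiff ?f j\<bar> \<le> K2 * ?P"
        using K2(2)[of n] by (simp add: n)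
      also have "\<dots> \<le> K * ?P" using K1(1) P1 by (intro mult_right_mono) (auto simp: K_def)
      finally show ?thesis .
    qed
  qed
  moreover have "0 < K" using K1(1) K2(1) by (simp add: K_def)
  ultimately show ?thesis by blast
qed

definition K where
  "K = (SOME K. 0 < K \<and> (\<forall>j. \<bar>antidiff (\<lambda>j. wait j - drift j) j\<bar> \<le> K * (1 + \<bar>real_of_int j\<bar>) powr (1 - \<tau>)))"

lemma K: "0 < K" "\<bar>antidiff (\<lambda>j. wait j - drift j) j\<bar> \<le> K * (1 + \<bar>real_of_int j\<bar>) powr (1 - \<tau>)"
  using someI_ex[OF antidiff_fluctuation] unfolding K_def by auto

text \<open>A single waiting time is recovered as a difference of two consecutive values of the
  primitive, so the hypotheses on averages already limit its growth. This bounds the martingale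
  jumps of the clock.\<close>

lemma wait_bound:
  assumes "\<bar>j\<bar> \<le> int n"
  shows "wait j \<le> (2 * K + \<gamma>\<^sub>1) * (2 + real n) powr (1 - \<tau>)"
proof -
  let ?f = "\<lambda>j. wait j - drift j" and ?P = "(2 + real n) powr (1 - \<tau>)"
  have le: "\<bar>real_of_int j\<bar> \<le> real n" using assms by linarith
  have "\<bar>antidiff ?f j\<bar> \<le> K * ?P" "\<bar>antidiff ?f (j + 1)\<bar> \<le> K * ?P"
    using le \<tau> K(1) by (auto intro!: order_trans[OF K(2)] mult_left_mono powr_mono2)
  then have "?f j \<le> 2 * (K * ?P)" using antidiff_step[of ?f j] by linarith
  moreover have "drift j \<le> \<gamma>\<^sub>1 * 1" using \<gamma> by (simp add: drift_def)
  moreover have "\<gamma>\<^sub>1 * 1 \<le> \<gamma>\<^sub>1 * ?P"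
    using \<gamma> \<tau> by (intro mult_left_mono ge_one_powr_ge_zero) auto
  ultimately show ?thesis by (simp add: algebra_simps)
qed

text \<open>The error splits into the compensated waiting times (\<open>p1\<close>), the replacement
  of waiting times by their mean on each side (\<open>p2\<close>), and the passage from a sum over
  steps to an integral along the Wiener path (\<open>p4\<close>, through the visits counted in
  \<open>p3\<close>). Each is at most a constant times \<open>L\<close>.\<close>

lemma time_error:
  fixes c :: "nat \<times> nat \<Rightarrow> bool" and u :: "nat \<Rightarrow> real"
  defines "S \<equiv> walk (coin_row 0 c)"
  assumes T: "tame \<delta> n\<^sub>0 c" and \<delta>: "0 < \<delta>" "\<delta> \<le> 1/16"
    and V: "\<forall>\<^sub>F n in sequentially. \<bar>real n - (\<Sum>k<vert p S u n. wait (S k))\<bar>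
      \<le> real n powr \<delta> * (sqrt (real n) * ((2 * K + \<gamma>\<^sub>1) * (2 + real n) powr (1 - \<tau>)))"
    and A: "\<forall>\<^sub>F n in sequentially. \<forall>m\<le>n. \<bar>\<Sum>k<m. wait (S k) - drift (S k)\<bar>
      \<le> 2 * K * (2 + \<bar>real_of_int (S m)\<bar>) powr (1 + (1 - \<tau>)) + real n powr \<delta> * (sqrt (real n) * (2 * K * (2 + real n) powr (1 - \<tau>)))"
    and Z: "\<forall>\<^sub>F n in sequentially. \<forall>r\<le>n. \<forall>m\<le>n. (\<Sum>k<m. of_bool (\<bar>S k\<bar> \<le> int r))
      \<le> 2 * (2 * real r + 1) * (\<bar>real_of_int (S m)\<bar> + real n powr \<delta> * sqrt (real n))"
  shows "\<exists>C\<ge>0. \<forall>\<^sub>F n in sequentially. \<bar>A2 \<gamma>\<^sub>1 \<gamma>\<^sub>2 (\<lambda>s. wiener s c) (real (vert p S u n)) - real n\<bar>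
    \<le> C * real n powr (5/4 - \<tau>/2 + 3 * \<delta>)"
proof -
  define R where "R = rate \<delta> n\<^sub>0 + 1"
  have R: "0 < R" "rate \<delta> n\<^sub>0 \<le> R" using rate_nonneg[of \<delta> n\<^sub>0] by (simp_all add: R_def)
  \<comment> \<open>Up to time \<open>n\<close> the path stays within
    \<open>2 * R * n powr (1/4 + 2 * \<delta>)\<close> of the walk at the rounded-down time; the
    extra 1 pays for the step from \<open>k\<close> to \<open>k + 1\<close>.\<close>
  define r where "r n = nat \<lceil>2 * R * real n powr (1/4 + 2 * \<delta>)\<rceil> + 1" for n :: nat
  have w: "continuous_on {0..} (\<lambda>s. wiener s c)" by (rule continuous_wiener[OF T \<delta>])
  \<comment> \<open>The constants of \<open>p1\<close>, \<open>p2\<close> and \<open>p4\<close>, in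
    this order.\<close>
  define C where "C = 3 * (2 * K + \<gamma>\<^sub>1) + 24 * K + (\<gamma>\<^sub>1 - \<gamma>\<^sub>2) * (4 * (4 * R + 5))"
  have C0: "0 \<le> C" using K(1) \<gamma> R by (simp add: C_def)
  \<comment> \<open>\<open>3/8\<close> is \<open>1/4 + 2 * \<delta>\<close> for the largest
    admissible \<open>\<delta>\<close>. The aim is \<open>r n \<le> n\<close>, the range in which
    the visit estimate holds.\<close>
  have r_small: "\<forall>\<^sub>F n in sequentially. 2 * R * real n powr (3/8) + 2 \<le> real n"
    using R(1) by real_asymp
  have "\<forall>\<^sub>F n in sequentially. \<bar>A2 \<gamma>\<^sub>1 \<gamma>\<^sub>2 (\<lambda>s. wiener s c) (real (vert p S u n)) - real n\<bar>
    \<le> C * real n powr (5/4 - \<tau>/2 + 3 * \<delta>)"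
    using V A Z r_small eventually_ge_at_top[of n\<^sub>0] eventually_ge_at_top[of 1]
  proof eventually_elim
    case (elim n)
    define v where "v = vert p S u n"
    define L where "L = real n powr (5/4 - \<tau>/2 + 3 * \<delta>)"
    have vn: "v \<le> n" by (simp add: v_def vert_le)
    have n1: "1 \<le> real n" using elim by simp
    have powr_le: "real n powr a \<le> L" if "a \<le> 5/4 - \<tau>/2 + 3 * \<delta>" for a
      unfolding L_def using that n1 by (intro powr_mono) auto
    have sq: "real n powr \<delta> * sqrt (real n) = real n powr (1/2 + \<delta>)"
      by (simp add: powr_half_sqrt[symmetric] powr_add)
    have Sm: "\<bar>real_of_int (S m)\<bar> \<le> real n powr (1/2 + \<delta>)" if "m \<le> n" for m
    proof -
      have "\<bar>real_of_int (S m)\<bar> \<le> real n powr \<delta> * sqrt (real m)"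
        using tameD[OF T, of n 0 0 m 0] that elim by (simp add: S_def walk_def)
      also have "\<dots> \<le> real n powr \<delta> * sqrt (real n)"
        using that by (intro mult_left_mono) auto
      finally show ?thesis by (simp only: sq)
    qed
    have pow: "(2 + real n) powr (1 - \<tau>) \<le> 3 * real n powr (1 - \<tau>)"
    proof -
      have "(2 + real n) powr (1 - \<tau>) \<le> (3 * real n) powr (1 - \<tau>)"
        using n1 \<tau> by (intro powr_mono2) auto
      also have "\<dots> = 3 powr (1 - \<tau>) * real n powr (1 - \<tau>)" by (simp add: powr_mult)
      also have "\<dots> \<le> 3 powr 1 * real n powr (1 - \<tau>)" using \<tau> by (intro mult_right_mono powr_mono) auto
      finally show ?thesis by simp
    qed
    have pow2: "real n powr \<delta> * (sqrt (real n) * (2 + real n) powr (1 - \<tau>)) \<le> 3 * L"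
    proof -
      have "real n powr \<delta> * (sqrt (real n) * (2 + real n) powr (1 - \<tau>)) = real n powr (1/2 + \<delta>) * (2 + real n) powr (1 - \<tau>)"
        by (simp add: sq[symmetric])
      also have "\<dots> \<le> real n powr (1/2 + \<delta>) * (3 * real n powr (1 - \<tau>))"
        by (intro mult_left_mono pow) simp
      also have "\<dots> = 3 * real n powr (1/2 + \<delta> + (1 - \<tau>))"
        by (simp only: powr_add mult_ac)
      \<comment> \<open>The comparison \<open>3/2 - \<tau> \<le> 5/4 - \<tau>/2\<close> of the main
        exponents rests on \<open>1/2 < \<tau>\<close>.\<close>
      also have "\<dots> \<le> 3 * L" using \<tau> \<delta> by (intro mult_left_mono powr_le) auto
      finally show ?thesis .
    qed
    have p1: "\<bar>real n - (\<Sum>k<v. wait (S k))\<bar> \<le> 3 * (2 * K + \<gamma>\<^sub>1) * L"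
    proof -
      have "\<bar>real n - (\<Sum>k<v. wait (S k))\<bar> \<le> (2 * K + \<gamma>\<^sub>1) * (real n powr \<delta> * (sqrt (real n) * (2 + real n) powr (1 - \<tau>)))"
        using elim(1) by (simp add: v_def mult_ac)
      also have "\<dots> \<le> (2 * K + \<gamma>\<^sub>1) * (3 * L)" using K(1) \<gamma> by (intro mult_left_mono pow2) auto
      finally show ?thesis by (simp add: mult_ac)
    qed
    \<comment> \<open>Boundary term and martingale together:
      \<open>24 = 2 * 9 + 2 * 3\<close>.\<close>
    have p2: "\<bar>\<Sum>k<v. wait (S k) - drift (S k)\<bar> \<le> 24 * K * L"
    proof -
      have "(2 + \<bar>real_of_int (S v)\<bar>) powr (2 - \<tau>) \<le> (3 * real n powr (1/2 + \<delta>)) powr (2 - \<tau>)"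
      proof (intro powr_mono2)
        have "1 \<le> real n powr (1/2 + \<delta>)" using n1 \<delta> by (intro ge_one_powr_ge_zero) auto
        then show "2 + \<bar>real_of_int (S v)\<bar> \<le> 3 * real n powr (1/2 + \<delta>)" using Sm[OF vn] by simp
      qed (use \<tau> in auto)
      also have "\<dots> = 3 powr (2 - \<tau>) * real n powr ((1/2 + \<delta>) * (2 - \<tau>))" by (simp add: powr_mult powr_powr)
      also have "\<dots> \<le> 3 powr 2 * L"
      proof (intro mult_mono powr_mono powr_le)
        have "\<delta> * (2 - \<tau>) \<le> \<delta> * 2" using \<delta> \<tau> by (intro mult_left_mono) auto
        moreover have "(1/2 + \<delta>) * (2 - \<tau>) = 1 - \<tau>/2 + \<delta> * (2 - \<tau>)" by (simp add: field_simps)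
        ultimately show "(1/2 + \<delta>) * (2 - \<tau>) \<le> 5/4 - \<tau>/2 + 3 * \<delta>" using \<delta> by linarith
      qed (use \<tau> in auto)
      finally have "(2 + \<bar>real_of_int (S v)\<bar>) powr (2 - \<tau>) \<le> 9 * L" by (simp add: powr_numeral)
      then have "2 * K * (2 + \<bar>real_of_int (S v)\<bar>) powr (2 - \<tau>) \<le> 2 * K * (9 * L)"
        using K(1) by (intro mult_left_mono) auto
      moreover have "2 * K * (real n powr \<delta> * (sqrt (real n) * (2 + real n) powr (1 - \<tau>))) \<le> 2 * K * (3 * L)"
        using K(1) by (intro mult_left_mono pow2) auto
      moreover have "\<bar>\<Sum>k<v. wait (S k) - drift (S k)\<bar> \<le> 2 * K * (2 + \<bar>real_of_int (S v)\<bar>) powr (2 - \<tau>)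
          + 2 * K * (real n powr \<delta> * (sqrt (real n) * (2 + real n) powr (1 - \<tau>)))"
        using elim(2) vn by (auto simp: mult_ac)
      ultimately show ?thesis by (simp add: algebra_simps)
    qed
    have r_le: "real (r n) \<le> 2 * R * real n powr (1/4 + 2 * \<delta>) + 2" "2 * R * real n powr (1/4 + 2 * \<delta>) + 1 \<le> real (r n)"
    proof -
      have "0 \<le> 2 * R * real n powr (1/4 + 2 * \<delta>)" using R by simp
      then show "real (r n) \<le> 2 * R * real n powr (1/4 + 2 * \<delta>) + 2" "2 * R * real n powr (1/4 + 2 * \<delta>) + 1 \<le> real (r n)"
        unfolding r_def by linarith+
    qed
    have "r n \<le> n"
    proof -
      have "2 * R * real n powr (1/4 + 2 * \<delta>) \<le> 2 * R * real n powr (3/8)"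
        using R \<delta> n1 by (intro mult_left_mono powr_mono) auto
      then have "real (r n) \<le> real n" using r_le(1) elim(4) by linarith
      then show ?thesis by simp
    qed
    have p3: "(\<Sum>k<v. of_bool (\<bar>S k\<bar> \<le> int (r n))) \<le> 4 * (4 * R + 5) * L"
    proof -
      have "1 \<le> real n powr (1/4 + 2 * \<delta>)" using n1 \<delta> by (intro ge_one_powr_ge_zero) auto
      then have "2 * real (r n) + 1 \<le> (4 * R + 5) * real n powr (1/4 + 2 * \<delta>)"
        using r_le(1) by (simp add: algebra_simps)
      then have "2 * (2 * real (r n) + 1) * (\<bar>real_of_int (S v)\<bar> + real n powr (1/2 + \<delta>))
        \<le> 2 * ((4 * R + 5) * real n powr (1/4 + 2 * \<delta>)) * (2 * real n powr (1/2 + \<delta>))"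
        using Sm[OF vn] R by (intro mult_mono) auto
      also have "\<dots> = 4 * (4 * R + 5) * real n powr ((1/4 + 2 * \<delta>) + (1/2 + \<delta>))"
        by (simp only: powr_add)
      \<comment> \<open>The comparison \<open>3/4 \<le> 5/4 - \<tau>/2\<close> rests on
        \<open>\<tau> \<le> 1\<close>.\<close>
      also have "\<dots> \<le> 4 * (4 * R + 5) * L"
        using R \<tau> by (intro mult_left_mono powr_le) auto
      finally show ?thesis using elim(3) vn \<open>r n \<le> n\<close> unfolding sq by fastforce
    qed
    have near: "\<bar>wiener s c - real_of_int (S k)\<bar> \<le> real (r n)" if k: "k < v" "real k \<le> s" "s \<le> real k + 1" for k s
    proof -
      have kn: "real k + 1 \<le> real n" using k vn by linarith
      define l where "l = nat \<lfloor>s\<rfloor>"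
      have "real l \<le> s" "s < real l + 1" using k by (simp_all add: l_def)
      then have "l = k \<or> l = k + 1" using k by linarith
      then have "\<bar>real_of_int (S l) - real_of_int (S k)\<bar> \<le> 1"
        using abs_walk_diff_le[of "coin_row 0 c" k 1] by (auto simp: S_def)
      moreover have "\<bar>wiener s c - real_of_int (S l)\<bar> \<le> rate \<delta> n\<^sub>0 * (s + 1) powr (1/4 + 2 * \<delta>)"
        unfolding l_def S_def using k by (intro wiener_walk[OF T \<delta>]) auto
      moreover have "rate \<delta> n\<^sub>0 * (s + 1) powr (1/4 + 2 * \<delta>) \<le> R * (2 * real n powr (1/4 + 2 * \<delta>))"
      proof (intro mult_mono R)
        have "(s + 1) powr (1/4 + 2 * \<delta>) \<le> (2 * real n) powr (1/4 + 2 * \<delta>)"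
          using k kn n1 \<delta> by (intro powr_mono2) auto
        also have "\<dots> = 2 powr (1/4 + 2 * \<delta>) * real n powr (1/4 + 2 * \<delta>)" by (simp add: powr_mult)
        also have "\<dots> \<le> 2 powr 1 * real n powr (1/4 + 2 * \<delta>)"
          using \<delta> by (intro mult_right_mono powr_mono) auto
        finally show "(s + 1) powr (1/4 + 2 * \<delta>) \<le> 2 * real n powr (1/4 + 2 * \<delta>)" by simp
      qed (use R in auto)
      ultimately show ?thesis using r_le(2) by (simp add: algebra_simps)
    qed
    have "\<bar>A2 \<gamma>\<^sub>1 \<gamma>\<^sub>2 (\<lambda>s. wiener s c) (real v) - (\<Sum>k<v. drift (S k))\<bar> \<le> (\<gamma>\<^sub>1 - \<gamma>\<^sub>2) * (\<Sum>k<v. of_bool (\<bar>S k\<bar> \<le> int (r n)))"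
      unfolding drift_def by (rule A2_discretisation[OF \<gamma> w]) (rule near)
    also have "\<dots> \<le> (\<gamma>\<^sub>1 - \<gamma>\<^sub>2) * (4 * (4 * R + 5) * L)"
      using \<gamma> by (intro mult_left_mono p3) auto
    finally have p4: "\<bar>A2 \<gamma>\<^sub>1 \<gamma>\<^sub>2 (\<lambda>s. wiener s c) (real v) - (\<Sum>k<v. drift (S k))\<bar> \<le> (\<gamma>\<^sub>1 - \<gamma>\<^sub>2) * (4 * (4 * R + 5)) * L"
      by (simp add: mult_ac)
    have "C * L = 3 * (2 * K + \<gamma>\<^sub>1) * L + 24 * K * L + (\<gamma>\<^sub>1 - \<gamma>\<^sub>2) * (4 * (4 * R + 5)) * L"
      by (simp add: C_def distrib_right)
    then show ?case
      using p1 p2 p4 unfolding v_def[symmetric] L_def[symmetric] sum_subtractf by linarith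
  qed
  then show ?thesis using C0 by blast
qed

text \<open>Expansion of \<open>A2\<close> bounds \<open>\<bar>v n - a n\<bar>\<close> by the time
  error, and the horizontal times \<open>n - v n\<close> and \<open>n - a n\<close> differ by the
  same amount. Path increments take the square root, which halves the exponent; the losses add up to
  \<open>\<delta> + 3 * \<delta> / 2 \<le> 3 * \<delta>\<close>.\<close>

lemma pathwise_approximation:
  fixes c d :: "nat \<times> nat \<Rightarrow> bool" and u :: "nat \<Rightarrow> real"
  defines "v \<equiv> vert p (walk (coin_row 0 d)) u" and "a \<equiv> \<lambda>n. A2_inv \<gamma>\<^sub>1 \<gamma>\<^sub>2 (\<lambda>s. wiener s d) (real n)"
  assumes T: "tame \<delta> n\<^sub>1 c" "tame \<delta> n\<^sub>2 d" and \<delta>: "0 < \<delta>" "\<delta> \<le> 1/16"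
    and C: "0 \<le> C" and time: "\<forall>\<^sub>F n in sequentially. \<bar>A2 \<gamma>\<^sub>1 \<gamma>\<^sub>2 (\<lambda>s. wiener s d) (real (v n)) - real n\<bar>
      \<le> C * real n powr (5/4 - \<tau>/2 + 3 * \<delta>)"
  shows "(\<lambda>n. \<bar>real_of_int (walk (coin_row 0 c) (n - v n)) - wiener (real n - a n) c\<bar> + \<bar>real_of_int (walk (coin_row 0 d) (v n)) - wiener (a n) d\<bar>)
    \<in> O(\<lambda>n. real n powr (5/8 - \<tau>/4 + 3 * \<delta>))"
proof (rule landau_o.bigI)
  define R where "R = rate \<delta> n\<^sub>1 + rate \<delta> n\<^sub>2"
  define B where "B = 2 * sqrt (C + 1) + 2 * R + 1"
  have R: "0 \<le> R" using rate_nonneg[of \<delta> n\<^sub>1] rate_nonneg[of \<delta> n\<^sub>2] by (simp add: R_def)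
  show "0 < B" using C R by (simp add: B_def add_nonneg_pos)
  have w: "continuous_on {0..} (\<lambda>s. wiener s d)" by (rule continuous_wiener[OF T(2) \<delta>])
  show "\<forall>\<^sub>F n in sequentially. norm (\<bar>real_of_int (walk (coin_row 0 c) (n - v n)) - wiener (real n - a n) c\<bar> + \<bar>real_of_int (walk (coin_row 0 d) (v n)) - wiener (a n) d\<bar>)
    \<le> B * norm (real n powr (5/8 - \<tau>/4 + 3 * \<delta>))"
    using time eventually_ge_at_top[of n\<^sub>1] eventually_ge_at_top[of n\<^sub>2] eventually_ge_at_top[of 1]
  proof eventually_elim
    case (elim n)
    define L where "L = real n powr (5/4 - \<tau>/2 + 3 * \<delta>)"
    define P where "P = real n powr (5/8 - \<tau>/4 + 3 * \<delta>)"
    have n1: "1 \<le> real n" using elim by simp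
    have vn: "v n \<le> n" by (simp add: v_def vert_le)
    have a: "0 \<le> a n" "a n \<le> real n" "A2 \<gamma>\<^sub>1 \<gamma>\<^sub>2 (\<lambda>s. wiener s d) (a n) = real n"
      unfolding a_def by (rule A2_inv[OF \<gamma> w]; simp)+
    have va: "\<bar>real (v n) - a n\<bar> \<le> C * L"
      using A2_expanding[OF \<gamma> w a(1), of "real (v n)"] elim(1) a(3) by (simp add: L_def)
    have L1: "1 \<le> L" unfolding L_def using n1 \<tau> \<delta> by (intro ge_one_powr_ge_zero) auto
    have "sqrt (C * L + 1) \<le> sqrt ((C + 1) * L)"
      using L1 by (intro real_sqrt_le_mono) (simp add: algebra_simps)
    also have "\<dots> = sqrt (C + 1) * real n powr ((5/4 - \<tau>/2 + 3 * \<delta>) / 2)"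
      by (simp add: real_sqrt_mult L_def powr_half_sqrt[symmetric] powr_powr)
    finally have "real n powr \<delta> * sqrt (C * L + 1) \<le> real n powr \<delta> * (sqrt (C + 1) * real n powr ((5/4 - \<tau>/2 + 3 * \<delta>) / 2))"
      by (intro mult_left_mono) auto
    also have "\<dots> = sqrt (C + 1) * real n powr (\<delta> + (5/4 - \<tau>/2 + 3 * \<delta>) / 2)"
      by (simp only: powr_add) (simp add: mult_ac)
    also have "\<dots> \<le> sqrt (C + 1) * P"
      unfolding P_def using C \<delta> n1 by (intro mult_left_mono powr_mono) (auto simp: field_simps)
    finally have q1: "real n powr \<delta> * sqrt (C * L + 1) \<le> sqrt (C + 1) * P" .
    have q2: "real n powr (1/4 + 2 * \<delta>) \<le> P"
      unfolding P_def using \<tau> \<delta> n1 by (intro powr_mono) auto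
    have "\<bar>real_of_int (walk (coin_row 0 d) (v n)) - wiener (a n) d\<bar> \<le> real n powr \<delta> * sqrt (C * L + 1) + 2 * rate \<delta> n\<^sub>2 * real n powr (1/4 + 2 * \<delta>)"
      using elim vn a va by (intro walk_wiener_close[OF T(2) \<delta>]) auto
    moreover have "\<bar>real_of_int (walk (coin_row 0 c) (n - v n)) - wiener (real n - a n) c\<bar> \<le> real n powr \<delta> * sqrt (C * L + 1) + 2 * rate \<delta> n\<^sub>1 * real n powr (1/4 + 2 * \<delta>)"
      using elim vn a va by (intro walk_wiener_close[OF T(1) \<delta>]) (auto simp: of_nat_diff abs_minus_commute)
    moreover have "2 * rate \<delta> n\<^sub>1 * real n powr (1/4 + 2 * \<delta>) + 2 * rate \<delta> n\<^sub>2 * real n powr (1/4 + 2 * \<delta>) \<le> 2 * R * P"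
      using mult_left_mono[OF q2 R] by (simp add: R_def algebra_simps)
    moreover have "0 \<le> P" by (simp add: P_def)
    ultimately show ?case
      using q1 unfolding P_def[symmetric] by (simp add: B_def algebra_simps)
  qed
qed

end

text \<open>The anisotropic walk is driven by the unrefined steps; all further rows of the arrays
  enter the Wiener processes alone.\<close>

definition coarsest :: "(nat \<times> nat \<Rightarrow> bool) \<times> (nat \<times> nat \<Rightarrow> bool) \<times> (nat \<Rightarrow> real) \<Rightarrow> (nat \<Rightarrow> bool) \<times> (nat \<Rightarrow> bool) \<times> (nat \<Rightarrow> real)" where
  "coarsest = (\<lambda>(c, d, u). (coin_row 0 c, coin_row 0 d, u))"

lemma measure_preserving_row: "measure_preserving coins coins (coin_row r)"
  by (simp add: measure_preserving_def distr_row)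

lemma measure_preserving_coarsest: "measure_preserving source drivers coarsest"
proof -
  have "measure_preserving source drivers (\<lambda>(c, x). (coin_row 0 c, (\<lambda>(d, u). (coin_row 0 d, u)) x))"
    by (intro measure_preserving_prod measure_preserving_row measure_preserving_id
      prob_space_pair prob_space_coins prob_space_uniforms)
  moreover have "coarsest = (\<lambda>(c, x). (coin_row 0 c, (\<lambda>(d, u). (coin_row 0 d, u)) x))"
    by (auto simp: coarsest_def fun_eq_iff)
  ultimately show ?thesis by (simp only:)
qed

theorem theorem1p1:
  fixes p :: "int \<Rightarrow> real" and \<gamma>\<^sub>1 \<gamma>\<^sub>2 \<tau> :: real
  assumes "\<And>j. 0 < p j" and "\<And>j. p j \<le> 1 / 2"
    and "\<exists>j. p j < 1 / 2"
    and "1 \<le> \<gamma>\<^sub>2" and "\<gamma>\<^sub>2 < \<gamma>\<^sub>1"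
    and "1 / 2 < \<tau>" and "\<tau> \<le> 1"
    and "(\<lambda>n::nat. (\<Sum>j=1..n. 1 / p (int j)) / real n - 2 * \<gamma>\<^sub>1) \<in> o(\<lambda>n. real n powr (- \<tau>))"
    and "(\<lambda>n::nat. (\<Sum>j=1..n. 1 / p (- int j)) / real n - 2 * \<gamma>\<^sub>2) \<in> o(\<lambda>n. real n powr (- \<tau>))"
  shows "\<exists>(M :: sample_point measure) (C :: nat \<Rightarrow> sample_point \<Rightarrow> int \<times> int)
           (W\<^sub>1 :: real \<Rightarrow> sample_point \<Rightarrow> real) (W\<^sub>2 :: real \<Rightarrow> sample_point \<Rightarrow> real).
    prob_space M \<and> anisotropic_walk M p C \<and>
    wiener_process M W\<^sub>1 \<and> wiener_process M W\<^sub>2 \<and> independent_processes M W\<^sub>1 W\<^sub>2 \<and>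
    (\<forall>\<epsilon>>0. AE \<omega> in M.
      (\<lambda>N::nat.
         \<bar>real_of_int (fst (C N \<omega>)) - W\<^sub>1 (real N - A2_inv \<gamma>\<^sub>1 \<gamma>\<^sub>2 (\<lambda>s. W\<^sub>2 s \<omega>) (real N)) \<omega>\<bar> +
         \<bar>real_of_int (snd (C N \<omega>)) - W\<^sub>2 (A2_inv \<gamma>\<^sub>1 \<gamma>\<^sub>2 (\<lambda>s. W\<^sub>2 s \<omega>) (real N)) \<omega>\<bar>)
      \<in> O(\<lambda>N. real N powr (5 / 8 - \<tau> / 4 + \<epsilon>)))"
proof -
  interpret environment p \<gamma>\<^sub>1 \<gamma>\<^sub>2 \<tau> using assms by unfold_locales
  let ?coins = "coins :: (nat \<times> nat \<Rightarrow> bool) measure"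
  have source_fst: "measure_preserving source ?coins fst"
    by (intro measure_preserving_fst prob_space_pair prob_space_coins prob_space_uniforms)
  have source_snd: "measure_preserving source (?coins \<Otimes>\<^sub>M uniforms) snd"
    by (intro measure_preserving_snd prob_space_pair prob_space_coins prob_space_uniforms)
  have source_mid: "measure_preserving source ?coins (\<lambda>x. fst (snd x))"
    by (intro measure_preserving_compose[OF source_snd] measure_preserving_fst prob_space_uniforms)
  have mp1: "measure_preserving sample_space ?coins (\<lambda>\<omega>. fst (decode \<omega>))"
    by (rule measure_preserving_compose[OF measure_preserving_decode source_fst])
  have mp2: "measure_preserving sample_space ?coins (\<lambda>\<omega>. fst (snd (decode \<omega>)))"
    by (rule measure_preserving_compose[OF measure_preserving_decode source_mid])
  have mp2': "measure_preserving sample_space coins (\<lambda>\<omega>. coin_row 0 (fst (snd (decode \<omega>))))"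
    by (rule measure_preserving_compose[OF mp2 measure_preserving_row])
  have mp3: "measure_preserving sample_space (coins \<Otimes>\<^sub>M uniforms) (\<lambda>\<omega>. (coin_row 0 (fst (snd (decode \<omega>))), snd (snd (decode \<omega>))))"
    using measure_preserving_compose[OF measure_preserving_compose[OF measure_preserving_decode source_snd]
        measure_preserving_prod[OF measure_preserving_row measure_preserving_id prob_space_uniforms]]
    by (simp add: case_prod_beta)
  have approx: "AE \<omega> in sample_space.
      (\<lambda>N::nat.
         \<bar>real_of_int (fst (aniso p N (coarsest (decode \<omega>)))) - wiener (real N - A2_inv \<gamma>\<^sub>1 \<gamma>\<^sub>2 (\<lambda>s. wiener s (fst (snd (decode \<omega>)))) (real N)) (fst (decode \<omega>))\<bar> +
         \<bar>real_of_int (snd (aniso p N (coarsest (decode \<omega>)))) - wiener (A2_inv \<gamma>\<^sub>1 \<gamma>\<^sub>2 (\<lambda>s. wiener s (fst (snd (decode \<omega>)))) (real N)) (fst (snd (decode \<omega>)))\<bar>)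
      \<in> O(\<lambda>N. real N powr (5 / 8 - \<tau> / 4 + \<epsilon>))" if \<epsilon>: "0 < \<epsilon>" for \<epsilon>
  proof -
    \<comment> \<open>The pathwise bound loses \<open>3 * \<delta>\<close> in the exponent; the cap
      \<open>1/16\<close> keeps the level changes of the refined walks summable.\<close>
    define \<delta> where "\<delta> = min (1/16) (\<epsilon> / 3)"
    have \<delta>: "0 < \<delta>" "\<delta> \<le> 1/16" "3 * \<delta> \<le> \<epsilon>" using \<epsilon> by (auto simp: \<delta>_def)
    have \<beta>: "0 \<le> 1 - \<tau>" using assms by simp
    note tame1 = AE_measure_preserving[OF mp1 AE_tame[OF \<delta>(1)]]
    note tame2 = AE_measure_preserving[OF mp2 AE_tame[OF \<delta>(1)]]
    note additive = AE_measure_preserving[OF mp2' AE_additive_functional[OF \<delta>(1) K(2) \<beta> K(1)]]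
    note visits = AE_measure_preserving[OF mp2' AE_visits[OF \<delta>(1)]]
    have "AE (x, u) in coins \<Otimes>\<^sub>M uniforms. \<forall>\<^sub>F n in sequentially.
      \<bar>real n - (\<Sum>k<vert p (walk x) u n. 1 / (2 * p (walk x k)))\<bar>
        \<le> real n powr \<delta> * (sqrt (real n) * ((2 * K + \<gamma>\<^sub>1) * (2 + real n) powr (1 - \<tau>)))"
      by (rule AE_vert[OF assms(1,2) \<delta>(1)]) (rule wait_bound[unfolded wait_def])
    note clock = AE_measure_preserving[OF mp3 this]
    show ?thesis
      using tame1 tame2 additive visits clock
    proof eventually_elim
      case (elim \<omega>)
      \<comment> \<open>On the intersection of the five almost sure events the rest is
        deterministic.\<close>
      obtain c d u where \<omega>: "decode \<omega> = (c, d, u)" by (cases "decode \<omega>")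
      obtain n\<^sub>1 n\<^sub>2 where T: "tame \<delta> n\<^sub>1 c" "tame \<delta> n\<^sub>2 d" using elim(1,2) by (auto simp: \<omega>)
      have "\<exists>C\<ge>0. \<forall>\<^sub>F n in sequentially. \<bar>A2 \<gamma>\<^sub>1 \<gamma>\<^sub>2 (\<lambda>s. wiener s d) (real (vert p (walk (coin_row 0 d)) u n)) - real n\<bar>
        \<le> C * real n powr (5/4 - \<tau>/2 + 3 * \<delta>)"
        using elim(3,4,5) by (intro time_error[OF T(2) \<delta>(1,2)]) (simp_all add: \<omega> wait_def)
      then obtain C where C: "0 \<le> C" "\<forall>\<^sub>F n in sequentially. \<bar>A2 \<gamma>\<^sub>1 \<gamma>\<^sub>2 (\<lambda>s. wiener s d) (real (vert p (walk (coin_row 0 d)) u n)) - real n\<bar>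
        \<le> C * real n powr (5/4 - \<tau>/2 + 3 * \<delta>)" by blast
      have "(\<lambda>n. real n powr (5/8 - \<tau>/4 + 3 * \<delta>)) \<in> O(\<lambda>n. real n powr (5/8 - \<tau>/4 + \<epsilon>))"
      proof (rule landau_o.bigI[of 1])
        show "\<forall>\<^sub>F n in sequentially. norm (real n powr (5/8 - \<tau>/4 + 3 * \<delta>)) \<le> 1 * norm (real n powr (5/8 - \<tau>/4 + \<epsilon>))"
          using eventually_ge_at_top[of 1] by eventually_elim (use \<delta> in \<open>auto intro!: powr_mono\<close>)
      qed simp
      from landau_o.big_trans[OF pathwise_approximation[OF T \<delta>(1,2) C] this]
      show ?case by (simp add: \<omega> coarsest_def aniso_def)
    qed
  qed
  have "anisotropic_walk sample_space p (\<lambda>n \<omega>. aniso p n (coarsest (decode \<omega>)))"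
    by (rule anisotropic_walk_aniso[OF prob_space_sample_space
      measure_preserving_compose[OF measure_preserving_decode measure_preserving_coarsest] assms(1,2)])
  moreover have "wiener_process sample_space (\<lambda>t \<omega>. wiener t (fst (decode \<omega>)))"
    "wiener_process sample_space (\<lambda>t \<omega>. wiener t (fst (snd (decode \<omega>))))"
    using mp1 mp2 unfolding measure_preserving_def
    by (auto intro: wiener_process_measure_preserving[OF prob_space_sample_space _ _ wiener_process_wiener])
  moreover have "independent_processes sample_space (\<lambda>t \<omega>. wiener t (fst (decode \<omega>))) (\<lambda>t \<omega>. wiener t (fst (snd (decode \<omega>))))"
    by (rule independent_processes_wiener[OF prob_space_sample_space measure_preserving_decode])
  ultimately show ?thesis
    using prob_space_sample_space approx by blast
qed

end
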